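(* Let $L$ be the infinitesimal generator of a uniformly bounded $C_0$-semigroup $\{e^{tL}\}_{t\geq0}$ on a Banach space $X$. Then, for any $u\in D(L)$, $$\log(-L)u=\lim_{s\to0^+}\frac{1}{\Gamma(1-s)}\int_0^\infty\frac{e^{-t}u-e^{tL}u}{t^{1+s}}\,dt.$$ Therefore, at least formally, $$\log(-L)u=\int_0^\infty\frac{e^{-t}u-e^{tL}u}{t}\,dt.$$
   Context: $X$ is a Banach space with norm $\|\cdot\|_X$, operator norm $\|\cdot\|$ and identity operator $I$; $\Gamma$ is the Gamma function, and integrals of $X$-valued functions are Bochner integrals. A $C_0$-semigroup $\{e^{tL}\}_{t\ge0}$ on $X$ is a family of bounded linear operators with $e^{0L}=I$, $e^{t_1L}e^{t_2L}=e^{(t_1+t_2)L}$ for all $t_1,t_2\ge0$, and $\lim_{t\to0}e^{tL}u=u$ for all $u\in X$; its infinitesimal generator is $Lu=\lim_{t\to0}(e^{tL}u-u)/t$, with domain $D(L)$ the set of $u\in X$ for which this limit exists in $X$. The semigroup is uniformly bounded if there is $M>0$ with $\|e^{tL}u\|_X\le M\|u\|_X$ for all $u\in X$, $t\ge0$. In this case $A=-L$ is a nonnegative operator, i.e. for every $\mu>0$ the operator $\mu I+A:D(A)\to X$ has a bounded inverse on $X$, and $\sup_{\mu>0}\|\mu(\mu I+A)^{-1}\|<\infty$. Fractional powers $A^s$, $0<s<1$, of a nonnegative operator $A$ (only small $s$ is needed here): (a) if $A$ is bounded, $A^su=\frac{\sin(s\pi)}{\pi}\int_0^\infty\mu^{s-1}(\mu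 I+A)^{-1}Au\,d\mu$ for $u\in D(A)$; (b) if $A$ is unbounded and has a bounded inverse on $X$, $A^s=[(A^{-1})^s]^{-1}$; (c) if $A$ is unbounded and does not have a bounded inverse on $X$, $A^su=\lim_{\varepsilon\to0^+}(A+\varepsilon I)^su$, with $D(A^s)$ the set of all $u$ that belong to $D((A+\varepsilon I)^s)$ for all $\varepsilon>0$ close to zero and for which the limit exists in $X$. The logarithm of a nonnegative operator $A$ is $\log(A)u=\frac{d}{ds}A^su\big|_{s=0}=\lim_{s\to0^+}\frac1s(A^su-u)$, with domain $D(\log(A))$ the set of $u\in X$ for which this limit exists in $X$. *)

theory Defs
  imports "HOL-Analysis.Analysis"
begin

section \<open>Bochner integral in an arbitrary normed space\<close>

text \<open>
  The library's integral for vector-valued functions needs a second-countable, i.e. separable,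
  codomain. The definition below is the usual one without that restriction: Borel measurability
  of the integrand is replaced by strong measurability (almost everywhere a pointwise limit of
  simple functions). The simple functions and their integrals are those of the library.
\<close>

definition has_bint :: "'b measure \<Rightarrow> ('b \<Rightarrow> 'a::real_normed_vector) \<Rightarrow> 'a \<Rightarrow> bool" where
  "has_bint M f w \<longleftrightarrow> (\<exists>s. (\<forall>i::nat. Bochner_Integration.simple_bochner_integrable M (s i)) \<and>
     (AE x in M. (\<lambda>i. s i x) \<longlonglongrightarrow> f x) \<and>
     (\<lambda>i. \<integral>\<^sup>+ x. ennreal (norm (f x - s i x)) \<partial>M) \<longlonglongrightarrow> 0 \<and>
     (\<lambda>i. Bochner_Integration.simple_bochner_integral M (s i)) \<longlonglongrightarrow> w)"

lemma has_bint_unique: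
  fixes f :: "'b \<Rightarrow> 'a::real_normed_vector"
  assumes "has_bint M f v" and "has_bint M f w"
  shows "v = w"
proof -
  let ?I = "Bochner_Integration.simple_bochner_integral M"
  obtain s where s: "\<And>i::nat. Bochner_Integration.simple_bochner_integrable M (s i)"
    and s_lim: "AE x in M. (\<lambda>i. s i x) \<longlonglongrightarrow> f x"
    and s_L1: "(\<lambda>i. \<integral>\<^sup>+ x. ennreal (norm (f x - s i x)) \<partial>M) \<longlonglongrightarrow> 0"
    and s_int: "(\<lambda>i. ?I (s i)) \<longlonglongrightarrow> v"
    using assms(1) unfolding has_bint_def by auto
  obtain t where t: "\<And>i::nat. Bochner_Integration.simple_bochner_integrable M (t i)"
    and t_L1: "(\<lambda>i. \<integral>\<^sup>+ x. ennreal (norm (f x - t i x)) \<partial>M) \<longlonglongrightarrow> 0"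
    and t_int: "(\<lambda>i. ?I (t i)) \<longlonglongrightarrow> w"
    using assms(2) unfolding has_bint_def by auto
  let ?dst = "\<lambda>p q x. ennreal (norm (p x - q x))"
  have meas: "?dst p q \<in> borel_measurable M"
    if "Bochner_Integration.simple_bochner_integrable M p" "Bochner_Integration.simple_bochner_integrable M q" for p q :: "'b \<Rightarrow> 'a"
    using simple_bochner_integrable_compose2[of "\<lambda>x y. norm (x - y)" M p q] that
    by (auto elim!: simple_bochner_integrable.cases intro!: measurable_compose[OF _ measurable_ennreal]
        borel_measurable_simple_function)
  have approx: "\<exists>g \<in> borel_measurable M. AE x in M. ?dst f p x = g x"
    if p: "Bochner_Integration.simple_bochner_integrable M p" for p
  proof
    show "(\<lambda>x. liminf (\<lambda>j. ?dst (s j) p x)) \<in> borel_measurable M"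
      using meas[OF s p] by measurable
    show "AE x in M. ?dst f p x = liminf (\<lambda>j. ?dst (s j) p x)"
      using s_lim
    proof eventually_elim
      case (elim x)
      have "(\<lambda>j. ?dst (s j) p x) \<longlonglongrightarrow> ?dst f p x"
        by (intro tendsto_ennrealI tendsto_norm tendsto_diff elim tendsto_const)
      then show ?case
        using lim_imp_Liminf[OF sequentially_bot] by metis
    qed
  qed
  have bound: "ennreal (norm (?I (s i) - ?I (t i)))
      \<le> (\<integral>\<^sup>+ x. ?dst f (s i) x \<partial>M) + (\<integral>\<^sup>+ x. ?dst f (t i) x \<partial>M)" for i
  proof -
    obtain g where g: "g \<in> borel_measurable M" "AE x in M. ?dst f (s i) x = g x"
      using approx[OF s] by blast
    obtain h where h: "h \<in> borel_measurable M" "AE x in M. ?dst f (t i) x = h x"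
      using approx[OF t] by blast
    have "ennreal (norm (?I (s i) - ?I (t i)))
        = ennreal (norm (?I (\<lambda>x. s i x - t i x)))"
      using s t by (subst simple_bochner_integral_diff) auto
    also have "\<dots> \<le> ennreal (?I (\<lambda>x. norm (s i x - t i x)))"
      using simple_bochner_integrable_compose2[of "(-)" M "s i" "t i"] s t
      by (intro ennreal_leI simple_bochner_integral_norm_bound) auto
    also have "\<dots> = (\<integral>\<^sup>+ x. ?dst (s i) (t i) x \<partial>M)"
      using simple_bochner_integrable_compose2[of "\<lambda>x y. norm (x - y)" M "s i" "t i"] s t
      by (intro simple_bochner_integral_eq_nn_integral) auto
    also have "\<dots> \<le> (\<integral>\<^sup>+ x. g x + h x \<partial>M)"
    proof (rule nn_integral_mono_AE)
      show "AE x in M. ?dst (s i) (t i) x \<le> g x + h x"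
        using g(2) h(2)
      proof eventually_elim
        case (elim x)
        have "norm (s i x - t i x) \<le> norm (f x - s i x) + norm (f x - t i x)"
          by (metis dual_order.refl norm_diff_triangle_le norm_minus_commute)
        then have "?dst (s i) (t i) x \<le> ?dst f (s i) x + ?dst f (t i) x"
          by (metis ennreal_leI ennreal_plus norm_ge_zero)
        then show ?case using elim by simp
      qed
    qed
    also have "\<dots> = (\<integral>\<^sup>+ x. g x \<partial>M) + (\<integral>\<^sup>+ x. h x \<partial>M)"
      using g h by (intro nn_integral_add)
    also have "(\<integral>\<^sup>+ x. g x \<partial>M) = (\<integral>\<^sup>+ x. ?dst f (s i) x \<partial>M)"
      using g(2) by (intro nn_integral_cong_AE) auto
    also have "(\<integral>\<^sup>+ x. h x \<partial>M) = (\<integral>\<^sup>+ x. ?dst f (t i) x \<partial>M)"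
      using h(2) by (intro nn_integral_cong_AE) auto
    finally show ?thesis .
  qed
  have "(\<lambda>i. ennreal (norm (?I (s i) - ?I (t i)))) \<longlonglongrightarrow> ennreal 0"
  proof (rule tendsto_sandwich[where f = "\<lambda>_. 0"])
    show "(\<lambda>i. (\<integral>\<^sup>+ x. ?dst f (s i) x \<partial>M) + (\<integral>\<^sup>+ x. ?dst f (t i) x \<partial>M)) \<longlonglongrightarrow> ennreal 0"
      using tendsto_add[OF s_L1 t_L1] by simp
  qed (use bound in auto)
  then have "(\<lambda>i. norm (?I (s i) - ?I (t i))) \<longlonglongrightarrow> 0"
    by (subst (asm) tendsto_ennreal_iff) auto
  moreover have "(\<lambda>i. norm (?I (s i) - ?I (t i))) \<longlonglongrightarrow> norm (v - w)"
    by (intro tendsto_norm tendsto_diff s_int t_int)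
  ultimately have "norm (v - w) = 0"
    using LIMSEQ_unique by blast
  then show "v = w" by simp
qed

lemma has_bint_imp_has_bochner_integral:
  fixes f :: "'b \<Rightarrow> 'a::{real_normed_vector, second_countable_topology}"
  assumes "has_bint M f w" and "f \<in> borel_measurable M"
  shows "has_bochner_integral M f w"
  using assms unfolding has_bint_def by (blast intro: has_bochner_integral.intros)

text \<open>Integrals over the half-line \<open>(0, \<infinity>)\<close> with respect to Lebesgue measure.\<close>

definition has_bint_Ioi :: "(real \<Rightarrow> 'a::real_normed_vector) \<Rightarrow> 'a \<Rightarrow> bool" where
  "has_bint_Ioi f w \<longleftrightarrow> has_bint lborel (\<lambda>t. indicat_real {0<..} t *\<^sub>R f t) w"

definition bintegrable_Ioi :: "(real \<Rightarrow> 'a::real_normed_vector) \<Rightarrow> bool" where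
  "bintegrable_Ioi f \<longleftrightarrow> (\<exists>w. has_bint_Ioi f w)"

definition bint_Ioi :: "(real \<Rightarrow> 'a::real_normed_vector) \<Rightarrow> 'a" where
  "bint_Ioi f = (THE w. has_bint_Ioi f w)"

lemma bint_Ioi_eq: "has_bint_Ioi f w \<Longrightarrow> bint_Ioi f = w"
  unfolding bint_Ioi_def has_bint_Ioi_def by (blast intro: has_bint_unique)


section \<open>Partially defined operators\<close>

text \<open>
  A partially defined operator is represented by its graph: the domain is \<^const>\<open>Domain\<close>, and
  the inverse is the converse relation.
\<close>

type_synonym 'a operator = "('a \<times> 'a) set"

definition op_app :: "'a operator \<Rightarrow> 'a \<Rightarrow> 'a" where
  "op_app A u = (THE v. (u, v) \<in> A)"

definition neg_op :: "'a::real_normed_vector operator \<Rightarrow> 'a operator" where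
  "neg_op A = {(u, - v) | u v. (u, v) \<in> A}"

text \<open>The operator \<open>\<mu>I + A\<close>.\<close>

definition shift_op :: "real \<Rightarrow> 'a::real_normed_vector operator \<Rightarrow> 'a operator" where
  "shift_op \<mu> A = {(u, \<mu> *\<^sub>R u + v) | u v. (u, v) \<in> A}"

definition bounded_op :: "'a::real_normed_vector operator \<Rightarrow> bool" where
  "bounded_op A \<longleftrightarrow> (\<exists>K. \<forall>(u, v) \<in> A. norm v \<le> K * norm u)"

definition has_bounded_inverse :: "'a::real_normed_vector operator \<Rightarrow> bool" where
  "has_bounded_inverse A \<longleftrightarrow> (\<exists>B. bounded_linear B \<and> A\<inverse> = {(w, B w) | w. True})"


section \<open>Fractional powers and logarithm of a nonnegative operator\<close>

text \<open>
  The three definitions below are meant for nonnegative operators and, for the fractional powers,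
  for exponents \<open>0 < s < 1\<close>. For a bounded nonnegative operator the integral always exists, so
  that the domain of \<open>balakrishnan_power A s\<close> is that of \<open>A\<close>.
\<close>

definition balakrishnan_power :: "'a::real_normed_vector operator \<Rightarrow> real \<Rightarrow> 'a operator" where
  "balakrishnan_power A s =
     {(u, (sin (s * pi) / pi) *\<^sub>R w) | u w. u \<in> Domain A \<and>
        has_bint_Ioi (\<lambda>\<mu>. (\<mu> powr (s - 1)) *\<^sub>R op_app ((shift_op \<mu> A)\<inverse>) (op_app A u)) w}"

text \<open>
  In the last case \<open>A + \<epsilon>I\<close> is itself unbounded and has a bounded inverse, so its power is the
  one of the second case.
\<close>

definition frac_power :: "'a::real_normed_vector operator \<Rightarrow> real \<Rightarrow> 'a operator" where
  "frac_power A s =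
     (if bounded_op A then balakrishnan_power A s
      else if has_bounded_inverse A then (balakrishnan_power (A\<inverse>) s)\<inverse>
      else (let P = (\<lambda>\<epsilon>. (balakrishnan_power ((shift_op \<epsilon> A)\<inverse>) s)\<inverse>)
            in {(u, v). (\<forall>\<^sub>F \<epsilon> in at_right 0. u \<in> Domain (P \<epsilon>)) \<and>
                        ((\<lambda>\<epsilon>. op_app (P \<epsilon>) u) \<longlongrightarrow> v) (at_right 0)}))"

definition log_op :: "'a::real_normed_vector operator \<Rightarrow> 'a operator" where
  "log_op A =
     {(u, v). (\<forall>\<^sub>F s in at_right 0. u \<in> Domain (frac_power A s)) \<and>
              ((\<lambda>s. (1 / s) *\<^sub>R (op_app (frac_power A s) u - u)) \<longlongrightarrow> v) (at_right 0)}"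


section \<open>Strongly continuous semigroups\<close>

text \<open>Only the values \<open>T t\<close> for \<open>t \<ge> 0\<close> are relevant.\<close>

definition C0_semigroup :: "(real \<Rightarrow> 'a::real_normed_vector \<Rightarrow> 'a) \<Rightarrow> bool" where
  "C0_semigroup T \<longleftrightarrow>
     (\<forall>t\<ge>0. bounded_linear (T t)) \<and>
     (\<forall>u. T 0 u = u) \<and>
     (\<forall>t1\<ge>0. \<forall>t2\<ge>0. \<forall>u. T t1 (T t2 u) = T (t1 + t2) u) \<and>
     (\<forall>u. ((\<lambda>t. T t u) \<longlongrightarrow> u) (at_right 0))"

definition uniformly_bounded_semigroup :: "(real \<Rightarrow> 'a::real_normed_vector \<Rightarrow> 'a) \<Rightarrow> bool" where
  "uniformly_bounded_semigroup T \<longleftrightarrow> (\<exists>M>0. \<forall>u. \<forall>t\<ge>0. norm (T t u) \<le> M * norm u)"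

definition inf_generator :: "(real \<Rightarrow> 'a::real_normed_vector \<Rightarrow> 'a) \<Rightarrow> 'a operator" where
  "inf_generator T = {(u, v). ((\<lambda>t. (1 / t) *\<^sub>R (T t u - u)) \<longlongrightarrow> v) (at_right 0)}"

end

(*
  For u in D(A), A = -L, write the resolvent (mu + A)^-1 as the Laplace transform of the semigroup.
  Then (mu + A)^-1 A u = mu * int e^(-mu t) (u - T_t u) dt, and Fubini turns Balakrishnan's integral
  into w_s = s / Gamma(1 - s) * int t^(-1-s) (u - T_t u) dt; the same identity for the numbers
  e^(-t) gives (w_s - u) / s = 1 / Gamma(1 - s) * int t^(-1-s) (e^(-t) u - T_t u) dt.  It remains to
  see that A^s u = w_s in each of the three cases of the definition.  For bounded A this is
  Balakrishnan's formula.  If A has a bounded inverse, put Q_s = int x^(-s) (x + A)^-1 dx.  Then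
  (A^-1)^s = sin(pi s) / pi * Q_s and w_s = sin(pi s) / pi * Q_(1-s) A u, so the claim is
  Q_s Q_(1-s) = (pi / sin(pi s))^2 A^-1, which by the resolvent identity is a double integral of
  difference quotients of the resolvent.  The last case follows by letting eps tend to 0 in
  the second one for the semigroup e^(-eps t) T_t.

  Since X need not be separable, identities between vector-valued integrals are tested with
  functionals from the Hahn-Banach theorem, which reduces them to Fubini for real functions.
*)

theory Submission
  imports Defs "HOL-Real_Asymp.Real_Asymp"
begin

section \<open>Functionals and Bochner integrals\<close>

text \<open>None of the three cases of \<open>frac_power\<close> mentions the semigroup. The formula
  for w_s can serve as their common value because it makes sense for every u in D(A): there u - T_t
  u is O(t) at 0 and bounded at infinity, exactly what the weight t^(-1-s) with 0 < s < 1 asks for.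
  In the invertible case the power is given only as the converse of a relation, so membership and
  uniqueness both have to be shown. The product formula for Q_s and Q_(1-s) serves twice: it
  evaluates Q_s w_s and, with s and 1 - s exchanged, it makes Q_s injective. The term e^(-t) u comes
  from the operator I, all of whose powers are I: it supplies the - u in (A^s u - u) / s, and the
  factor s, common to both formulas, cancels. As s tends to 0 the kernel loses decay at infinity,
  where T_t u is only known to be bounded. Hence the limit need not exist, and the closed formula is
  proved under integrability of its integrand.\<close>

lemma norming_functional:
  fixes v :: "'a::real_normed_vector"
  obtains \<phi> :: "'a \<Rightarrow> real"
  where "linear \<phi>" "\<And>x. \<bar>\<phi> x\<bar> \<le> norm x" "\<phi> v = norm v"
proof -
  define \<A> :: "('a \<times> real) set set" where
    "\<A> = {G. subspace G \<and> (v, norm v) \<in> G \<and> (\<forall>x r. (x, r) \<in> G \<longrightarrow> r \<le> norm x)}"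
  have "\<exists>M\<in>\<A>. \<forall>X\<in>\<A>. M \<subseteq> X \<longrightarrow> X = M"
  proof (rule subset_Zorn_nonempty)
    have "span {(v, norm v)} \<in> \<A>"
      unfolding \<A>_def
    proof (intro CollectI conjI allI impI)
      fix x r assume "(x, r) \<in> span {(v, norm v)}"
      then obtain c where "x = c *\<^sub>R v" "r = c * norm v"
        by (auto simp: span_singleton)
      then show "r \<le> norm x" by (simp add: mult_right_mono)
    qed (auto simp: span_base)
    then show "\<A> \<noteq> {}" by blast
  next
    fix \<C> assume ne: "\<C> \<noteq> {}" and "subset.chain \<A> \<C>"
    then have sub: "\<C> \<subseteq> \<A>" and lin: "\<And>X Y. X \<in> \<C> \<Longrightarrow> Y \<in> \<C> \<Longrightarrow> X \<subseteq> Y \<or> Y \<subseteq> X"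
      by (auto simp: subset_chain_def)
    have "subspace (\<Union>\<C>)"
    proof (rule subspaceI)
      obtain X where "X \<in> \<C>" using ne by blast
      moreover have "0 \<in> X" using \<open>X \<in> \<C>\<close> sub by (auto simp: \<A>_def intro!: subspace_0)
      ultimately show "0 \<in> \<Union>\<C>" by blast
      fix x y assume "x \<in> \<Union>\<C>" "y \<in> \<Union>\<C>"
      then obtain X Y where XY: "X \<in> \<C>" "Y \<in> \<C>" "x \<in> X" "y \<in> Y" by blast
      with lin[of X Y] obtain Z where "Z \<in> \<C>" "x \<in> Z" "y \<in> Z" by blast
      with sub show "x + y \<in> \<Union>\<C>" by (auto simp: \<A>_def intro!: bexI[of _ Z] subspace_add)
    next
      fix c x assume "x \<in> \<Union>\<C>"
      then show "c *\<^sub>R x \<in> \<Union>\<C>" using sub by (auto simp: \<A>_def intro: subspace_scale)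
    qed
    with ne sub show "\<Union>\<C> \<in> \<A>" unfolding \<A>_def by blast
  qed
  then obtain M where "M \<in> \<A>" and max: "\<And>X. X \<in> \<A> \<Longrightarrow> M \<subseteq> X \<Longrightarrow> X = M" by blast
  then have M: "subspace M" "(v, norm v) \<in> M" and le: "\<And>x r. (x, r) \<in> M \<Longrightarrow> r \<le> norm x"
    by (auto simp: \<A>_def)
  have add: "(x + y, r + q) \<in> M" if "(x, r) \<in> M" "(y, q) \<in> M" for x y r q
    using subspace_add[OF M(1) that] by simp
  have scale: "(c *\<^sub>R x, c * r) \<in> M" if "(x, r) \<in> M" for x r c
    using subspace_scale[OF M(1) that, of c] by simp
  have ex: "\<exists>r. (x, r) \<in> M" for x
  proof (rule ccontr)
    assume nex: "\<nexists>r. (x, r) \<in> M"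
    let ?S = "(\<lambda>(y, r). r - norm (y - x)) ` M"
    \<comment> \<open>A value \<alpha> at the new vector \<open>x\<close> has to satisfy r - norm (y
      - x) \<le> \<alpha> \<le> norm (z + x) - q for all (y, r) and (z, q) in \<open>M\<close>.
      Every lower bound lies below every upper bound, so the supremum of the lower ones is
      admissible.\<close>
    have gap: "r - norm (y - x) \<le> norm (z + x) - q" if "(y, r) \<in> M" "(z, q) \<in> M" for y z r q
    proof -
      have "r + q \<le> norm ((y - x) + (z + x))" using le[OF add[OF that]] by simp
      then show ?thesis using norm_triangle_ineq[of "y - x" "z + x"] by linarith
    qed
    define \<alpha> where "\<alpha> = Sup ?S"
    have bdd: "bdd_above ?S"
      using gap M(2) by (intro bdd_aboveI[of _ "norm (v + x) - norm v"]) auto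
    have lo: "r - norm (y - x) \<le> \<alpha>" if "(y, r) \<in> M" for y r
      unfolding \<alpha>_def using that by (intro cSup_upper[OF _ bdd]) force
    have hi: "\<alpha> \<le> norm (z + x) - q" if "(z, q) \<in> M" for z q
      unfolding \<alpha>_def using gap that M(2) by (intro cSup_least) auto
    let ?N = "{a + b | a b. a \<in> M \<and> b \<in> span {(x, \<alpha>)}}"
    have MN: "M \<subseteq> ?N"
    proof
      fix a assume "a \<in> M"
      then show "a \<in> ?N" by (intro CollectI exI[of _ a] exI[of _ 0]) (auto simp: span_zero)
    qed
    have "?N \<in> \<A>"
      unfolding \<A>_def
    proof (rule CollectI, intro conjI allI impI)
      show "subspace ?N" by (intro subspace_sums M) simp
      show "(v, norm v) \<in> ?N" using M(2) MN by blast
      fix w p assume "(w, p) \<in> ?N"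
      then obtain y r c where yr: "(y, r) \<in> M" "w = y + c *\<^sub>R x" "p = r + c * \<alpha>"
        by (auto simp: span_singleton)
      \<comment> \<open>Dividing the element of \<open>M\<close> by the absolute value of c reduces
        the claim to the coefficients 1 and -1, which are \<open>hi\<close> and
        \<open>lo\<close>.\<close>
      consider "c = 0" | "c > 0" | "c < 0" by linarith
      then show "p \<le> norm w"
      proof cases
        case 1 then show ?thesis using yr le by simp
      next
        case 2
        have "c * \<alpha> \<le> c * (norm ((1 / c) *\<^sub>R y + x) - (1 / c) * r)"
          using 2 hi[OF scale[OF yr(1), of "1 / c"]] by (intro mult_left_mono) auto
        also have "\<dots> = norm (c *\<^sub>R ((1 / c) *\<^sub>R y + x)) - r"
          using 2 by (simp add: right_diff_distrib)
        also have "c *\<^sub>R ((1 / c) *\<^sub>R y + x) = w" using 2 yr by (simp add: scaleR_add_right)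
        finally show ?thesis using yr by simp
      next
        case 3
        define d where "d = - c"
        have d: "d > 0" using 3 by (simp add: d_def)
        have w: "d *\<^sub>R ((1 / d) *\<^sub>R y - x) = w"
          using d yr by (simp add: scaleR_diff_right d_def)
        have "r - norm w = d * ((1 / d) * r - norm ((1 / d) *\<^sub>R y - x))"
          using d by (simp add: right_diff_distrib flip: w)
        also have "\<dots> \<le> d * \<alpha>"
          using d lo[OF scale[OF yr(1), of "1 / d"]] by (intro mult_left_mono) auto
        finally show ?thesis using yr(3) by (simp add: d_def)
      qed
    qed
    then have "?N = M" using MN by (rule max)
    moreover have "(x, \<alpha>) \<in> ?N"
      by (intro CollectI exI[of _ 0] exI[of _ "(x, \<alpha>)"])
        (auto simp: span_base subspace_0[OF M(1)])
    ultimately show False using nex by blast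
  qed
  have unique: "r = q" if "(x, r) \<in> M" "(x, q) \<in> M" for x r q
    using le[OF add[OF that(1) scale[OF that(2), of "-1"]]]
      le[OF add[OF that(2) scale[OF that(1), of "-1"]]] by simp
  define \<phi> where "\<phi> x = (THE r. (x, r) \<in> M)" for x
  have \<phi>: "(x, \<phi> x) \<in> M" for x
    unfolding \<phi>_def using ex[of x] unique by (metis theI)
  have \<phi>_eq: "\<phi> x = r" if "(x, r) \<in> M" for x r
    using unique[OF \<phi> that] .
  show thesis
  proof
    show "linear \<phi>" by (rule linearI) (auto intro!: \<phi>_eq add scale \<phi>)
    show "\<phi> v = norm v" by (intro \<phi>_eq M)
    show "\<bar>\<phi> x\<bar> \<le> norm x" for x
      using le[OF \<phi>[of x]] le[OF scale[OF \<phi>[of x], of "-1"]] by simp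
  qed
qed

lemma eq_by_functionals:
  fixes a b :: "'a::real_normed_vector"
  assumes "\<And>\<phi> :: 'a \<Rightarrow> real. linear \<phi> \<Longrightarrow> (\<And>x. \<bar>\<phi> x\<bar> \<le> norm x) \<Longrightarrow> \<phi> a = \<phi> b"
  shows "a = b"
proof -
  obtain \<phi> :: "'a \<Rightarrow> real"
    where \<phi>: "linear \<phi>" "\<And>x. \<bar>\<phi> x\<bar> \<le> norm x" "\<phi> (a - b) = norm (a - b)"
    by (rule norming_functional[of "a - b"]) blast
  then show ?thesis using assms[OF \<phi>(1,2)] by (simp add: linear_diff)
qed

lemma norm_le_by_functionals:
  fixes a :: "'a::real_normed_vector"
  assumes "\<And>\<phi> :: 'a \<Rightarrow> real. linear \<phi> \<Longrightarrow> (\<And>x. \<bar>\<phi> x\<bar> \<le> norm x) \<Longrightarrow> \<phi> a \<le> K"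
  shows "norm a \<le> K"
  by (metis assms norming_functional[of a])

section \<open>Integrability from continuity and a majorant\<close>

lemma has_bint_of_dominated_approximation:
  fixes f :: "'b \<Rightarrow> 'a::banach" and d :: "nat \<Rightarrow> 'b \<Rightarrow> real"
  assumes s: "\<And>i. Bochner_Integration.simple_bochner_integrable M (s i)"
    and lim: "AE x in M. (\<lambda>i. s i x) \<longlonglongrightarrow> f x"
    and meas [measurable]: "\<And>i. d i \<in> borel_measurable M"
    and le: "\<And>i x. norm (f x - s i x) \<le> d i x"
    and d: "(\<lambda>i. \<integral>\<^sup>+ x. ennreal (d i x) \<partial>M) \<longlonglongrightarrow> 0"
  shows "\<exists>w. has_bint M f w"
proof -
  let ?I = "Bochner_Integration.simple_bochner_integral M"
  let ?D = "\<lambda>i. \<integral>\<^sup>+ x. ennreal (d i x) \<partial>M"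
  have d_nonneg: "0 \<le> d i x" for i x
    using le[where i = i and x = x] norm_ge_zero order_trans by blast
  have bound: "ennreal (norm (?I (s i) - ?I (s j))) \<le> ?D i + ?D j" for i j
  proof -
    have "ennreal (norm (?I (s i) - ?I (s j)))
        = ennreal (norm (?I (\<lambda>x. s i x - s j x)))"
      using s by (subst simple_bochner_integral_diff) auto
    also have "\<dots> \<le> ennreal (?I (\<lambda>x. norm (s i x - s j x)))"
      using simple_bochner_integrable_compose2[of "(-)" M "s i" "s j"] s
      by (intro ennreal_leI simple_bochner_integral_norm_bound) auto
    also have "\<dots> = (\<integral>\<^sup>+ x. ennreal (norm (s i x - s j x)) \<partial>M)"
      using simple_bochner_integrable_compose2[of "\<lambda>x y. norm (x - y)" M "s i" "s j"] s
      by (intro simple_bochner_integral_eq_nn_integral) auto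
    also have "\<dots> \<le> (\<integral>\<^sup>+ x. ennreal (d i x) + ennreal (d j x) \<partial>M)"
    proof (rule nn_integral_mono)
      fix x
      have "norm (s i x - s j x) \<le> norm (f x - s i x) + norm (f x - s j x)"
        by (metis dual_order.refl norm_diff_triangle_le norm_minus_commute)
      also have "\<dots> \<le> d i x + d j x" by (intro add_mono le)
      finally show "ennreal (norm (s i x - s j x)) \<le> ennreal (d i x) + ennreal (d j x)"
        by (simp add: d_nonneg ennreal_leI flip: ennreal_plus)
    qed
    \<comment> \<open>Additivity of the upper-level integrals is used for the measurable majorants
      \<open>d i\<close>, not for norm (f x - s i x), whose measurability is not assumed.\<close>
    also have "\<dots> = ?D i + ?D j" by (rule nn_integral_add) auto
    finally show ?thesis .
  qed
  have "Cauchy (\<lambda>i. ?I (s i))"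
  proof (rule metric_CauchyI)
    fix e :: real assume "0 < e"
    then have "0 < ennreal (e / 2)" by simp
    with d have "\<forall>\<^sub>F i in sequentially. ?D i < ennreal (e / 2)" by (rule order_tendstoD(2))
    then obtain N where N: "\<And>i. i \<ge> N \<Longrightarrow> ?D i < ennreal (e / 2)"
      by (auto simp: eventually_sequentially)
    have "dist (?I (s i)) (?I (s j)) < e" if "i \<ge> N" "j \<ge> N" for i j
    proof -
      have "ennreal (norm (?I (s i) - ?I (s j))) < ennreal (e / 2) + ennreal (e / 2)"
        using bound add_strict_mono[OF N[OF that(1)] N[OF that(2)]] by (rule le_less_trans)
      also have "\<dots> = ennreal e" using \<open>0 < e\<close> by (simp flip: ennreal_plus)
      finally show ?thesis by (simp add: dist_norm ennreal_less_iff)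
    qed
    then show "\<exists>N. \<forall>i\<ge>N. \<forall>j\<ge>N. dist (?I (s i)) (?I (s j)) < e" by blast
  qed
  then obtain w where w: "(\<lambda>i. ?I (s i)) \<longlonglongrightarrow> w"
    using Cauchy_convergent convergent_def by blast
  have "(\<lambda>i. \<integral>\<^sup>+ x. ennreal (norm (f x - s i x)) \<partial>M) \<longlonglongrightarrow> 0"
    by (rule tendsto_sandwich[OF _ _ tendsto_const d])
      (auto intro!: always_eventually nn_integral_mono ennreal_leI le)
  with s lim w show ?thesis unfolding has_bint_def by blast
qed

text \<open>Sampling \<open>f\<close> at the left end of each cell of a mesh of width 1 / N leaves
  finitely many values, and uniform continuity bounds the error.\<close>

lemma simple_approximation_Icc:
  fixes f :: "real \<Rightarrow> 'a::real_normed_vector"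
  assumes cont: "continuous_on {a..b} f" and "0 < e"
  obtains s where "Bochner_Integration.simple_bochner_integrable lborel s"
    "\<And>t. t \<in> {a..b} \<Longrightarrow> norm (f t - s t) \<le> e" "\<And>t. t \<notin> {a..b} \<Longrightarrow> s t = 0"
proof -
  have "uniformly_continuous_on {a..b} f"
    using cont by (intro compact_uniformly_continuous) auto
  then obtain \<delta> where "\<delta> > 0"
    and \<delta>: "\<And>x y. x \<in> {a..b} \<Longrightarrow> y \<in> {a..b} \<Longrightarrow> dist y x < \<delta> \<Longrightarrow> dist (f y) (f x) < e"
    using \<open>0 < e\<close> unfolding uniformly_continuous_on_def by metis
  obtain N where "N > 0" and N: "1 / real N < \<delta>"
    using \<open>\<delta> > 0\<close> by (metis nat_approx_posE inverse_eq_divide zero_less_Suc)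
  \<comment> \<open>\<open>s\<close> will be a function of the integer-valued \<open>c\<close>, so
    only \<open>c\<close> has to be measurable. The value just below the first cell index marks the
    points outside the interval.\<close>
  define c where "c t = (if t \<in> {a..b} then \<lfloor>t * real N\<rfloor> else \<lfloor>a * real N\<rfloor> - 1)" for t
  \<comment> \<open>The \<open>max\<close> moves the sample point of the first cell back into the
    interval, the only place where \<open>f\<close> is controlled.\<close>
  define s where "s t = (if t \<in> {a..b} then f (max a (of_int \<lfloor>t * real N\<rfloor> / real N)) else 0)" for t
  have "simple_function lborel c"
    unfolding simple_function_def
  proof (intro conjI ballI)
    have "\<lfloor>a * real N\<rfloor> \<le> \<lfloor>t * real N\<rfloor>" "\<lfloor>t * real N\<rfloor> \<le> \<lfloor>b * real N\<rfloor>" if "t \<in> {a..b}" for t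
      using that by (auto intro!: floor_mono mult_right_mono)
    then have "range c \<subseteq> {\<lfloor>a * real N\<rfloor> - 1..max (\<lfloor>a * real N\<rfloor> - 1) \<lfloor>b * real N\<rfloor>}"
      by (fastforce simp: c_def)
    then show "finite (c ` space lborel)" by (auto intro: finite_subset)
    have "c \<in> measurable lborel (count_space UNIV)" unfolding c_def by measurable
    then show "c -` {x} \<inter> space lborel \<in> sets lborel" for x
      by (rule measurable_sets) auto
  qed
  then have "simple_function lborel
      ((\<lambda>k. if k < \<lfloor>a * real N\<rfloor> then 0 else f (max a (of_int k / real N))) \<circ> c)"
    by (rule simple_function_compose)
  also have "(\<lambda>k. if k < \<lfloor>a * real N\<rfloor> then 0 else f (max a (of_int k / real N))) \<circ> c = s"
  proof
    fix t
    have "\<lfloor>a * real N\<rfloor> \<le> \<lfloor>t * real N\<rfloor>" if "a \<le> t"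
      using that by (auto intro!: floor_mono mult_right_mono)
    then show "((\<lambda>k. if k < \<lfloor>a * real N\<rfloor> then 0 else f (max a (of_int k / real N))) \<circ> c) t = s t"
      by (auto simp: c_def s_def not_less)
  qed
  finally have "simple_function lborel s" .
  moreover have "emeasure lborel {t \<in> space lborel. s t \<noteq> 0} \<le> emeasure lborel {a..b}"
    by (intro emeasure_mono) (auto simp: s_def split: if_splits)
  then have "emeasure lborel {t \<in> space lborel. s t \<noteq> 0} \<noteq> \<infinity>"
    by (auto simp: top_unique emeasure_lborel_Icc_eq split: if_splits)
  ultimately have "Bochner_Integration.simple_bochner_integrable lborel s"
    by (rule simple_bochner_integrable.intros)
  moreover have "norm (f t - s t) \<le> e" if t: "t \<in> {a..b}" for t
  proof -
    let ?r = "max a (of_int \<lfloor>t * real N\<rfloor> / real N)"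
    have "of_int \<lfloor>t * real N\<rfloor> / real N \<le> t"
      using \<open>N > 0\<close> floor_correct[of "t * real N"] by (simp add: divide_le_eq)
    moreover have "t < (of_int \<lfloor>t * real N\<rfloor> + 1) / real N"
      using \<open>N > 0\<close> floor_correct[of "t * real N"] by (subst pos_less_divide_eq) auto
    then have "t - 1 / real N < of_int \<lfloor>t * real N\<rfloor> / real N"
      unfolding add_divide_distrib by linarith
    ultimately have "?r \<in> {a..b}" "dist t ?r < \<delta>" using t N by (auto simp: dist_real_def)
    then have "dist (f t) (f ?r) < e" using t \<delta> by blast
    then show ?thesis using t by (simp add: s_def dist_norm)
  qed
  ultimately show thesis by (rule that) (auto simp: s_def)
qed

abbreviation lborel_pos :: "real measure" where
  "lborel_pos \<equiv> restrict_space lborel {0<..}"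

lemma space_lborel_pos [simp]: "space lborel_pos = {0<..}"
  by (simp add: space_restrict_space)

lemma borel_measurable_lborel_pos:
  fixes f :: "real \<Rightarrow> 'a::topological_space"
  assumes "continuous_on {0<..} f"
  shows "f \<in> borel_measurable lborel_pos"
  using borel_measurable_continuous_on_restrict[OF assms]
  by (simp cong: measurable_cong_sets add: sets_restrict_space)

lemma AE_lborel_pos: "AE t in lborel_pos. 0 < t"
  by (rule AE_I2) simp

text \<open>On compact intervals exhausting the half-line, \<open>f\<close> is uniformly close to
  simple functions; what remains outside them is controlled by \<open>g\<close> and dominated
  convergence. Continuity takes the place of separability of the range.\<close>

lemma bintegrable_Ioi_dominated:
  fixes f :: "real \<Rightarrow> 'a::banach"
  assumes cont: "continuous_on {0<..} f" and g: "integrable lborel_pos g"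
    and le: "\<And>t. 0 < t \<Longrightarrow> norm (f t) \<le> g t"
  shows "bintegrable_Ioi f"
proof -
  define J where "J n = {1 / real (Suc n)..real (Suc n)}" for n
  \<comment> \<open>\<open>J n\<close> has length at most n + 1, and (n + 1) * e n still tends to
    0.\<close>
  define e where "e n = 1 / real (Suc n) ^ 2" for n
  have "\<exists>s. Bochner_Integration.simple_bochner_integrable lborel s \<and>
      (\<forall>t\<in>J n. norm (f t - s t) \<le> e n) \<and> (\<forall>t. t \<notin> J n \<longrightarrow> s t = 0)" for n
  proof -
    have "J n \<subseteq> {0<..}" by (auto simp: J_def intro: less_le_trans[rotated])
    then have "continuous_on (J n) f" using cont continuous_on_subset by blast
    then show ?thesis unfolding J_def
      by (rule simple_approximation_Icc[of _ _ _ "e n"]) (auto simp: e_def)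
  qed
  then obtain s where s: "\<And>n. Bochner_Integration.simple_bochner_integrable lborel (s n)"
    and s_in: "\<And>n t. t \<in> J n \<Longrightarrow> norm (f t - s n t) \<le> e n"
    and s_out: "\<And>n t. t \<notin> J n \<Longrightarrow> s n t = 0"
    by metis
  have J_pos: "0 < t" if "t \<in> J n" for t n
    using that less_le_trans[of 0 "1 / real (Suc n)" t] by (auto simp: J_def)
  have J_ev: "\<forall>\<^sub>F n in sequentially. t \<in> J n" if "0 < t" for t
  proof -
    have "\<forall>\<^sub>F n in sequentially. 1 / real (Suc n) < t"
      using that by real_asymp
    moreover have "\<forall>\<^sub>F n in sequentially. t < real (Suc n)"
      by real_asymp
    ultimately show ?thesis by eventually_elim (auto simp: J_def)
  qed
  have g0: "integrable lborel (\<lambda>t. indicator {0<..} t * g t)"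
    using g by (simp add: integrable_restrict_space)
  have g_nn: "0 \<le> indicator {0<..} t * g t" for t
    using order_trans[OF norm_ge_zero le[of t]] by (auto simp: indicator_def)
  \<comment> \<open>Outside \<open>J n\<close> the simple function vanishes and the error is at most
    \<open>g\<close>; inside, it is at most \<open>e n\<close>.\<close>
  define d where
    "d n t = indicator (- J n) t * (indicator {0<..} t * g t) + indicator (J n) t * e n" for n t
  have g_meas [measurable]: "(\<lambda>t. indicator {0<..} t * g t) \<in> borel_measurable lborel"
    using g0 by simp
  have J_meas [measurable]: "J n \<in> sets borel" for n by (simp add: J_def)
  have "\<exists>w. has_bint lborel (\<lambda>t. indicat_real {0<..} t *\<^sub>R f t) w"
  proof (rule has_bint_of_dominated_approximation[OF s, where d = d])
    show "d n \<in> borel_measurable lborel" for n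
      unfolding d_def by measurable
    show "norm (indicat_real {0<..} t *\<^sub>R f t - s n t) \<le> d n t" for n t
      using s_in[of t n] s_out[of t n] J_pos[of t n] le[of t] by (auto simp: d_def indicator_def)
    show "AE t in lborel. (\<lambda>n. s n t) \<longlonglongrightarrow> indicat_real {0<..} t *\<^sub>R f t"
    proof (rule AE_I2)
      fix t :: real
      show "(\<lambda>n. s n t) \<longlonglongrightarrow> indicat_real {0<..} t *\<^sub>R f t"
      proof (cases "0 < t")
        case True
        have "e \<longlonglongrightarrow> 0" unfolding e_def by real_asymp
        moreover have "\<forall>\<^sub>F n in sequentially. norm (s n t - f t) \<le> e n"
          using J_ev[OF True] by (rule eventually_mono) (use s_in in \<open>simp add: norm_minus_commute\<close>)
        ultimately have "(\<lambda>n. s n t - f t) \<longlonglongrightarrow> 0"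
          by (rule Lim_null_comparison[rotated])
        with True show ?thesis by (simp add: LIM_zero_iff)
      next
        case False
        then have "s n t = 0" for n using s_out J_pos by blast
        with False show ?thesis by simp
      qed
    qed
    have 1: "(\<lambda>n. LINT t|lborel. indicator (- J n) t * (indicator {0<..} t * g t)) \<longlonglongrightarrow> (LINT t|lborel. 0 * t)"
    proof (rule integral_dominated_convergence[where w = "\<lambda>t. indicator {0<..} t * g t"])
      show "AE t in lborel. (\<lambda>n. indicator (- J n) t * (indicator {0<..} t * g t)) \<longlonglongrightarrow> 0 * t"
      proof (rule AE_I2)
        fix t :: real
        show "(\<lambda>n. indicator (- J n) t * (indicator {0<..} t * g t)) \<longlonglongrightarrow> 0 * t"
        proof (cases "0 < t")
          case True
          show ?thesis
            by (rule tendsto_eventually) (use J_ev[OF True] in eventually_elim, simp)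
        qed simp
      qed
      show "AE t in lborel. norm (indicator (- J n) t * (indicator {0<..} t * g t))
          \<le> indicator {0<..} t * g t" for n
      proof (rule AE_I2)
        fix t
        show "norm (indicator (- J n) t * (indicator {0<..} t * g t)) \<le> indicator {0<..} t * g t"
          using g_nn[of t] by (cases "t \<in> J n") auto
      qed
    qed (use g0 in measurable)
    have J_int: "integrable lborel (\<lambda>t. indicator (J n) t * e n)"
      and J_val: "(LINT t|lborel. indicator (J n) t * e n) = measure lborel (J n) * e n" for n
      by (auto simp: J_def emeasure_lborel_Icc_eq intro!: integrable_mult_left)
    have g_int: "integrable lborel (\<lambda>t. indicator (- J n) t * (indicator {0<..} t * g t))" for n
      using integrable_mult_indicator[OF _ g0, of "- J n"] J_meas by simp
    have "(\<lambda>n. measure lborel (J n) * e n) \<longlonglongrightarrow> 0"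
    proof (rule tendsto_sandwich[OF _ _ tendsto_const])
      show "\<forall>\<^sub>F n in sequentially. measure lborel (J n) * e n \<le> real (Suc n) * e n"
      proof (intro always_eventually allI mult_right_mono)
        fix n
        have "1 / real (Suc n) \<le> real (Suc n)" by (simp add: divide_le_eq algebra_simps)
        then show "measure lborel (J n) \<le> real (Suc n)"
          unfolding J_def by (subst measure_lborel_Icc) auto
      qed (simp add: e_def)
      show "(\<lambda>n. real (Suc n) * e n) \<longlonglongrightarrow> 0" unfolding e_def by real_asymp
    qed (auto simp: e_def)
    from tendsto_add[OF 1 this]
    have "(\<lambda>n. LINT t|lborel. d n t) \<longlonglongrightarrow> 0"
      unfolding d_def Bochner_Integration.integral_add[OF g_int J_int] J_val by simp
    moreover have "integrable lborel (d n)" "0 \<le> d n t" for n t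
      unfolding d_def using g_int J_int g_nn by (auto simp: e_def indicator_def)
    ultimately show "(\<lambda>n. \<integral>\<^sup>+ t. ennreal (d n t) \<partial>lborel) \<longlonglongrightarrow> 0"
      by (subst nn_integral_eq_integral) (auto simp flip: ennreal_0 intro!: tendsto_ennrealI)
  qed
  then show ?thesis by (simp add: bintegrable_Ioi_def has_bint_Ioi_def)
qed

section \<open>Evaluating and estimating integrals by functionals\<close>

lemma has_bint_functional:
  fixes \<phi> :: "'a::real_normed_vector \<Rightarrow> real"
  assumes "has_bint M f w" and lin: "linear \<phi>" and le: "\<And>x. \<bar>\<phi> x\<bar> \<le> norm x"
  shows "has_bint M (\<lambda>x. \<phi> (f x)) (\<phi> w)"
proof -
  have \<phi>: "bounded_linear \<phi>"
    using lin le by (intro bounded_linear.intro bounded_linear_axioms.intro exI[of _ 1]) auto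
  obtain s where s: "\<And>i::nat. Bochner_Integration.simple_bochner_integrable M (s i)"
    and lim: "AE x in M. (\<lambda>i. s i x) \<longlonglongrightarrow> f x"
    and L1: "(\<lambda>i. \<integral>\<^sup>+ x. ennreal (norm (f x - s i x)) \<partial>M) \<longlonglongrightarrow> 0"
    and int: "(\<lambda>i. Bochner_Integration.simple_bochner_integral M (s i)) \<longlonglongrightarrow> w"
    using assms(1) unfolding has_bint_def by auto
  show ?thesis
    unfolding has_bint_def
  proof (intro exI[of _ "\<lambda>i x. \<phi> (s i x)"] conjI allI)
    show "Bochner_Integration.simple_bochner_integrable M (\<lambda>x. \<phi> (s i x))" for i
      using simple_bochner_integrable_compose2[of "\<lambda>x y. \<phi> x" M "s i" "s i"] s
      by (simp add: linear_0 lin)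
    show "AE x in M. (\<lambda>i. \<phi> (s i x)) \<longlonglongrightarrow> \<phi> (f x)"
      using lim by eventually_elim (rule bounded_linear.tendsto[OF \<phi>])
    show "(\<lambda>i. \<integral>\<^sup>+ x. ennreal (norm (\<phi> (f x) - \<phi> (s i x))) \<partial>M) \<longlonglongrightarrow> 0"
      by (rule tendsto_sandwich[OF _ _ tendsto_const L1])
        (auto intro!: always_eventually nn_integral_mono ennreal_leI le simp flip: linear_diff[OF lin])
    show "(\<lambda>i. Bochner_Integration.simple_bochner_integral M (\<lambda>x. \<phi> (s i x))) \<longlonglongrightarrow> \<phi> w"
      unfolding simple_bochner_integral_linear[OF lin s] by (rule bounded_linear.tendsto[OF \<phi> int])
  qed
qed

lemma has_bint_Ioi_functional:
  fixes \<phi> :: "'a::real_normed_vector \<Rightarrow> real"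
  assumes f: "has_bint_Ioi f w" and cont: "continuous_on {0<..} f"
    and \<phi>: "linear \<phi>" "\<And>x. \<bar>\<phi> x\<bar> \<le> norm x"
  shows "has_bochner_integral lborel_pos (\<lambda>t. \<phi> (f t)) (\<phi> w)"
proof -
  have "bounded_linear \<phi>"
    using \<phi> by (intro bounded_linear.intro bounded_linear_axioms.intro exI[of _ 1]) auto
  then have "continuous_on {0<..} (\<lambda>t. \<phi> (f t))"
    using cont by (rule bounded_linear.continuous_on)
  then have "(\<lambda>t. indicat_real {0<..} t *\<^sub>R \<phi> (f t)) \<in> borel_measurable lborel"
    using borel_measurable_continuous_on_indicator[of "{0<..}" "\<lambda>t. \<phi> (f t)"] by simp
  moreover have "has_bint lborel (\<lambda>t. indicat_real {0<..} t *\<^sub>R \<phi> (f t)) (\<phi> w)"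
    using has_bint_functional[OF f[unfolded has_bint_Ioi_def] \<phi>] by (simp add: linear_scale \<phi>)
  ultimately have "has_bochner_integral lborel (\<lambda>t. indicat_real {0<..} t *\<^sub>R \<phi> (f t)) (\<phi> w)"
    by (rule has_bint_imp_has_bochner_integral[rotated])
  then show ?thesis by (subst has_bochner_integral_restrict_space) auto
qed

text \<open>Existence and value are separated: integrability yields some value \<open>v\<close>, and
  functionals distinguish \<open>v\<close> from any other vector. With a majorant for the first
  part, only scalar integrals remain to be computed.\<close>

lemma has_bint_IoiI:
  fixes f :: "real \<Rightarrow> 'a::real_normed_vector"
  assumes "bintegrable_Ioi f" and cont: "continuous_on {0<..} f"
    and \<phi>: "\<And>\<phi> :: 'a \<Rightarrow> real. linear \<phi> \<Longrightarrow> (\<And>x. \<bar>\<phi> x\<bar> \<le> norm x) \<Longrightarrow>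
      integral\<^sup>L lborel_pos (\<lambda>t. \<phi> (f t)) = \<phi> w"
  shows "has_bint_Ioi f w"
proof -
  obtain v where v: "has_bint_Ioi f v" using assms(1) by (auto simp: bintegrable_Ioi_def)
  have "v = w"
  proof (rule eq_by_functionals)
    fix \<phi> :: "'a \<Rightarrow> real" assume *: "linear \<phi>" "\<And>x. \<bar>\<phi> x\<bar> \<le> norm x"
    show "\<phi> v = \<phi> w"
      using has_bochner_integral_integral_eq[OF has_bint_Ioi_functional[OF v cont *]] \<phi>[OF *] by simp
  qed
  with v show ?thesis by simp
qed

text \<open>After a functional of norm at most 1 is applied, the pointwise bound is integrated as a
  scalar inequality; the norming functional then recovers the norm.\<close>

lemma has_bint_Ioi_norm_diff_le:
  fixes f g :: "real \<Rightarrow> 'a::real_normed_vector"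
  assumes f: "has_bint_Ioi f v" "continuous_on {0<..} f"
    and g: "has_bint_Ioi g w" "continuous_on {0<..} g"
    and d: "integrable lborel_pos d" "\<And>t. 0 < t \<Longrightarrow> norm (f t - g t) \<le> d t"
  shows "norm (v - w) \<le> integral\<^sup>L lborel_pos d"
proof (rule norm_le_by_functionals)
  fix \<phi> :: "'a \<Rightarrow> real" assume \<phi>: "linear \<phi>" "\<And>x. \<bar>\<phi> x\<bar> \<le> norm x"
  have "has_bochner_integral lborel_pos (\<lambda>t. \<phi> (f t) - \<phi> (g t)) (\<phi> v - \<phi> w)"
    by (intro has_bochner_integral_diff has_bint_Ioi_functional f g \<phi>)
  then have *: "has_bochner_integral lborel_pos (\<lambda>t. \<phi> (f t - g t)) (\<phi> (v - w))"
    by (simp add: linear_diff \<phi>)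
  have "\<phi> (f t - g t) \<le> d t" if "0 < t" for t
    using \<phi>(2)[of "f t - g t"] d(2)[OF that] by linarith
  then have "(LINT t|lborel_pos. \<phi> (f t - g t)) \<le> integral\<^sup>L lborel_pos d"
    using * d(1) by (intro integral_mono) (auto simp: has_bochner_integral_iff)
  then show "\<phi> (v - w) \<le> integral\<^sup>L lborel_pos d"
    using * by (simp add: has_bochner_integral_iff)
qed

lemma has_bint_zero: "has_bint M (\<lambda>_. 0 :: 'a::real_normed_vector) 0"
proof -
  have "Bochner_Integration.simple_bochner_integral M (\<lambda>_. 0 :: 'a) = 0"
    unfolding simple_bochner_integral_def by (rule sum.neutral) auto
  then show ?thesis
    unfolding has_bint_def
    by (intro exI[of _ "\<lambda>_ _. 0"]) (simp add: simple_bochner_integrable.simps)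
qed

lemma has_bint_Ioi_norm_le:
  fixes f :: "real \<Rightarrow> 'a::real_normed_vector"
  assumes "has_bint_Ioi f v" "continuous_on {0<..} f"
    and "integrable lborel_pos d" "\<And>t. 0 < t \<Longrightarrow> norm (f t) \<le> d t"
  shows "norm v \<le> integral\<^sup>L lborel_pos d"
  using has_bint_Ioi_norm_diff_le[of f v "\<lambda>_. 0" 0 d] assms
  by (simp add: has_bint_Ioi_def has_bint_zero)

text \<open>One simple function at distance less than 1 in the mean already makes the integral of
  the norm finite. This turns the integrability assumed in the last claim of the theorem into a
  majorant for dominated convergence.\<close>

lemma integrable_norm_bintegrable_Ioi:
  fixes f :: "real \<Rightarrow> 'a::real_normed_vector"
  assumes "bintegrable_Ioi f" and cont: "continuous_on {0<..} f"
  shows "integrable lborel_pos (\<lambda>t. norm (f t))"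
proof -
  let ?f = "\<lambda>t. indicat_real {0<..} t *\<^sub>R f t"
  obtain s where s: "\<And>i::nat. Bochner_Integration.simple_bochner_integrable lborel (s i)"
    and L1: "(\<lambda>i. \<integral>\<^sup>+ x. ennreal (norm (?f x - s i x)) \<partial>lborel) \<longlonglongrightarrow> 0"
    using assms(1) unfolding bintegrable_Ioi_def has_bint_Ioi_def has_bint_def by auto
  have "\<forall>\<^sub>F i in sequentially. (\<integral>\<^sup>+ x. ennreal (norm (?f x - s i x)) \<partial>lborel) < 1"
    using L1 by (rule order_tendstoD) simp
  then obtain i where i: "(\<integral>\<^sup>+ x. ennreal (norm (?f x - s i x)) \<partial>lborel) < 1"
    by (auto simp: eventually_sequentially)
  have simple: "simple_function lborel (s i)" using s by (auto elim: simple_bochner_integrable.cases)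
  have [measurable]: "(\<lambda>t. indicat_real {0<..} t * norm (f t - y)) \<in> borel_measurable borel" for y
    using borel_measurable_continuous_on_indicator[of "{0<..}" "\<lambda>t. norm (f t - y)"]
      continuous_on_norm[OF continuous_on_diff[OF cont continuous_on_const[of _ y]]] by simp
  \<comment> \<open>The simple function takes finitely many values \<open>y\<close>, and for each
    fixed \<open>y\<close> the distance from \<open>y\<close> is measurable by continuity on the
    half-line.\<close>
  have "(\<lambda>t. norm (?f t - s i t)) \<in> borel_measurable lborel"
  proof (rule measurable_compose_countable'[where g = "s i" and I = "range (s i)"
        and f = "\<lambda>y t. norm (?f t - y)"])
    show "countable (range (s i))"
      using simple by (auto simp: simple_function_def intro: countable_finite)
    show "s i \<in> measurable lborel (count_space (range (s i)))"
      using simple by (intro measurable_count_space_eq_countable[THEN iffD2])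
        (auto simp: simple_function_def intro: countable_finite)
    have "(\<lambda>t. norm (?f t - y)) = (\<lambda>t. indicat_real {0<..} t * norm (f t - y)
        + indicat_real {..0} t * norm y)" for y
      by (auto simp: indicator_def fun_eq_iff)
    then show "(\<lambda>t. norm (?f t - y)) \<in> borel_measurable lborel" for y
      by simp
  qed
  note [measurable] = this
  have [measurable]: "(\<lambda>t. norm (s i t)) \<in> borel_measurable lborel"
    using simple_function_compose1[OF simple, of norm] by (rule borel_measurable_simple_function)
  have fm: "(\<lambda>t. norm (?f t)) \<in> borel_measurable lborel"
    using borel_measurable_continuous_on_indicator[of "{0<..}" "\<lambda>t. norm (f t)"]
      continuous_on_norm[OF cont] by simp
  have "(\<integral>\<^sup>+ t. ennreal (norm (?f t)) \<partial>lborel)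
      \<le> (\<integral>\<^sup>+ t. ennreal (norm (?f t - s i t)) + ennreal (norm (s i t)) \<partial>lborel)"
    by (intro nn_integral_mono)
      (metis add.commute diff_add_cancel ennreal_leI ennreal_plus norm_ge_zero norm_triangle_ineq)
  also have "\<dots> = (\<integral>\<^sup>+ t. ennreal (norm (?f t - s i t)) \<partial>lborel)
      + (\<integral>\<^sup>+ t. ennreal (norm (s i t)) \<partial>lborel)"
    by (rule nn_integral_add) auto
  also have "(\<integral>\<^sup>+ t. ennreal (norm (s i t)) \<partial>lborel)
      = ennreal (Bochner_Integration.simple_bochner_integral lborel (\<lambda>t. norm (s i t)))"
    using simple_bochner_integrable_compose2[of "\<lambda>x y. norm x" lborel "s i" "s i"] s
    by (intro simple_bochner_integral_eq_nn_integral[symmetric]) auto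
  also have "(\<integral>\<^sup>+ t. ennreal (norm (?f t - s i t)) \<partial>lborel) + \<dots> < \<infinity>"
    using i by (simp add: less_top[symmetric])
      (metis ennreal_add_eq_top ennreal_neq_top ennreal_one_neq_top less_top order_less_trans top.not_eq_extremum)
  finally have "integrable lborel (\<lambda>t. norm (?f t))"
    using fm by (intro integrableI_bounded) auto
  then show ?thesis by (subst integrable_restrict_space) auto
qed

section \<open>Integrals over the positive half-line\<close>

interpretation lborel_pos: sigma_finite_measure lborel_pos
  by (rule sigma_finite_measure_restrict_space) (auto intro: sigma_finite_lborel)

interpretation lborel_pos_pair: pair_sigma_finite lborel_pos lborel_pos
  by (rule pair_sigma_finite.intro) unfold_locales

lemma measurable_ident_lborel_pos [measurable]: "(\<lambda>x. x) \<in> borel_measurable lborel_pos"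
  by (intro borel_measurable_lborel_pos continuous_intros)

lemma measurable_fst_lborel_pos [measurable]: "fst \<in> borel_measurable (lborel_pos \<Otimes>\<^sub>M M)"
  using measurable_compose[OF measurable_fst measurable_ident_lborel_pos] .

lemma measurable_snd_lborel_pos [measurable]: "snd \<in> borel_measurable (M \<Otimes>\<^sub>M lborel_pos)"
  using measurable_compose[OF measurable_snd measurable_ident_lborel_pos] .

lemma has_bochner_integral_lborel_pos_iff:
  fixes f :: "real \<Rightarrow> real"
  shows "has_bochner_integral lborel_pos f I
    \<longleftrightarrow> has_bochner_integral lborel (\<lambda>x. indicator {0<..} x * f x) I"
  by (subst has_bochner_integral_restrict_space) auto

lemma has_bochner_integral_lborel_pos_cong:
  assumes "\<And>x. 0 < x \<Longrightarrow> f x = g x" "I = J"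
  shows "has_bochner_integral lborel_pos f I \<longleftrightarrow> has_bochner_integral lborel_pos g J"
  using assms by (intro has_bochner_integral_cong) auto

lemma has_bochner_integral_lborel_pos_scale:
  fixes f :: "real \<Rightarrow> real"
  assumes "has_bochner_integral lborel_pos f I" "0 < c"
  shows "has_bochner_integral lborel_pos (\<lambda>x. f (c * x)) (I / c)"
proof -
  have "(\<lambda>x. indicator {0<..} (0 + c * x) * f (0 + c * x)) = (\<lambda>x. indicator {0<..} x * f (c * x))"
    using assms(2) by (auto simp: fun_eq_iff indicator_def zero_less_mult_iff)
  then show ?thesis
    using assms lborel_has_bochner_integral_real_affine_iff[of c "\<lambda>x. indicator {0<..} x * f x" I 0]
    by (simp add: has_bochner_integral_lborel_pos_iff divide_inverse mult.commute)
qed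

lemma integral_lborel_pos_shift:
  fixes f :: "real \<Rightarrow> real"
  assumes "0 \<le> h"
  shows "(LINT x|lborel_pos. f (h + x)) = (LINT x|lborel_pos. indicator {h<..} x * f x)"
proof -
  have "(LINT x|lborel. indicator {0<..} x * (indicator {h<..} x * f x))
      = (LINT x|lborel. indicator {0<..} (h + x) * (indicator {h<..} (h + x) * f (h + x)))"
    using lborel_integral_real_affine[of 1 "\<lambda>x. indicator {0<..} x * (indicator {h<..} x * f x)" h]
    by simp
  also have "(\<lambda>x. indicator {0<..} (h + x) * (indicator {h<..} (h + x) * f (h + x)))
      = (\<lambda>x. indicator {0<..} x * f (h + x))"
    using assms by (auto simp: fun_eq_iff indicator_def)
  finally show ?thesis by (simp add: integral_restrict_space)
qed

text \<open>The substitution rule is applied to absolute integrability for the completed measure;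
  continuity gives the Borel measurability needed to pass to \<open>lborel_pos\<close> and back. It
  is used for the substitution of 1 / \<mu> in the power of the inverse operator.\<close>

lemma has_bochner_integral_lborel_pos_inverse:
  fixes f :: "real \<Rightarrow> real"
  assumes cont: "continuous_on {0<..} f" and f: "has_bochner_integral lborel_pos f I"
  shows "has_bochner_integral lborel_pos (\<lambda>x. f (1 / x) / x ^ 2) I"
proof -
  have lebesgue: "g absolutely_integrable_on {0<..} \<and> integral {0<..} g = J
      \<longleftrightarrow> has_bochner_integral lborel_pos g J"
    if "continuous_on {0<..} g" for g :: "real \<Rightarrow> real" and J
  proof -
    have [measurable]: "(\<lambda>x. indicator {0<..} x * g x) \<in> borel_measurable lborel"
      using borel_measurable_continuous_on_indicator[OF _ that] by simp
    have "integral {0<..} g = (LINT x|lebesgue. indicator {0<..} x * g x)"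
      if "g absolutely_integrable_on {0<..}"
      using set_lebesgue_integral_eq_integral(2)[OF that] by (simp add: set_lebesgue_integral_def)
    then show ?thesis
      unfolding has_bochner_integral_lborel_pos_iff
      by (auto simp: has_bochner_integral_iff set_integrable_def integrable_completion integral_completion)
  qed
  have img: "(\<lambda>x. 1 / x) ` {0<..} = {0 :: real<..}"
  proof -
    have "y \<in> (\<lambda>x. 1 / x) ` {0<..}" if "0 < y" for y :: real
      using that by (intro image_eqI[of _ _ "1 / y"]) auto
    then show ?thesis by auto
  qed
  have "(\<lambda>x. \<bar>- 1 / x ^ 2\<bar> * f (1 / x)) absolutely_integrable_on {0<..} \<and>
      integral {0<..} (\<lambda>x. \<bar>- 1 / x ^ 2\<bar> * f (1 / x)) = I"
  proof (rule has_absolute_integral_change_of_variables_1'[where f = f and g = "\<lambda>x. 1 / x"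
        and g' = "\<lambda>x. - 1 / x ^ 2", THEN iffD2])
    show "((\<lambda>x. 1 / x) has_field_derivative - 1 / x ^ 2) (at x within {0<..})"
      if "x \<in> {0<..}" for x :: real
      using that by (auto intro!: derivative_eq_intros simp: power2_eq_square)
    show "f absolutely_integrable_on (\<lambda>x. 1 / x) ` {0<..} \<and> integral ((\<lambda>x. 1 / x) ` {0<..}) f = I"
      unfolding img using lebesgue[OF cont] f by blast
  qed (auto simp: inj_on_def)
  moreover have "continuous_on {0<..} (\<lambda>x :: real. \<bar>- 1 / x ^ 2\<bar> * f (1 / x))"
    by (intro continuous_intros continuous_on_compose2[OF cont]) auto
  ultimately have "has_bochner_integral lborel_pos (\<lambda>x. \<bar>- 1 / x ^ 2\<bar> * f (1 / x)) I"
    using lebesgue by blast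
  then show ?thesis by (simp add: abs_mult mult.commute)
qed

text \<open>\<open>N\<close> is the inner integral of the absolute value, so its integrability is
  Tonelli's condition. The inner integrals \<open>G\<close> and \<open>H\<close> are supplied as
  closed forms on the positive axis, which lets the exchange of order be read as an
  evaluation.\<close>

lemma
  fixes f :: "real \<Rightarrow> real \<Rightarrow> real"
  assumes meas: "case_prod f \<in> borel_measurable (lborel_pos \<Otimes>\<^sub>M lborel_pos)"
    and abs: "\<And>x. 0 < x \<Longrightarrow> has_bochner_integral lborel_pos (\<lambda>y. \<bar>f x y\<bar>) (N x)"
    and N: "integrable lborel_pos N"
    and G: "\<And>x. 0 < x \<Longrightarrow> (LINT y|lborel_pos. f x y) = G x"
  shows lborel_pos_Fubini_integrable: "integrable (lborel_pos \<Otimes>\<^sub>M lborel_pos) (case_prod f)"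
    and lborel_pos_Fubini: "(\<And>y. 0 < y \<Longrightarrow> (LINT x|lborel_pos. f x y) = H y)
      \<Longrightarrow> has_bochner_integral lborel_pos H (integral\<^sup>L lborel_pos G)"
proof -
  have "integrable lborel_pos (\<lambda>x. LINT y|lborel_pos. norm (case_prod f (x, y)))"
    using abs N by (subst Bochner_Integration.integrable_cong[OF refl, of _ _ N])
      (auto simp: has_bochner_integral_iff)
  moreover have "AE x in lborel_pos. integrable lborel_pos (\<lambda>y. case_prod f (x, y))"
  proof (rule AE_I2)
    fix x assume "x \<in> space lborel_pos"
    then have "integrable lborel_pos (\<lambda>y. \<bar>f x y\<bar>)" using abs by (auto simp: has_bochner_integral_iff)
    moreover have "f x \<in> borel_measurable lborel_pos"
      using measurable_Pair2[OF meas] \<open>x \<in> space lborel_pos\<close> by simp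
    ultimately show "integrable lborel_pos (\<lambda>y. case_prod f (x, y))"
      using integrable_norm_iff[of "f x" lborel_pos] by simp
  qed
  ultimately show int: "integrable (lborel_pos \<Otimes>\<^sub>M lborel_pos) (case_prod f)"
    by (rule lborel_pos_pair.Fubini_integrable[OF meas])
  have "(LINT y|lborel_pos. (LINT x|lborel_pos. f x y)) = (LINT x|lborel_pos. (LINT y|lborel_pos. f x y))"
    using lborel_pos_pair.Fubini_integral[OF int] .
  also have "\<dots> = integral\<^sup>L lborel_pos G"
    using G by (intro Bochner_Integration.integral_cong) auto
  finally have eq: "(LINT y|lborel_pos. (LINT x|lborel_pos. f x y)) = integral\<^sup>L lborel_pos G" .
  assume H: "\<And>y. 0 < y \<Longrightarrow> (LINT x|lborel_pos. f x y) = H y"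
  have "has_bochner_integral lborel_pos (\<lambda>y. LINT x|lborel_pos. f x y) (integral\<^sup>L lborel_pos G)"
    using lborel_pos_pair.integrable_snd[OF int] eq by (simp add: has_bochner_integral_iff)
  then show "has_bochner_integral lborel_pos H (integral\<^sup>L lborel_pos G)"
    by (subst has_bochner_integral_lborel_pos_cong[symmetric, OF H refl])
qed

section \<open>Gamma, Beta and Laplace integrals\<close>

lemma has_bochner_integral_Gamma:
  fixes x c :: real
  assumes x: "0 < x" and c: "0 < c"
  shows "has_bochner_integral lborel_pos (\<lambda>t. t powr (x - 1) * exp (- (c * t))) (Gamma x / c powr x)"
proof -
  have "has_bochner_integral lborel (\<lambda>t. indicator {0<..} t * (t powr (x - 1) * exp (- t))) (Gamma x)"
  proof (rule has_bochner_integral_nn_integral)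
    show "(\<integral>\<^sup>+ t. ennreal (indicator {0<..} t * (t powr (x - 1) * exp (- t))) \<partial>lborel) = ennreal (Gamma x)"
      unfolding Gamma_conv_nn_integral_real[OF x]
      by (intro nn_integral_cong) (auto simp: indicator_def exp_minus divide_inverse)
    show "0 \<le> Gamma x" using Gamma_real_pos[OF x] by simp
  qed auto
  then have "has_bochner_integral lborel_pos (\<lambda>t. t powr (x - 1) * exp (- t)) (Gamma x)"
    by (simp add: has_bochner_integral_lborel_pos_iff)
  from has_bochner_integral_lborel_pos_scale[OF this c]
  have scaled: "has_bochner_integral lborel_pos (\<lambda>t. c powr (1 - x) * ((c * t) powr (x - 1) * exp (- (c * t))))
      (c powr (1 - x) * (Gamma x / c))"
    by (rule has_bochner_integral_mult_right)
  have eq: "c powr (1 - x) * ((c * t) powr (x - 1) * exp (- (c * t)))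
      = t powr (x - 1) * exp (- (c * t))" if "0 < t" for t
  proof -
    have "c powr (1 - x) * c powr (x - 1) = 1"
      using c by (simp flip: powr_add)
    then have "c powr (1 - x) * (c * t) powr (x - 1) = t powr (x - 1)"
      using c that by (simp add: powr_mult mult.assoc[symmetric])
    then show ?thesis by (simp only: mult.assoc[symmetric])
  qed
  have "c powr (1 - x) * (Gamma x / c) = Gamma x / c powr x"
    using c by (simp add: powr_diff)
  from iffD1[OF has_bochner_integral_lborel_pos_cong[OF eq this] scaled] show ?thesis .
qed

lemma has_bochner_integral_exp:
  fixes c :: real
  assumes "0 < c"
  shows "has_bochner_integral lborel_pos (\<lambda>t. exp (- (c * t))) (1 / c)"
proof (rule iffD1[OF has_bochner_integral_lborel_pos_cong])
  show "has_bochner_integral lborel_pos (\<lambda>t. t powr (1 - 1) * exp (- (c * t))) (Gamma 1 / c powr 1)"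
    using assms by (intro has_bochner_integral_Gamma) auto
qed (use assms in auto)

text \<open>Valid at integers as well: one Gamma factor is then at a pole, where its value is 0, and
  the right-hand side is a division by zero.\<close>

lemma Gamma_reflection_real:
  fixes s :: real
  shows "Gamma s * Gamma (1 - s) = pi / sin (pi * s)"
proof -
  have 1: "Gamma (1 - complex_of_real s) = of_real (Gamma (1 - s))"
    using Gamma_complex_of_real[of "1 - s"] by simp
  have 2: "sin (complex_of_real pi * of_real s) = of_real (sin (pi * s))"
    using sin_of_real[of "pi * s", where 'a = complex] by simp
  have "complex_of_real (Gamma s * Gamma (1 - s)) = complex_of_real (pi / sin (pi * s))"
    using Gamma_reflection_complex[of "of_real s"]
    unfolding 1 2 Gamma_complex_of_real of_real_mult of_real_divide .
  then show ?thesis by (simp only: of_real_eq_iff)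
qed

text \<open>Integrate x^(s-1) e^(-t(1+x)) in both orders. Integrating over x first leaves Gamma(s)
  t^(-s) e^(-t), hence the product Gamma(s) Gamma(1-s); integrating over t first leaves the claimed
  integrand.\<close>

lemma has_bochner_integral_Beta:
  fixes s :: real
  assumes s: "0 < s" "s < 1"
  shows "has_bochner_integral lborel_pos (\<lambda>x. x powr (s - 1) / (1 + x)) (pi / sin (pi * s))"
proof -
  let ?f = "\<lambda>t x :: real. x powr (s - 1) * exp (- (t * x)) * exp (- t)"
  let ?G = "\<lambda>t :: real. Gamma s * (t powr (1 - s - 1) * exp (- t))"
  have G: "has_bochner_integral lborel_pos ?G (Gamma s * Gamma (1 - s))"
    using has_bochner_integral_mult_right[OF has_bochner_integral_Gamma[of "1 - s" 1]] s by simp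
  have inner: "has_bochner_integral lborel_pos (?f t) (?G t)" if "0 < t" for t
    using has_bochner_integral_mult_left[OF has_bochner_integral_Gamma[OF s(1) that], of "exp (- t)"] that
    by (simp add: powr_minus_divide)
  have "has_bochner_integral lborel_pos (\<lambda>x. x powr (s - 1) / (1 + x)) (integral\<^sup>L lborel_pos ?G)"
  proof (rule lborel_pos_Fubini[where f = ?f and N = ?G])
    show "case_prod ?f \<in> borel_measurable (lborel_pos \<Otimes>\<^sub>M lborel_pos)" by measurable
    show "has_bochner_integral lborel_pos (\<lambda>x. \<bar>?f t x\<bar>) (?G t)" if "0 < t" for t
      using inner[OF that] by (simp add: abs_mult)
    show "integrable lborel_pos ?G" using G by (simp add: has_bochner_integral_iff)
    show "(LINT x|lborel_pos. ?f t x) = ?G t" if "0 < t" for t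
      using inner[OF that] by (simp add: has_bochner_integral_iff)
    show "(LINT t|lborel_pos. ?f t x) = x powr (s - 1) / (1 + x)" if "0 < x" for x
    proof (rule has_bochner_integral_integral_eq)
      have "has_bochner_integral lborel_pos (\<lambda>t. x powr (s - 1) * exp (- ((1 + x) * t)))
          (x powr (s - 1) * (1 / (1 + x)))"
        using that by (intro has_bochner_integral_mult_right has_bochner_integral_exp) auto
      moreover have "x powr (s - 1) * exp (- ((1 + x) * t)) = ?f t x" for t
      proof -
        have "- ((1 + x) * t) = - (t * x) + - t" by (simp add: algebra_simps)
        then show ?thesis by (simp only: exp_add mult.assoc)
      qed
      ultimately show "has_bochner_integral lborel_pos (\<lambda>t. ?f t x) (x powr (s - 1) / (1 + x))"
        by simp
    qed
  qed
  then show ?thesis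
    using G s by (simp add: has_bochner_integral_iff flip: Gamma_reflection_real)
qed

text \<open>The majorant for every integrand that is O(t) at 0 and bounded at infinity before the
  weight is applied. The comparison min 1 t \<le> 2 t / (1 + t) reduces it to the Beta integral for
  1 - s.\<close>

lemma integrable_powr_min:
  fixes s :: real
  assumes s: "0 < s" "s < 1"
  shows "integrable lborel_pos (\<lambda>t. t powr (- 1 - s) * min 1 t)"
proof (rule Bochner_Integration.integrable_bound)
  show "integrable lborel_pos (\<lambda>t. 2 * (t powr (1 - s - 1) / (1 + t)))"
    using has_bochner_integral_Beta[of "1 - s"] s
    by (intro integrable_mult_right) (auto simp: has_bochner_integral_iff)
  show "AE t in lborel_pos. norm (t powr (- 1 - s) * min 1 t)
      \<le> norm (2 * (t powr (1 - s - 1) / (1 + t)))"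
  proof (rule AE_I2)
    fix t assume "t \<in> space lborel_pos"
    then have t: "0 < t" by simp
    have "min 1 t * (1 + t) \<le> 2 * t" using t by (cases "t \<le> 1") (auto simp: min_def ring_distribs mult_left_le)
    then have "min 1 t \<le> 2 * (t / (1 + t))" using t by (simp add: pos_le_divide_eq)
    then have "t powr (- 1 - s) * min 1 t \<le> t powr (- 1 - s) * (2 * (t / (1 + t)))"
      by (intro mult_left_mono) auto
    also have "\<dots> = 2 * (t powr (1 - s - 1) / (1 + t))"
      using t powr_add[of t 1 "- 1 - s"] by simp
    finally show "norm (t powr (- 1 - s) * min 1 t) \<le> norm (2 * (t powr (1 - s - 1) / (1 + t)))"
      using t by simp
  qed
qed measurable

text \<open>By Fubini, since \<mu>^s e^(-\<mu>t) integrates over \<mu> to Gamma(1+s) t^(-1-s). It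
  converts a weighted integral of a Laplace transform into a weighted integral of the function
  itself.\<close>

lemma has_bochner_integral_Balakrishnan:
  fixes D :: "real \<Rightarrow> real" and s :: real
  assumes s: "0 < s" "s < 1" and meas [measurable]: "D \<in> borel_measurable lborel_pos"
    and D: "\<And>t. 0 < t \<Longrightarrow> \<bar>D t\<bar> \<le> K * min 1 t"
  shows "integrable lborel_pos (\<lambda>t. t powr (- 1 - s) * D t)"
    and "has_bochner_integral lborel_pos (\<lambda>\<mu>. \<mu> powr s * (LINT t|lborel_pos. exp (- (\<mu> * t)) * D t))
      (Gamma (1 + s) * (LINT t|lborel_pos. t powr (- 1 - s) * D t))"
proof -
  show int: "integrable lborel_pos (\<lambda>t. t powr (- 1 - s) * D t)"
  proof (rule Bochner_Integration.integrable_bound)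
    show "integrable lborel_pos (\<lambda>t. K * (t powr (- 1 - s) * min 1 t))"
      by (intro integrable_mult_right integrable_powr_min s)
    show "AE t in lborel_pos. norm (t powr (- 1 - s) * D t) \<le> norm (K * (t powr (- 1 - s) * min 1 t))"
    proof (rule AE_I2)
      fix t assume "t \<in> space lborel_pos"
      then have "t powr (- 1 - s) * \<bar>D t\<bar> \<le> t powr (- 1 - s) * (K * min 1 t)"
        using D by (intro mult_left_mono) auto
      also have "\<dots> \<le> \<bar>t powr (- 1 - s) * (K * min 1 t)\<bar>" by (rule abs_ge_self)
      finally show "norm (t powr (- 1 - s) * D t) \<le> norm (K * (t powr (- 1 - s) * min 1 t))"
        by (simp add: abs_mult mult.left_commute)
    qed
  qed measurable
  let ?f = "\<lambda>t \<mu>. \<mu> powr s * exp (- (t * \<mu>)) * D t"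
  have inner: "has_bochner_integral lborel_pos (\<lambda>\<mu>. \<mu> powr s * exp (- (t * \<mu>)))
      (Gamma (1 + s) * t powr (- 1 - s))" if "0 < t" for t
    using has_bochner_integral_Gamma[of "1 + s" t] powr_minus_divide[of t "1 + s"] s that by simp
  have "has_bochner_integral lborel_pos (\<lambda>\<mu>. \<mu> powr s * (LINT t|lborel_pos. exp (- (\<mu> * t)) * D t))
      (LINT t|lborel_pos. Gamma (1 + s) * (t powr (- 1 - s) * D t))"
  proof (rule lborel_pos_Fubini[where f = ?f
        and N = "\<lambda>t. Gamma (1 + s) * norm (t powr (- 1 - s) * D t)"])
    show "case_prod ?f \<in> borel_measurable (lborel_pos \<Otimes>\<^sub>M lborel_pos)" by measurable
    show "has_bochner_integral lborel_pos (\<lambda>\<mu>. \<bar>?f t \<mu>\<bar>) (Gamma (1 + s) * norm (t powr (- 1 - s) * D t))"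
      if "0 < t" for t
      using has_bochner_integral_mult_left[OF inner[OF that], of "\<bar>D t\<bar>"]
      by (simp add: abs_mult mult_ac)
    show "integrable lborel_pos (\<lambda>t. Gamma (1 + s) * norm (t powr (- 1 - s) * D t))"
      using int by (intro integrable_mult_right integrable_norm)
    show "(LINT \<mu>|lborel_pos. ?f t \<mu>) = Gamma (1 + s) * (t powr (- 1 - s) * D t)" if "0 < t" for t
      using has_bochner_integral_mult_left[OF inner[OF that], of "D t"]
      by (simp add: has_bochner_integral_iff mult_ac)
    show "(LINT t|lborel_pos. ?f t \<mu>) = \<mu> powr s * (LINT t|lborel_pos. exp (- (\<mu> * t)) * D t)" for \<mu>
      by (simp add: mult_ac flip: integral_mult_right_zero)
  qed
  then show "has_bochner_integral lborel_pos (\<lambda>\<mu>. \<mu> powr s * (LINT t|lborel_pos. exp (- (\<mu> * t)) * D t))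
      (Gamma (1 + s) * (LINT t|lborel_pos. t powr (- 1 - s) * D t))"
    by simp
qed

text \<open>The preceding lemma for the scalar semigroup e^(-t): the Laplace transform of 1 - e^(-t)
  is 1 / (\<mu> (1 + \<mu>)), so the left side becomes a Beta integral and the reflection formula
  cancels Gamma(s). The substitution of c t then produces c^s. It is applied with c = 1 to the term
  e^(-t) u and with c = \<epsilon> to bound the error of the approximation by A +
  \<epsilon>I.\<close>

lemma has_bochner_integral_one_minus_exp:
  fixes s c :: real
  assumes s: "0 < s" "s < 1" and c: "0 < c"
  shows "has_bochner_integral lborel_pos (\<lambda>t. t powr (- 1 - s) * (1 - exp (- (c * t))))
    (c powr s * (Gamma (1 - s) / s))"
proof -
  let ?D = "\<lambda>t :: real. 1 - exp (- t)"
  have D: "\<bar>?D t\<bar> \<le> 1 * min 1 t" if "0 < t" for t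
    using that exp_ge_add_one_self[of "- t"] by (simp add: min_def)
  have meas: "?D \<in> borel_measurable lborel_pos" by measurable
  note Bal = has_bochner_integral_Balakrishnan[OF s meas D]
  have inner: "\<mu> powr s * (LINT t|lborel_pos. exp (- (\<mu> * t)) * ?D t) = \<mu> powr (s - 1) / (1 + \<mu>)"
    if \<mu>: "0 < \<mu>" for \<mu>
  proof -
    have "has_bochner_integral lborel_pos (\<lambda>t. exp (- (\<mu> * t)) - exp (- ((1 + \<mu>) * t)))
        (1 / \<mu> - 1 / (1 + \<mu>))"
      using \<mu> by (intro has_bochner_integral_diff has_bochner_integral_exp) auto
    moreover have "exp (- (\<mu> * t)) - exp (- ((1 + \<mu>) * t)) = exp (- (\<mu> * t)) * ?D t" for t
    proof -
      have "- ((1 + \<mu>) * t) = - (\<mu> * t) + - t" by (simp add: algebra_simps)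
      then show ?thesis by (simp only: exp_add right_diff_distrib mult_1_right)
    qed
    ultimately have "(LINT t|lborel_pos. exp (- (\<mu> * t)) * ?D t) = 1 / \<mu> - 1 / (1 + \<mu>)"
      by (simp add: has_bochner_integral_iff)
    moreover have "1 / \<mu> - 1 / (1 + \<mu>) = 1 / \<mu> / (1 + \<mu>)" using \<mu> by (simp add: field_simps)
    ultimately show ?thesis using \<mu> by (simp add: powr_diff)
  qed
  have "Gamma (1 + s) * (LINT t|lborel_pos. t powr (- 1 - s) * ?D t) = pi / sin (pi * s)"
  proof (rule has_bochner_integral_eq)
    show "has_bochner_integral lborel_pos (\<lambda>\<mu>. \<mu> powr (s - 1) / (1 + \<mu>))
        (Gamma (1 + s) * (LINT t|lborel_pos. t powr (- 1 - s) * ?D t))"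
      using iffD1[OF has_bochner_integral_lborel_pos_cong[OF inner refl] Bal(2)] .
  qed (intro has_bochner_integral_Beta s)
  also have "\<dots> = Gamma s * Gamma (1 - s)" by (rule Gamma_reflection_real[symmetric])
  finally have "(LINT t|lborel_pos. t powr (- 1 - s) * ?D t) = Gamma (1 - s) / s"
  proof -
    assume *: "Gamma (1 + s) * (LINT t|lborel_pos. t powr (- 1 - s) * ?D t) = Gamma s * Gamma (1 - s)"
    have "s \<notin> \<int>\<^sub>\<le>\<^sub>0" using s by (auto elim!: nonpos_Ints_cases)
    then have "Gamma (1 + s) = Gamma s * s" using Gamma_plus1[of s] by (simp add: add.commute)
    then have "Gamma s * (s * (LINT t|lborel_pos. t powr (- 1 - s) * ?D t)) = Gamma s * Gamma (1 - s)"
      using * by (simp only: mult.assoc)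
    then have "s * (LINT t|lborel_pos. t powr (- 1 - s) * ?D t) = Gamma (1 - s)"
      using Gamma_real_pos[OF s(1)] by simp
    then show ?thesis using s by (simp add: eq_divide_eq mult.commute)
  qed
  with Bal(1) have "has_bochner_integral lborel_pos (\<lambda>t. t powr (- 1 - s) * ?D t) (Gamma (1 - s) / s)"
    by (simp add: has_bochner_integral_iff)
  note scaled = has_bochner_integral_mult_right[OF has_bochner_integral_lborel_pos_scale[OF this c],
      of "c powr (1 + s)"]
  have eq: "c powr (1 + s) * ((c * t) powr (- 1 - s) * (1 - exp (- (c * t))))
      = t powr (- 1 - s) * (1 - exp (- (c * t)))" if "0 < t" for t
  proof -
    have "c powr (1 + s) * (c * t) powr (- 1 - s) = (c powr (1 + s) * c powr (- 1 - s)) * t powr (- 1 - s)"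
      using c that by (simp add: powr_mult)
    also have "c powr (1 + s) * c powr (- 1 - s) = 1" using c by (simp flip: powr_add)
    finally show ?thesis by (simp only: mult.assoc[symmetric] mult_1_left)
  qed
  have "c powr (1 + s) * (Gamma (1 - s) / s / c) = c powr s * (Gamma (1 - s) / s)"
    using c by (simp add: powr_add)
  from iffD1[OF has_bochner_integral_lborel_pos_cong[OF eq this] scaled] show ?thesis .
qed

section \<open>Frullani integrals and the double integral of difference quotients\<close>

lemma AE_lborel_pos_neq: "AE y in lborel_pos. y \<noteq> x"
  using AE_lborel_singleton[of x] by (subst AE_restrict_space_iff) (auto elim: eventually_mono)

text \<open>With an antiderivative P of f(x) / x, the integrand has the antiderivative P(r x) -
  P(x). Cauchy's mean value theorem, applied to P and ln, writes this as f(z) ln r with z between x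
  and r x, so its limits at 0 and at infinity are l ln r and m ln r.\<close>

lemma Frullani:
  fixes f :: "real \<Rightarrow> real"
  assumes cont: "continuous_on {0<..} f" and lim0: "(f \<longlongrightarrow> l) (at_right 0)"
    and lim_top: "(f \<longlongrightarrow> m) at_top" and r: "0 < r"
    and int: "integrable lborel_pos (\<lambda>x. (f (r * x) - f x) / x)"
  shows "(LINT x|lborel_pos. (f (r * x) - f x) / x) = (m - l) * ln r"
proof -
  have f_cont: "isCont f x" if "0 < x" for x
    using cont that by (simp add: continuous_on_eq_continuous_at)
  have "\<exists>P. \<forall>x. ereal 0 < ereal x \<longrightarrow> ereal x < \<infinity> \<longrightarrow> (P has_vector_derivative f x / x) (at x)"
  proof (rule einterval_antiderivative)
    show "isCont (\<lambda>x. f x / x) x" if "ereal 0 < ereal x" for x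
      using that f_cont by (intro continuous_intros) auto
  qed simp
  then obtain P where P: "\<And>x. 0 < x \<Longrightarrow> (P has_real_derivative f x / x) (at x)"
    by (auto simp: has_real_derivative_iff_has_vector_derivative)
  have mean_lt: "\<exists>z. a < z \<and> z < b \<and> P b - P a = f z * (ln b - ln a)" if "0 < a" "a < b" for a b
  proof -
    have "\<exists>z. a < z \<and> z < b \<and> (P b - P a) * (1 / z) = (ln b - ln a) * (f z / z)"
    proof (rule GMVT'[where f = P and g = ln and f' = "\<lambda>z. f z / z" and g' = "\<lambda>z. 1 / z"])
      show "isCont P z" if "a \<le> z" "z \<le> b" for z
        using P[of z] that \<open>0 < a\<close> by (intro DERIV_isCont) auto
    qed (use \<open>0 < a\<close> \<open>a < b\<close> P in \<open>auto intro!: derivative_eq_intros isCont_ln\<close>)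
    then obtain z where z: "a < z" "z < b" "(P b - P a) * (1 / z) = (ln b - ln a) * (f z / z)" by blast
    then have "P b - P a = f z * (ln b - ln a)" using \<open>0 < a\<close> by simp
    with z show ?thesis by blast
  qed
  \<comment> \<open>With \<open>lo\<close> and \<open>hi\<close> the intermediate point is enclosed
    as lo x \<le> z \<le> hi x for r below and above 1 alike, and tends to 0 or infinity together
    with x.\<close>
  define lo where "lo = min 1 r"
  define hi where "hi = max 1 r"
  have lohi: "0 < lo" "0 < hi" using r by (auto simp: lo_def hi_def)
  have mean: "\<exists>z. lo * x \<le> z \<and> z \<le> hi * x \<and> P (r * x) - P x = f z * ln r" if x: "0 < x" for x
  proof -
    consider "r = 1" | "r > 1" | "r < 1" by linarith
    then show ?thesis
    proof cases
      case 1 then show ?thesis by (auto simp: lo_def hi_def)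
    next
      case 2
      then obtain z where "x < z" "z < r * x" "P (r * x) - P x = f z * (ln (r * x) - ln x)"
        using mean_lt[of x "r * x"] x by auto
      with 2 x show ?thesis by (auto simp: lo_def hi_def ln_mult intro!: exI[of _ z])
    next
      case 3
      then obtain z where z: "r * x < z" "z < x" "P x - P (r * x) = f z * (ln x - ln (r * x))"
        using mean_lt[of "r * x" x] x r by auto
      then have "P (r * x) - P x = f z * ln r" using x r by (simp add: ln_mult algebra_simps)
      with 3 x z show ?thesis by (auto simp: lo_def hi_def intro!: exI[of _ z])
    qed
  qed
  define z where "z x = (SOME z. lo * x \<le> z \<and> z \<le> hi * x \<and> P (r * x) - P x = f z * ln r)" for x
  have z: "lo * x \<le> z x" "z x \<le> hi * x" "P (r * x) - P x = f (z x) * ln r" if "0 < x" for x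
    using someI_ex[OF mean[OF that]] unfolding z_def by auto
  have z0: "filterlim z (at_right 0) (at_right 0)"
  proof -
    have "((\<lambda>x. hi * x) \<longlongrightarrow> hi * 0) (at_right 0)" by (intro tendsto_intros)
    then have hi0: "((\<lambda>x. hi * x) \<longlongrightarrow> 0) (at_right 0)" by simp
    have pos: "\<forall>\<^sub>F x in at_right 0. 0 < z x"
    proof (rule eventually_at_right_less[THEN eventually_mono])
      fix x :: real assume "0 < x"
      then show "0 < z x" using less_le_trans[OF mult_pos_pos[OF lohi(1)] z(1)] by blast
    qed
    have "(z \<longlongrightarrow> 0) (at_right 0)"
    proof (rule tendsto_sandwich[OF _ _ tendsto_const hi0])
      show "\<forall>\<^sub>F x in at_right 0. 0 \<le> z x" using pos by (rule eventually_mono) simp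
      show "\<forall>\<^sub>F x in at_right 0. z x \<le> hi * x"
        by (rule eventually_at_right_less[THEN eventually_mono]) (rule z(2))
    qed
    from this pos show ?thesis by (rule tendsto_imp_filterlim_at_right)
  qed
  have z_top: "filterlim z at_top at_top"
  proof (rule filterlim_at_top_mono)
    show "filterlim (\<lambda>x. lo * x) at_top at_top"
      using lohi by (intro filterlim_tendsto_pos_mult_at_top[OF tendsto_const]) (auto intro: filterlim_ident)
    show "\<forall>\<^sub>F x in at_top. lo * x \<le> z x"
      using eventually_gt_at_top[of 0] by (rule eventually_mono) (rule z(1))
  qed
  let ?H = "\<lambda>x. P (r * x) - P x"
  have H0: "(?H \<longlongrightarrow> l * ln r) (at_right 0)"
  proof (rule Lim_transform_eventually)
    show "((\<lambda>x. f (z x) * ln r) \<longlongrightarrow> l * ln r) (at_right 0)"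
      by (intro tendsto_mult_right filterlim_compose[OF lim0 z0])
    show "\<forall>\<^sub>F x in at_right 0. f (z x) * ln r = ?H x"
      by (rule eventually_at_right_less[THEN eventually_mono]) (rule z(3)[symmetric])
  qed
  have H_top: "(?H \<longlongrightarrow> m * ln r) at_top"
  proof (rule Lim_transform_eventually)
    show "((\<lambda>x. f (z x) * ln r) \<longlongrightarrow> m * ln r) at_top"
      by (intro tendsto_mult_right filterlim_compose[OF lim_top z_top])
    show "\<forall>\<^sub>F x in at_top. f (z x) * ln r = ?H x"
      using eventually_gt_at_top[of 0] by (rule eventually_mono) (rule z(3)[symmetric])
  qed
  have "(LBINT x=ereal 0..\<infinity>. (f (r * x) - f x) / x) = m * ln r - l * ln r"
  proof (rule interval_integral_FTC_integrable)
    fix x assume "ereal 0 < ereal x" "ereal x < \<infinity>"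
    then have x: "0 < x" by simp
    have "((\<lambda>x. P (r * x)) has_real_derivative (f (r * x) / (r * x)) * r) (at x)"
      using r x by (intro DERIV_chain2[OF P]) (auto intro!: derivative_eq_intros)
    from DERIV_diff[OF this P[OF x]]
    have "(?H has_real_derivative (f (r * x) / (r * x)) * r - f x / x) (at x)" .
    also have "(f (r * x) / (r * x)) * r - f x / x = (f (r * x) - f x) / x"
      using r x by (simp add: diff_divide_distrib)
    finally show "(?H has_vector_derivative (f (r * x) - f x) / x) (at x)"
      by (simp add: has_real_derivative_iff_has_vector_derivative)
    have "isCont (\<lambda>x. r * x) x" by simp
    moreover have "isCont f (r * x)" using r x by (intro f_cont) simp
    ultimately have "isCont (\<lambda>x. f (r * x)) x" by (rule isCont_o2)
    then show "isCont (\<lambda>x. (f (r * x) - f x) / x) x"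
      using x f_cont[OF x] by (intro isCont_divide isCont_diff) auto
  next
    have "einterval (ereal 0) \<infinity> = {0<..}" by (auto simp: einterval_def)
    then show "set_integrable lborel (einterval (ereal 0) \<infinity>) (\<lambda>x. (f (r * x) - f x) / x)"
      using int by (simp add: set_integrable_def integrable_restrict_space)
    show "((?H \<circ> real_of_ereal) \<longlongrightarrow> l * ln r) (at_right (ereal 0))"
      using H0 by (simp add: ereal_tendsto_simps)
    show "((?H \<circ> real_of_ereal) \<longlongrightarrow> m * ln r) (at_left \<infinity>)"
      using H_top by (simp add: ereal_tendsto_simps)
  qed simp
  then show ?thesis
    by (simp add: interval_integral_to_infinity_eq set_lebesgue_integral_def
        integral_restrict_space left_diff_distrib)
qed

text \<open>
  The substitution \<open>y = x r\<close> turns the inner difference quotient into a Frullani integrand, so the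
  double integral is a multiple of \<open>f(0)\<close> that depends on \<open>s\<close> only.
\<close>

lemma difference_quotient_integral_aux:
  fixes f :: "real \<Rightarrow> real" and s :: real
  assumes s: "0 < s" "s < 1"
    and bound: "\<And>x y. 0 < x \<Longrightarrow> 0 < y \<Longrightarrow> \<bar>f y - f x\<bar> \<le> C * \<bar>x - y\<bar> / ((1 + x) * (1 + y))"
    and lim0: "(f \<longlongrightarrow> l) (at_right 0)" and lim_top: "(f \<longlongrightarrow> 0) at_top"
  shows "(LINT x|lborel_pos. x powr (- s) * (LINT y|lborel_pos. y powr (s - 1) * ((f y - f x) / (x - y))))
    = l * (LINT r|lborel_pos. r powr (s - 1) * (ln r / (r - 1)))"
proof -
  define k where "k x y = (f y - f x) / (x - y)" for x y
  let ?\<beta> = "pi / sin (pi * s)"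
  \<comment> \<open>The points 1 and 2 are just two distinct points at which the bound reveals the
    sign of \<open>C\<close>.\<close>
  have "0 \<le> C * \<bar>1 - 2\<bar> / ((1 + 1) * (1 + 2 :: real))" using bound[of 1 2] by linarith
  then have C: "0 \<le> C" by simp
  have k: "\<bar>k x y\<bar> \<le> C / ((1 + x) * (1 + y))" if "0 < x" "0 < y" for x y
  proof (cases "x = y")
    case False
    then have "\<bar>k x y\<bar> \<le> (C * \<bar>x - y\<bar> / ((1 + x) * (1 + y))) / \<bar>x - y\<bar>"
      using bound[OF that] unfolding k_def abs_divide by (intro divide_right_mono) auto
    with False show ?thesis by simp
  qed (use C that in \<open>simp add: k_def\<close>)
  have cont: "continuous_on {0<..} f"
  proof (rule lipschitz_on_continuous_on[where L = C])
    show "C-lipschitz_on {0<..} f"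
    proof (rule lipschitz_onI)
      fix x y :: real assume "x \<in> {0<..}" "y \<in> {0<..}"
      then have xy: "0 < x" "0 < y" by auto
      have "1 * 1 \<le> (1 + x) * (1 + y)" using xy by (intro mult_mono) auto
      then have "C * \<bar>x - y\<bar> / ((1 + x) * (1 + y)) \<le> C * \<bar>x - y\<bar> / 1"
        using C by (intro divide_left_mono) auto
      with bound[OF xy] show "dist (f x) (f y) \<le> C * dist x y"
        by (simp add: dist_real_def abs_minus_commute)
    qed (rule C)
  qed
  have [measurable]: "f \<in> borel_measurable lborel_pos" by (rule borel_measurable_lborel_pos[OF cont])
  have mult_pos: "(\<lambda>p. fst p * snd p) \<in> lborel_pos \<Otimes>\<^sub>M lborel_pos \<rightarrow>\<^sub>M lborel_pos"
    by (rule measurable_restrict_space2) (auto simp: space_pair_measure)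
  have [measurable]: "(\<lambda>p. f (fst p * snd p)) \<in> borel_measurable (lborel_pos \<Otimes>\<^sub>M lborel_pos)"
    by (rule measurable_compose[OF mult_pos]) simp
  let ?g = "\<lambda>x r. r powr (s - 1) * k x (x * r)"
  have g_meas: "case_prod ?g \<in> borel_measurable (lborel_pos \<Otimes>\<^sub>M lborel_pos)"
    unfolding k_def case_prod_beta by measurable
  \<comment> \<open>\<open>?B\<close> is the bound for \<open>k\<close> after the substitution of x
    r for y. Its inner integral \<open>?N\<close> is a constant times x^(-s) / (1 + x), again a Beta
    integrand, so Tonelli's condition holds.\<close>
  let ?B = "\<lambda>x r. C / (1 + x) * (r powr (s - 1) / (1 + x * r))"
  let ?N = "\<lambda>x. C / (1 + x) * (x powr (- s) * ?\<beta>)"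
  \<comment> \<open>The weights x^(-s) and y^(s-1) are complementary: with y = x r and dy = x dr all
    powers of x cancel and only r^(s-1) dr is left.\<close>
  have rescale: "x powr (1 - s) * (x * r) powr (s - 1) = r powr (s - 1)" if "0 < x" "0 < r" for x r
  proof -
    have "x powr (1 - s) * x powr (s - 1) = 1" using that by (simp flip: powr_add)
    then show ?thesis using that by (simp add: powr_mult mult.assoc[symmetric])
  qed
  have scale: "has_bochner_integral lborel_pos (\<lambda>r. r powr (s - 1) * q (x * r)) (x powr (- s) * I)"
    if "has_bochner_integral lborel_pos (\<lambda>y. y powr (s - 1) * q y) I" "0 < x" for q I x
  proof -
    have eq: "x powr (1 - s) * ((x * r) powr (s - 1) * q (x * r)) = r powr (s - 1) * q (x * r)"
      if "0 < r" for r
      using rescale[OF \<open>0 < x\<close> that] by (simp add: mult.assoc[symmetric])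
    have "x powr (1 - s) * (I / x) = x powr (- s) * I"
      using that by (simp add: powr_diff powr_minus_divide)
    from iffD1[OF has_bochner_integral_lborel_pos_cong[OF eq this]
        has_bochner_integral_mult_right[OF has_bochner_integral_lborel_pos_scale[OF that]]]
    show ?thesis .
  qed
  have B: "has_bochner_integral lborel_pos (?B x) (?N x)" if x: "0 < x" for x
  proof -
    have "has_bochner_integral lborel_pos (\<lambda>y. y powr (s - 1) * (1 / (1 + y))) ?\<beta>"
      using has_bochner_integral_Beta[OF s] by simp
    from has_bochner_integral_mult_right[OF scale[OF this x], of "C / (1 + x)"]
    show ?thesis by simp
  qed
  have B_nn: "0 \<le> ?B x r" if "0 < x" "0 < r" for x r
    using C that by simp
  have B_int: "integrable (lborel_pos \<Otimes>\<^sub>M lborel_pos) (case_prod ?B)"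
  proof (rule lborel_pos_Fubini_integrable)
    show "case_prod ?B \<in> borel_measurable (lborel_pos \<Otimes>\<^sub>M lborel_pos)"
      unfolding case_prod_beta by measurable
    show "has_bochner_integral lborel_pos (\<lambda>r. \<bar>?B x r\<bar>) (?N x)" if "0 < x" for x
      using iffD1[OF has_bochner_integral_lborel_pos_cong[OF abs_of_nonneg[OF B_nn, symmetric] refl]
          B[OF that]] that by blast
    have "integrable lborel_pos (\<lambda>x. C * ?\<beta> * (x powr (1 - s - 1) / (1 + x)))"
      using has_bochner_integral_Beta[of "1 - s"] s
      by (intro integrable_mult_right) (simp add: has_bochner_integral_iff)
    then show "integrable lborel_pos ?N" by (simp add: mult_ac)
    show "(LINT r|lborel_pos. ?B x r) = ?N x" if "0 < x" for x
      using B[OF that] by (simp add: has_bochner_integral_iff)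
  qed
  have g_int: "integrable (lborel_pos \<Otimes>\<^sub>M lborel_pos) (case_prod ?g)"
  proof (rule Bochner_Integration.integrable_bound[OF B_int g_meas], rule AE_I2)
    fix p assume "p \<in> space (lborel_pos \<Otimes>\<^sub>M lborel_pos)"
    then obtain x r where p: "p = (x, r)" "0 < x" "0 < r" by (auto simp: space_pair_measure)
    have "\<bar>?g x r\<bar> \<le> r powr (s - 1) * (C / ((1 + x) * (1 + x * r)))"
      unfolding abs_mult using k[of x "x * r"] p by (intro mult_mono) auto
    also have "\<dots> = ?B x r" by simp
    also have "\<dots> = \<bar>?B x r\<bar>" by (rule abs_of_nonneg[OF B_nn[OF p(2,3)], symmetric])
    finally show "norm (case_prod ?g p) \<le> norm (case_prod ?B p)" using p by simp
  qed
  have inner_x: "x powr (- s) * (LINT y|lborel_pos. y powr (s - 1) * k x y) = (LINT r|lborel_pos. ?g x r)"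
    if x: "0 < x" for x
  proof -
    have "integrable lborel_pos (\<lambda>y. y powr (s - 1) * k x y)"
    proof (rule Bochner_Integration.integrable_bound)
      show "integrable lborel_pos (\<lambda>y. C / (1 + x) * (y powr (s - 1) / (1 + y)))"
        using has_bochner_integral_Beta[OF s]
        by (intro integrable_mult_right) (simp add: has_bochner_integral_iff)
      show "(\<lambda>y. y powr (s - 1) * k x y) \<in> borel_measurable lborel_pos"
        unfolding k_def by measurable
      show "AE y in lborel_pos. norm (y powr (s - 1) * k x y)
          \<le> norm (C / (1 + x) * (y powr (s - 1) / (1 + y)))"
      proof (rule AE_I2)
        fix y assume "y \<in> space lborel_pos"
        then have y: "0 < y" by simp
        have "y powr (s - 1) * \<bar>k x y\<bar> \<le> y powr (s - 1) * (C / ((1 + x) * (1 + y)))"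
          using k[OF x y] by (intro mult_left_mono) auto
        then show "norm (y powr (s - 1) * k x y) \<le> norm (C / (1 + x) * (y powr (s - 1) / (1 + y)))"
          using x y C by (simp add: abs_mult mult.commute)
      qed
    qed
    then have "has_bochner_integral lborel_pos (\<lambda>y. y powr (s - 1) * k x y)
        (LINT y|lborel_pos. y powr (s - 1) * k x y)"
      by (simp add: has_bochner_integral_iff)
    from scale[OF this x] show ?thesis by (simp add: has_bochner_integral_iff)
  qed
  \<comment> \<open>Since x - x r = (1 - r) x, this is a Frullani integral with limits l at 0 and 0
    at infinity. The value r = 1 is the diagonal, where the quotient is a division by zero;
    integrability in x comes from Fubini and holds for almost every r.\<close>
  have inner_r: "(LINT x|lborel_pos. ?g x r) = l * (r powr (s - 1) * (ln r / (r - 1)))"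
    if r: "0 < r" "r \<noteq> 1" and int: "integrable lborel_pos (\<lambda>x. ?g x r)" for r
  proof -
    let ?h = "\<lambda>x. (f (r * x) - f x) / x"
    have g_eq: "?g x r = r powr (s - 1) / (1 - r) * ?h x" if "0 < x" for x
    proof -
      have "x - x * r = (1 - r) * x" by (simp add: algebra_simps)
      then show ?thesis by (simp add: k_def mult.commute)
    qed
    have "integrable lborel_pos (\<lambda>x. r powr (s - 1) / (1 - r) * ?h x)"
      using int by (subst Bochner_Integration.integrable_cong[OF refl g_eq[symmetric]]) auto
    then have "integrable lborel_pos (\<lambda>x. (1 - r) / r powr (s - 1) * (r powr (s - 1) / (1 - r) * ?h x))"
      by (rule integrable_mult_right)
    then have h: "integrable lborel_pos ?h" using r by simp
    have "(LINT x|lborel_pos. ?g x r) = (LINT x|lborel_pos. r powr (s - 1) / (1 - r) * ?h x)"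
      using g_eq by (intro Bochner_Integration.integral_cong) auto
    also have "\<dots> = r powr (s - 1) / (1 - r) * (LINT x|lborel_pos. ?h x)"
      by (rule integral_mult_right_zero)
    also have "\<dots> = r powr (s - 1) / (1 - r) * ((0 - l) * ln r)"
      using Frullani[OF cont lim0 lim_top r(1) h] by simp
    also have "\<dots> = l * (r powr (s - 1) * (ln r / (r - 1)))"
    proof -
      have "- (1 / (1 - r)) = 1 / (r - 1)" by (simp add: minus_divide_right)
      moreover have "r powr (s - 1) / (1 - r) * ((0 - l) * ln r)
          = l * (r powr (s - 1) * (ln r * - (1 / (1 - r))))"
        by simp
      ultimately show ?thesis by simp
    qed
    finally show ?thesis .
  qed
  have "(LINT x|lborel_pos. x powr (- s) * (LINT y|lborel_pos. y powr (s - 1) * k x y))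
      = (LINT x|lborel_pos. LINT r|lborel_pos. ?g x r)"
    using inner_x by (intro Bochner_Integration.integral_cong) auto
  also have "\<dots> = (LINT r|lborel_pos. LINT x|lborel_pos. ?g x r)"
    by (rule lborel_pos_pair.Fubini_integral[OF g_int, symmetric])
  also have "\<dots> = (LINT r|lborel_pos. l * (r powr (s - 1) * (ln r / (r - 1))))"
  proof (rule integral_cong_AE)
    show "(\<lambda>r. LINT x|lborel_pos. ?g x r) \<in> borel_measurable lborel_pos"
      using lborel_pos_pair.integrable_snd[OF g_int] by (rule borel_measurable_integrable)
    show "AE r in lborel_pos. (LINT x|lborel_pos. ?g x r) = l * (r powr (s - 1) * (ln r / (r - 1)))"
      using lborel_pos_pair.AE_integrable_snd[OF g_int] AE_lborel_pos AE_lborel_pos_neq[of 1]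
      by eventually_elim (rule inner_r)
  qed measurable
  also have "\<dots> = l * (LINT r|lborel_pos. r powr (s - 1) * (ln r / (r - 1)))"
    by (rule integral_mult_right_zero)
  finally show ?thesis unfolding k_def .
qed

text \<open>The constant is evaluated by applying the auxiliary identity to \<open>f(x) = 1 / (1 + x)\<close>.\<close>

lemma difference_quotient_integral:
  fixes f :: "real \<Rightarrow> real" and s :: real
  assumes s: "0 < s" "s < 1"
    and bound: "\<And>x y. 0 < x \<Longrightarrow> 0 < y \<Longrightarrow> \<bar>f y - f x\<bar> \<le> C * \<bar>x - y\<bar> / ((1 + x) * (1 + y))"
    and lim0: "(f \<longlongrightarrow> l) (at_right 0)" and lim_top: "(f \<longlongrightarrow> 0) at_top"
  shows "(LINT x|lborel_pos. x powr (- s) * (LINT y|lborel_pos. y powr (s - 1) * ((f y - f x) / (x - y))))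
    = l * (pi / sin (pi * s)) ^ 2"
proof -
  let ?\<beta> = "pi / sin (pi * s)"
  let ?q = "\<lambda>x :: real. 1 / (1 + x)"
  have q_diff: "?q y - ?q x = (x - y) * (1 / ((1 + x) * (1 + y)))" if "0 < x" "0 < y" for x y
    using that by (simp add: diff_frac_eq)
  have "(LINT r|lborel_pos. r powr (s - 1) * (ln r / (r - 1)))
      = (LINT x|lborel_pos. x powr (- s) * (LINT y|lborel_pos. y powr (s - 1) * ((?q y - ?q x) / (x - y))))"
  proof (subst difference_quotient_integral_aux[OF s, where C = 1 and l = 1])
    show "\<bar>?q y - ?q x\<bar> \<le> 1 * \<bar>x - y\<bar> / ((1 + x) * (1 + y))" if "0 < x" "0 < y" for x y
      using that q_diff[OF that] by (simp add: abs_mult)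
    show "(?q \<longlongrightarrow> 1) (at_right 0)" by real_asymp
    show "(?q \<longlongrightarrow> 0) at_top" by real_asymp
  qed simp
  \<comment> \<open>For this test function the quotient is 1 / ((1 + x) (1 + y)) off the diagonal,
    so the double integral factors into the Beta integrals for s and 1 - s, which have the same
    value.\<close>
  also have "\<dots> = (LINT x|lborel_pos. ?\<beta> * (x powr (1 - s - 1) / (1 + x)))"
  proof (intro Bochner_Integration.integral_cong refl)
    fix x assume "x \<in> space lborel_pos"
    then have x: "0 < x" by simp
    have "(LINT y|lborel_pos. y powr (s - 1) * ((?q y - ?q x) / (x - y)))
        = (LINT y|lborel_pos. 1 / (1 + x) * (y powr (s - 1) / (1 + y)))"
    proof (rule integral_cong_AE)
      show "AE y in lborel_pos. y powr (s - 1) * ((?q y - ?q x) / (x - y))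
          = 1 / (1 + x) * (y powr (s - 1) / (1 + y))"
        using AE_lborel_pos AE_lborel_pos_neq[of x]
      proof eventually_elim
        case (elim y)
        then show ?case by (subst q_diff[OF x]) auto
      qed
    qed measurable
    also have "\<dots> = 1 / (1 + x) * (LINT y|lborel_pos. y powr (s - 1) / (1 + y))"
      by (rule integral_mult_right_zero)
    also have "\<dots> = 1 / (1 + x) * ?\<beta>"
      using has_bochner_integral_Beta[OF s] by (simp add: has_bochner_integral_iff)
    finally show "x powr (- s) * (LINT y|lborel_pos. y powr (s - 1) * ((?q y - ?q x) / (x - y)))
        = ?\<beta> * (x powr (1 - s - 1) / (1 + x))"
      by (simp add: mult_ac)
  qed
  also have "\<dots> = ?\<beta> * (LINT x|lborel_pos. x powr (1 - s - 1) / (1 + x))"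
    by (rule integral_mult_right_zero)
  also have "\<dots> = ?\<beta> * (pi / sin (pi * (1 - s)))"
    using has_bochner_integral_Beta[of "1 - s"] s by (simp add: has_bochner_integral_iff)
  also have "sin (pi * (1 - s)) = sin (pi * s)" by (simp add: right_diff_distrib sin_diff)
  finally show ?thesis
    using difference_quotient_integral_aux[OF assms] by (simp add: power2_eq_square)
qed

section \<open>The resolvent of a bounded semigroup\<close>

text \<open>Dividing by a bound \<open>K\<close> brings \<phi> into the unit ball. The extension is
  needed for compositions of \<phi> with \<open>T h\<close> or \<open>R x\<close>, which is how
  these operators are moved under an integral.\<close>

lemma has_bint_Ioi_bounded_linear:
  fixes \<phi> :: "'a::real_normed_vector \<Rightarrow> real"
  assumes f: "has_bint_Ioi f w" and cont: "continuous_on {0<..} f" and "bounded_linear \<phi>"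
  shows "has_bochner_integral lborel_pos (\<lambda>t. \<phi> (f t)) (\<phi> w)"
proof -
  interpret bounded_linear \<phi> by fact
  obtain K where K: "0 < K" "\<And>x. norm (\<phi> x) \<le> norm x * K" using pos_bounded by blast
  have lin: "linear (\<lambda>x. \<phi> x / K)"
    by (rule linearI) (auto simp: add scale add_divide_distrib)
  have le: "\<bar>\<phi> x / K\<bar> \<le> norm x" for x
    using K by (simp add: abs_divide divide_le_eq)
  have "has_bochner_integral lborel_pos (\<lambda>t. K * (\<phi> (f t) / K)) (K * (\<phi> w / K))"
    by (intro has_bochner_integral_mult_right has_bint_Ioi_functional[OF f cont lin le])
  then show ?thesis using K by simp
qed

lemma bounded_linear_functional:
  fixes \<phi> :: "'a::real_normed_vector \<Rightarrow> real"
  assumes "linear \<phi>" "\<And>x. \<bar>\<phi> x\<bar> \<le> norm x"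
  shows "bounded_linear \<phi>"
  using assms by (intro bounded_linear.intro bounded_linear_axioms.intro exI[of _ 1]) auto

section \<open>The Laplace transform of the semigroup as resolvent\<close>

locale bounded_C0_semigroup =
  fixes T :: "real \<Rightarrow> 'a::banach \<Rightarrow> 'a" and M :: real
  assumes C0: "C0_semigroup T" and M_pos: "0 < M"
    and norm_T: "0 \<le> t \<Longrightarrow> norm (T t u) \<le> M * norm u"
begin

lemma bounded_linear_T: "0 \<le> t \<Longrightarrow> bounded_linear (T t)"
  and T_zero: "T 0 u = u"
  and T_T: "0 \<le> a \<Longrightarrow> 0 \<le> b \<Longrightarrow> T a (T b u) = T (a + b) u"
  and T_tendsto: "((\<lambda>t. T t u) \<longlongrightarrow> u) (at_right 0)"
  using C0 by (auto simp: C0_semigroup_def)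

lemma norm_T_diff:
  assumes "0 \<le> a" "a \<le> b"
  shows "norm (T b u - T a u) \<le> M * norm (T (b - a) u - u)"
proof -
  have "T b u - T a u = T a (T (b - a) u - u)"
    using assms T_T[of a "b - a" u] by (simp add: linear_diff[OF bounded_linear.linear[OF bounded_linear_T]])
  then show ?thesis using norm_T[OF assms(1)] by simp
qed

text \<open>By \<open>norm_T_diff\<close> every increment is bounded by an increment at 0, with a
  factor independent of the base point; this treats both sides of a point at once.\<close>

lemma continuous_on_T: "continuous_on {0<..} (\<lambda>t. T t u)"
  unfolding continuous_on_iff
proof (intro ballI allI impI)
  fix t e :: real assume t: "t \<in> {0<..}" and e: "0 < e"
  have "\<forall>\<^sub>F h in at_right 0. dist (T h u) u < e / M"
    using T_tendsto e M_pos by (intro tendstoD) auto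
  then obtain d where d: "0 < d" "\<And>h. 0 < h \<Longrightarrow> h < d \<Longrightarrow> dist (T h u) u < e / M"
    by (auto simp: eventually_at_right_field)
  have small: "norm (T b u - T a u) < e" if "0 < a" "a \<le> b" "b - a < d" for a b
  proof (cases "a = b")
    case False
    have "M * norm (T (b - a) u - u) < M * (e / M)"
      using d(2)[of "b - a"] that False M_pos by (intro mult_strict_left_mono) (auto simp: dist_norm)
    then show ?thesis using norm_T_diff[of a b u] that M_pos by simp
  qed (use e in simp)
  have "dist (T r u) (T t u) < e" if "r \<in> {0<..}" "dist r t < d" for r
    using that t small[of r t] small[of t r]
    by (cases "r \<le> t") (auto simp: dist_norm norm_minus_commute)
  then show "\<exists>d>0. \<forall>r\<in>{0<..}. dist r t < d \<longrightarrow> dist (T r u) (T t u) < e"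
    using d(1) by blast
qed

text \<open>For \<mu> > 0 this is the inverse of \<mu>I + A, as \<open>R_in_A\<close> and
  \<open>R_A\<close> will show; other values of \<mu> have no meaning here.\<close>

definition R :: "real \<Rightarrow> 'a \<Rightarrow> 'a" where
  "R \<mu> x = bint_Ioi (\<lambda>t. exp (- (\<mu> * t)) *\<^sub>R T t x)"

lemma continuous_on_R_integrand: "continuous_on {0<..} (\<lambda>t. exp (- (\<mu> * t)) *\<^sub>R T t x)"
  by (intro continuous_intros continuous_on_T)

lemma norm_R_integrand: "0 < t \<Longrightarrow> norm (exp (- (\<mu> * t)) *\<^sub>R T t x) \<le> M * norm x * exp (- (\<mu> * t))"
  using norm_T[of t x] by (simp add: mult.commute)

lemma has_bint_R:
  assumes "0 < \<mu>"
  shows "has_bint_Ioi (\<lambda>t. exp (- (\<mu> * t)) *\<^sub>R T t x) (R \<mu> x)"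
proof -
  have "bintegrable_Ioi (\<lambda>t. exp (- (\<mu> * t)) *\<^sub>R T t x)"
  proof (rule bintegrable_Ioi_dominated[OF continuous_on_R_integrand _ norm_R_integrand])
    show "integrable lborel_pos (\<lambda>t. M * norm x * exp (- (\<mu> * t)))"
      using has_bochner_integral_exp[OF assms]
      by (intro integrable_mult_right) (simp add: has_bochner_integral_iff)
  qed
  then show ?thesis by (auto simp: bintegrable_Ioi_def R_def bint_Ioi_eq)
qed

lemma has_bochner_integral_R:
  assumes "0 < \<mu>" "bounded_linear \<phi>"
  shows "has_bochner_integral lborel_pos (\<lambda>t. exp (- (\<mu> * t)) * \<phi> (T t x)) (\<phi> (R \<mu> x))"
  using has_bint_Ioi_bounded_linear[OF has_bint_R[OF assms(1)] continuous_on_R_integrand assms(2)]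
  by (simp add: linear_scale[OF bounded_linear.linear[OF assms(2)]])

lemma norm_R:
  assumes "0 < \<mu>"
  shows "norm (R \<mu> x) \<le> M / \<mu> * norm x"
proof -
  have "has_bochner_integral lborel_pos (\<lambda>t. M * norm x * exp (- (\<mu> * t))) (M * norm x * (1 / \<mu>))"
    by (intro has_bochner_integral_mult_right has_bochner_integral_exp assms)
  with has_bint_Ioi_norm_le[OF has_bint_R[OF assms] continuous_on_R_integrand _ norm_R_integrand, of x]
  show ?thesis by (simp add: has_bochner_integral_iff)
qed

lemma bounded_linear_R:
  assumes \<mu>: "0 < \<mu>"
  shows "bounded_linear (R \<mu>)"
proof (rule bounded_linear_intro)
  show "norm (R \<mu> x) \<le> norm x * (M / \<mu>)" for x using norm_R[OF \<mu>, of x] by (simp add: mult.commute)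
  show "R \<mu> (x + y) = R \<mu> x + R \<mu> y" for x y
  proof (rule eq_by_functionals)
    fix \<phi> :: "'a \<Rightarrow> real" assume "linear \<phi>" "\<And>x. \<bar>\<phi> x\<bar> \<le> norm x"
    then have \<phi>: "bounded_linear \<phi>" by (rule bounded_linear_functional)
    note R = has_bochner_integral_R[OF \<mu> \<phi>]
    have "has_bochner_integral lborel_pos (\<lambda>t. exp (- (\<mu> * t)) * \<phi> (T t (x + y))) (\<phi> (R \<mu> x) + \<phi> (R \<mu> y))"
      by (rule iffD1[OF has_bochner_integral_lborel_pos_cong has_bochner_integral_add[OF R[of x] R[of y]]])
        (simp_all add: linear_add[OF bounded_linear.linear[OF bounded_linear_T]] linear_add[OF bounded_linear.linear[OF \<phi>]] distrib_left)
    from has_bochner_integral_eq[OF R this]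
    show "\<phi> (R \<mu> (x + y)) = \<phi> (R \<mu> x + R \<mu> y)" by (simp add: linear_add[OF bounded_linear.linear[OF \<phi>]])
  qed
  show "R \<mu> (c *\<^sub>R x) = c *\<^sub>R R \<mu> x" for c x
  proof (rule eq_by_functionals)
    fix \<phi> :: "'a \<Rightarrow> real" assume "linear \<phi>" "\<And>x. \<bar>\<phi> x\<bar> \<le> norm x"
    then have \<phi>: "bounded_linear \<phi>" by (rule bounded_linear_functional)
    note R = has_bochner_integral_R[OF \<mu> \<phi>]
    have "has_bochner_integral lborel_pos (\<lambda>t. exp (- (\<mu> * t)) * \<phi> (T t (c *\<^sub>R x))) (c * \<phi> (R \<mu> x))"
      by (rule iffD1[OF has_bochner_integral_lborel_pos_cong has_bochner_integral_mult_right[OF R[of x], of c]])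
        (simp_all add: linear_scale[OF bounded_linear.linear[OF bounded_linear_T]] linear_scale[OF bounded_linear.linear[OF \<phi>]])
    from has_bochner_integral_eq[OF R this]
    show "\<phi> (R \<mu> (c *\<^sub>R x)) = \<phi> (c *\<^sub>R R \<mu> x)" by (simp add: linear_scale[OF bounded_linear.linear[OF \<phi>]])
  qed
qed

text \<open>The composition of \<phi> with \<open>T h\<close> is again a bounded functional, so it
  may be applied to the integral defining \<open>R \<mu> x\<close>; the semigroup law then exchanges
  the two operators.\<close>

lemma T_R:
  assumes \<mu>: "0 < \<mu>" and h: "0 \<le> h"
  shows "T h (R \<mu> x) = R \<mu> (T h x)"
proof (rule eq_by_functionals)
  fix \<phi> :: "'a \<Rightarrow> real" assume "linear \<phi>" "\<And>x. \<bar>\<phi> x\<bar> \<le> norm x"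
  then have \<phi>: "bounded_linear \<phi>" by (rule bounded_linear_functional)
  have "bounded_linear (\<lambda>x. \<phi> (T h x))"
    by (rule bounded_linear_compose[OF \<phi> bounded_linear_T[OF h]])
  from has_bochner_integral_R[OF \<mu> this]
  have "has_bochner_integral lborel_pos (\<lambda>t. exp (- (\<mu> * t)) * \<phi> (T h (T t x))) (\<phi> (T h (R \<mu> x)))" .
  also have "?this \<longleftrightarrow>
      has_bochner_integral lborel_pos (\<lambda>t. exp (- (\<mu> * t)) * \<phi> (T t (T h x))) (\<phi> (T h (R \<mu> x)))"
    using h by (intro has_bochner_integral_lborel_pos_cong) (simp_all add: T_T add.commute)
  finally show "\<phi> (T h (R \<mu> x)) = \<phi> (R \<mu> (T h x))"
    using has_bochner_integral_R[OF \<mu> \<phi>] by (rule has_bochner_integral_eq)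
qed

text \<open>By the semigroup law, e^(-\<mu>h) T_h R x is the part of the Laplace integral beyond h.
  The vector on the left is therefore the integral of e^(-\<mu>t) T_t x - x over (0, h].\<close>

lemma R_estimate:
  assumes \<mu>: "0 < \<mu>" and h: "0 < h"
    and e: "\<And>t. 0 < t \<Longrightarrow> t \<le> h \<Longrightarrow> norm (exp (- (\<mu> * t)) *\<^sub>R T t x - x) \<le> e"
  shows "norm (R \<mu> x - exp (- (\<mu> * h)) *\<^sub>R T h (R \<mu> x) - h *\<^sub>R x) \<le> h * e"
proof (rule norm_le_by_functionals)
  fix \<phi> :: "'a \<Rightarrow> real" assume \<phi>': "linear \<phi>" "\<And>x. \<bar>\<phi> x\<bar> \<le> norm x"
  then have \<phi>: "bounded_linear \<phi>" by (rule bounded_linear_functional)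
  interpret \<phi>: bounded_linear \<phi> by (rule \<phi>)
  let ?F = "\<lambda>t. exp (- (\<mu> * t)) * \<phi> (T t x)"
  have F: "integrable lborel_pos ?F" "integral\<^sup>L lborel_pos ?F = \<phi> (R \<mu> x)"
    using has_bochner_integral_R[OF \<mu> \<phi>] by (auto simp: has_bochner_integral_iff)
  have "{0<..} \<inter> {h<..} \<in> sets lborel_pos" by (auto simp: sets_restrict_space)
  moreover have "{0<..} \<inter> {h<..} = {h<..}" using h by auto
  ultimately have "{h<..} \<in> sets lborel_pos" by simp
  then have F_hi: "integrable lborel_pos (\<lambda>t. indicator {h<..} t * ?F t)"
    using integrable_mult_indicator[OF _ F(1), of "{h<..}"] by simp
  have "has_bochner_integral lborel (\<lambda>t. indicator {0<..h} t :: real) h"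
    using h by (simp add: has_bochner_integral_iff)
  also have "(\<lambda>t. indicator {0<..h} t :: real) = (\<lambda>t. indicator {0<..} t * (1 - indicator {h<..} t))"
    using h by (auto simp: fun_eq_iff indicator_def)
  finally have ind: "has_bochner_integral lborel_pos (\<lambda>t. 1 - indicator {h<..} t :: real) h"
    by (simp add: has_bochner_integral_lborel_pos_iff)
  then have ind_int: "integrable lborel_pos (\<lambda>t. (1 - indicator {h<..} t) * c)" for c :: real
    by (intro integrable_mult_left) (auto simp: has_bochner_integral_iff)
  have "\<phi> (T h (R \<mu> x)) = (LINT t|lborel_pos. exp (- (\<mu> * t)) * \<phi> (T t (T h x)))"
    unfolding T_R[OF \<mu> less_imp_le[OF h]]
    using has_bochner_integral_R[OF \<mu> \<phi>] by (simp add: has_bochner_integral_iff)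
  also have "\<dots> = (LINT t|lborel_pos. exp (\<mu> * h) * ?F (h + t))"
  proof (intro Bochner_Integration.integral_cong refl)
    fix t assume "t \<in> space lborel_pos"
    moreover have "exp (- (\<mu> * t)) = exp (\<mu> * h) * exp (- (\<mu> * (h + t)))"
      by (simp add: algebra_simps flip: exp_add)
    ultimately show "exp (- (\<mu> * t)) * \<phi> (T t (T h x)) = exp (\<mu> * h) * ?F (h + t)"
      using h by (simp add: T_T add.commute)
  qed
  also have "\<dots> = exp (\<mu> * h) * (LINT t|lborel_pos. indicator {h<..} t * ?F t)"
    unfolding integral_mult_right_zero by (subst integral_lborel_pos_shift) (use h in auto)
  finally have "exp (- (\<mu> * h)) * \<phi> (T h (R \<mu> x)) = (LINT t|lborel_pos. indicator {h<..} t * ?F t)"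
    by (simp add: exp_minus)
  then have "\<phi> (R \<mu> x - exp (- (\<mu> * h)) *\<^sub>R T h (R \<mu> x) - h *\<^sub>R x)
      = (LINT t|lborel_pos. ?F t - indicator {h<..} t * ?F t - (1 - indicator {h<..} t) * \<phi> x)"
    using F F_hi ind by (simp add: \<phi>.diff \<phi>.scaleR has_bochner_integral_iff)
  also have "\<dots> \<le> (LINT t|lborel_pos. (1 - indicator {h<..} t) * e)"
  proof (rule integral_mono)
    show "integrable lborel_pos (\<lambda>t. ?F t - indicator {h<..} t * ?F t - (1 - indicator {h<..} t) * \<phi> x)"
      by (intro Bochner_Integration.integrable_diff F F_hi ind_int)
    show "integrable lborel_pos (\<lambda>t. (1 - indicator {h<..} t) * e)"
      by (rule ind_int)
    fix t assume "t \<in> space lborel_pos"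
    then have t: "0 < t" by simp
    show "?F t - indicator {h<..} t * ?F t - (1 - indicator {h<..} t) * \<phi> x \<le> (1 - indicator {h<..} t) * e"
    proof (cases "t \<le> h")
      case True
      have "?F t - \<phi> x = \<phi> (exp (- (\<mu> * t)) *\<^sub>R T t x - x)" by (simp add: \<phi>.diff \<phi>.scaleR)
      also have "\<dots> \<le> e" using \<phi>'(2) e[OF t True] by (meson abs_le_D1 order_trans)
      finally show ?thesis using True by simp
    qed simp
  qed
  also have "\<dots> = h * e" using ind by (simp add: has_bochner_integral_iff)
  finally show "\<phi> (R \<mu> x - exp (- (\<mu> * h)) *\<^sub>R T h (R \<mu> x) - h *\<^sub>R x) \<le> h * e" .
qed

lemma R_in_generator:
  assumes \<mu>: "0 < \<mu>"
  shows "(R \<mu> x, \<mu> *\<^sub>R R \<mu> x - x) \<in> inf_generator T"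
proof -
  \<comment> \<open>The mean over (0, h] of e^(-\<mu>t) T_t x - x, which vanishes in the limit by
    strong continuity at 0.\<close>
  define E where "E h = (1 / h) *\<^sub>R (R \<mu> x - exp (- (\<mu> * h)) *\<^sub>R T h (R \<mu> x) - h *\<^sub>R x)" for h
  have "((\<lambda>t. exp (- (\<mu> * t)) *\<^sub>R T t x) \<longlongrightarrow> exp (- (\<mu> * 0)) *\<^sub>R x) (at_right 0)"
    by (intro tendsto_intros T_tendsto)
  then have lim: "((\<lambda>t. exp (- (\<mu> * t)) *\<^sub>R T t x) \<longlongrightarrow> x) (at_right 0)" by simp
  have E: "(E \<longlongrightarrow> 0) (at_right 0)"
  proof (rule tendstoI)
    fix e :: real assume e: "0 < e"
    then have "\<forall>\<^sub>F t in at_right 0. dist (exp (- (\<mu> * t)) *\<^sub>R T t x) x < e / 2"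
      by (intro tendstoD[OF lim]) simp
    then obtain d where d: "0 < d" "\<And>t. 0 < t \<Longrightarrow> t < d \<Longrightarrow> dist (exp (- (\<mu> * t)) *\<^sub>R T t x) x < e / 2"
      by (auto simp: eventually_at_right_field)
    have "dist (E h) 0 < e" if h: "0 < h" "h < d" for h
    proof -
      have "norm (R \<mu> x - exp (- (\<mu> * h)) *\<^sub>R T h (R \<mu> x) - h *\<^sub>R x) \<le> h * (e / 2)"
        using d(2) h by (intro R_estimate \<mu>) (auto simp: dist_norm intro!: less_imp_le)
      then have "norm (E h) \<le> e / 2" using h by (simp add: E_def divide_le_eq mult.commute)
      then show ?thesis using e by simp
    qed
    then show "\<forall>\<^sub>F h in at_right 0. dist (E h) 0 < e"
      using d(1) by (auto simp: eventually_at_right_field)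
  qed
  \<comment> \<open>The definition of \<open>E h\<close>, solved for the difference quotient of the
    semigroup at \<open>R \<mu> x\<close>.\<close>
  have "((\<lambda>h. ((exp (\<mu> * h) - 1) / h) *\<^sub>R R \<mu> x - exp (\<mu> * h) *\<^sub>R x - exp (\<mu> * h) *\<^sub>R E h)
      \<longlongrightarrow> \<mu> *\<^sub>R R \<mu> x - exp (\<mu> * 0) *\<^sub>R x - exp (\<mu> * 0) *\<^sub>R 0) (at_right 0)"
  proof (intro tendsto_intros E)
    show "((\<lambda>h. (exp (\<mu> * h) - 1) / h) \<longlongrightarrow> \<mu>) (at_right 0)" by real_asymp
  qed
  moreover have "\<forall>\<^sub>F h in at_right 0. ((exp (\<mu> * h) - 1) / h) *\<^sub>R R \<mu> x - exp (\<mu> * h) *\<^sub>R x - exp (\<mu> * h) *\<^sub>R E h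
      = (1 / h) *\<^sub>R (T h (R \<mu> x) - R \<mu> x)"
  proof (rule eventually_at_right_less[THEN eventually_mono])
    fix h :: real assume h: "0 < h"
    have "exp (\<mu> * h) *\<^sub>R E h
        = (1 / h) *\<^sub>R (exp (\<mu> * h) *\<^sub>R R \<mu> x - (exp (\<mu> * h) * exp (- (\<mu> * h))) *\<^sub>R T h (R \<mu> x) - (exp (\<mu> * h) * h) *\<^sub>R x)"
      by (simp add: E_def scaleR_diff_right mult.commute)
    also have "exp (\<mu> * h) * exp (- (\<mu> * h)) = 1" by (simp flip: exp_add)
    finally have "exp (\<mu> * h) *\<^sub>R E h
        = (exp (\<mu> * h) / h) *\<^sub>R R \<mu> x - (1 / h) *\<^sub>R T h (R \<mu> x) - exp (\<mu> * h) *\<^sub>R x"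
      using h by (simp add: scaleR_diff_right)
    then show "((exp (\<mu> * h) - 1) / h) *\<^sub>R R \<mu> x - exp (\<mu> * h) *\<^sub>R x - exp (\<mu> * h) *\<^sub>R E h
        = (1 / h) *\<^sub>R (T h (R \<mu> x) - R \<mu> x)"
      by (simp add: diff_divide_distrib scaleR_diff_left scaleR_diff_right)
  qed
  ultimately have "((\<lambda>h. (1 / h) *\<^sub>R (T h (R \<mu> x) - R \<mu> x))
      \<longlongrightarrow> \<mu> *\<^sub>R R \<mu> x - exp (\<mu> * 0) *\<^sub>R x - exp (\<mu> * 0) *\<^sub>R 0) (at_right 0)"
    by (rule Lim_transform_eventually)
  then show ?thesis by (simp add: inf_generator_def)
qed

lemma inf_generator_unique: "(u, v) \<in> inf_generator T \<Longrightarrow> (u, w) \<in> inf_generator T \<Longrightarrow> v = w"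
  unfolding inf_generator_def by (auto intro: tendsto_unique[rotated])

text \<open>\<open>R \<mu>\<close> is bounded and commutes with \<open>T h\<close>, so applying it
  to the difference quotients at u gives L (R u) = R (L u). Comparison with the value of L (R u)
  from \<open>R_in_generator\<close> yields the claim.\<close>

lemma R_generator:
  assumes \<mu>: "0 < \<mu>" and uv: "(u, v) \<in> inf_generator T"
  shows "R \<mu> (\<mu> *\<^sub>R u - v) = u"
proof -
  interpret R: bounded_linear "R \<mu>" by (rule bounded_linear_R[OF \<mu>])
  have "((\<lambda>h. R \<mu> ((1 / h) *\<^sub>R (T h u - u))) \<longlongrightarrow> R \<mu> v) (at_right 0)"
    using uv by (intro R.tendsto) (simp add: inf_generator_def)
  moreover have "\<forall>\<^sub>F h in at_right 0. R \<mu> ((1 / h) *\<^sub>R (T h u - u)) = (1 / h) *\<^sub>R (T h (R \<mu> u) - R \<mu> u)"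
    by (rule eventually_at_right_less[THEN eventually_mono]) (simp add: R.scaleR R.diff T_R[OF \<mu>])
  ultimately have "(R \<mu> u, R \<mu> v) \<in> inf_generator T"
    unfolding inf_generator_def by (auto dest: Lim_transform_eventually)
  from inf_generator_unique[OF this R_in_generator[OF \<mu>]]
  show ?thesis by (simp add: R.diff R.scaleR)
qed

abbreviation A :: "'a operator" where
  "A \<equiv> neg_op (inf_generator T)"

lemma R_in_A: "0 < \<mu> \<Longrightarrow> (R \<mu> x, x - \<mu> *\<^sub>R R \<mu> x) \<in> A"
  using R_in_generator[of \<mu> x] unfolding neg_op_def by force

lemma R_A: "0 < \<mu> \<Longrightarrow> (u, a) \<in> A \<Longrightarrow> R \<mu> (\<mu> *\<^sub>R u + a) = u"
  using R_generator[of \<mu> u] unfolding neg_op_def by force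

lemma A_unique: "(u, a) \<in> A \<Longrightarrow> (u, b) \<in> A \<Longrightarrow> a = b"
  using inf_generator_unique[of u] unfolding neg_op_def by force

lemma op_app_A: "(u, a) \<in> A \<Longrightarrow> op_app A u = a"
  unfolding op_app_def using A_unique by blast

lemma op_app_shift_inverse:
  assumes \<mu>: "0 < \<mu>"
  shows "op_app ((shift_op \<mu> A)\<inverse>) x = R \<mu> x"
  unfolding op_app_def
proof (rule the_equality)
  show "(x, R \<mu> x) \<in> (shift_op \<mu> A)\<inverse>"
    using R_in_A[OF \<mu>, of x] unfolding shift_op_def by force
  show "p = R \<mu> x" if "(x, p) \<in> (shift_op \<mu> A)\<inverse>" for p
    using that R_A[OF \<mu>] unfolding shift_op_def by auto
qed

lemma resolvent_identity:
  assumes \<nu>: "0 < \<nu>" and \<mu>: "0 < \<mu>"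
  shows "R \<nu> x - R \<mu> x = (\<mu> - \<nu>) *\<^sub>R R \<nu> (R \<mu> x)"
proof -
  interpret R: bounded_linear "R \<nu>" by (rule bounded_linear_R[OF \<nu>])
  have "R \<nu> (\<nu> *\<^sub>R R \<mu> x + (x - \<mu> *\<^sub>R R \<mu> x)) = R \<mu> x"
    by (rule R_A[OF \<nu> R_in_A[OF \<mu>]])
  then have "R \<mu> x = \<nu> *\<^sub>R R \<nu> (R \<mu> x) + (R \<nu> x - \<mu> *\<^sub>R R \<nu> (R \<mu> x))"
    by (simp add: R.add R.diff R.scaleR)
  then have "R \<nu> x - R \<mu> x = R \<nu> x - (\<nu> *\<^sub>R R \<nu> (R \<mu> x) + (R \<nu> x - \<mu> *\<^sub>R R \<nu> (R \<mu> x)))"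
    by (rule arg_cong)
  then show ?thesis by (simp add: scaleR_diff_left)
qed

text \<open>On {\<mu>/2<..} the norms of the resolvents are at most 2 M / \<mu>, so the resolvent
  identity makes the map Lipschitz there.\<close>

lemma continuous_on_R: "continuous_on {0<..} (\<lambda>\<mu>. R \<mu> x)"
proof -
  have "isCont (\<lambda>\<mu>. R \<mu> x) \<mu>" if \<mu>: "0 < \<mu>" for \<mu>
  proof -
    let ?L = "(2 * M / \<mu>) * ((2 * M / \<mu>) * norm x)"
    have "?L-lipschitz_on {\<mu> / 2<..} (\<lambda>\<mu>. R \<mu> x)"
    proof (rule lipschitz_onI)
      fix a b assume "a \<in> {\<mu> / 2<..}" "b \<in> {\<mu> / 2<..}"
      then have ab: "0 < a" "\<mu> / 2 \<le> a" "0 < b" "\<mu> / 2 \<le> b" using \<mu> by auto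
      have half: "norm (R c y) \<le> 2 * M / \<mu> * norm y" if "0 < c" "\<mu> / 2 \<le> c" for c y
      proof -
        have "M / c \<le> M / (\<mu> / 2)" using that \<mu> M_pos by (intro divide_left_mono) auto
        then have "M / c * norm y \<le> 2 * M / \<mu> * norm y" by (intro mult_right_mono) (auto simp: mult.commute)
        with norm_R[OF that(1), of y] show ?thesis by linarith
      qed
      have "norm (R a (R b x)) \<le> 2 * M / \<mu> * norm (R b x)" using half ab by blast
      also have "\<dots> \<le> ?L" using half[of b x] ab \<mu> M_pos by (intro mult_left_mono) auto
      finally have "\<bar>b - a\<bar> * norm (R a (R b x)) \<le> \<bar>b - a\<bar> * ?L" by (intro mult_left_mono) auto
      then show "dist (R a x) (R b x) \<le> ?L * dist a b"
        unfolding dist_norm resolvent_identity[OF ab(1,3)] by (simp add: abs_minus_commute mult.commute)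
    qed (use \<mu> M_pos in simp)
    then have "continuous_on {\<mu> / 2<..} (\<lambda>\<mu>. R \<mu> x)" by (rule lipschitz_on_continuous_on)
    then show ?thesis using \<mu> by (simp add: continuous_on_eq_continuous_at)
  qed
  then show ?thesis by (simp add: continuous_on_eq_continuous_at)
qed

end

section \<open>Fractional powers\<close>

lemma has_bint_Ioi_cong:
  assumes "\<And>t. 0 < t \<Longrightarrow> f t = g t"
  shows "has_bint_Ioi f w \<longleftrightarrow> has_bint_Ioi g w"
proof -
  have "(\<lambda>t. indicat_real {0<..} t *\<^sub>R f t) = (\<lambda>t. indicat_real {0<..} t *\<^sub>R g t)"
    using assms by (auto simp: fun_eq_iff indicator_def)
  then show ?thesis by (simp add: has_bint_Ioi_def)
qed

section \<open>The semigroup formula for the power and Balakrishnan's integral\<close>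

context bounded_C0_semigroup
begin

text \<open>For u in D(A) the difference quotients converge at 0 and so are bounded on some (0,
  \<delta>); from \<delta> on, the bound (1 + M) norm u is absorbed by the factor 1 /
  \<delta>.\<close>

lemma norm_diff_T_le:
  assumes ua: "(u, a) \<in> A"
  obtains K where "\<And>t. 0 < t \<Longrightarrow> norm (u - T t u) \<le> K * min 1 t"
proof -
  have "((\<lambda>t. (1 / t) *\<^sub>R (T t u - u)) \<longlongrightarrow> - a) (at_right 0)"
    using ua by (auto simp: neg_op_def inf_generator_def)
  then have "((\<lambda>t. norm ((1 / t) *\<^sub>R (T t u - u))) \<longlongrightarrow> norm (- a)) (at_right 0)"
    by (rule tendsto_norm)
  then have "\<forall>\<^sub>F t in at_right 0. norm ((1 / t) *\<^sub>R (T t u - u)) < norm (- a) + 1"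
    by (rule order_tendstoD(2)) simp
  then obtain d where d: "0 < d"
    "\<And>t. 0 < t \<Longrightarrow> t < d \<Longrightarrow> norm ((1 / t) *\<^sub>R (T t u - u)) < norm (- a) + 1"
    by (auto simp: eventually_at_right_field)
  define \<delta> where "\<delta> = min 1 d"
  have \<delta>: "0 < \<delta>" "\<delta> \<le> 1" "\<delta> \<le> d" using d(1) by (auto simp: \<delta>_def)
  let ?K1 = "norm a + 1" and ?K2 = "(1 + M) * norm u"
  have K2: "0 \<le> ?K2 / \<delta>" using \<delta> M_pos by simp
  show thesis
  proof
    fix t :: real assume t: "0 < t"
    show "norm (u - T t u) \<le> (?K1 + ?K2 / \<delta>) * min 1 t"
    proof (cases "t < \<delta>")
      case True
      have "norm (u - T t u) = t * norm ((1 / t) *\<^sub>R (T t u - u))"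
        using t by (simp add: norm_minus_commute)
      also have "\<dots> \<le> t * ?K1"
        using d(2)[of t] True \<delta> t by (intro mult_left_mono) auto
      also have "\<dots> \<le> t * (?K1 + ?K2 / \<delta>)"
        using t K2 by (intro mult_left_mono) auto
      finally show ?thesis using True \<delta> t by (simp add: min_def mult.commute)
    next
      case False
      have "norm (u - T t u) \<le> norm u + norm (T t u)" by (rule norm_triangle_ineq4)
      also have "\<dots> \<le> ?K2" using norm_T[of t u] t by (simp add: ring_distribs)
      also have "\<dots> = ?K2 / \<delta> * \<delta>" using \<delta> by simp
      also have "\<dots> \<le> ?K2 / \<delta> * min 1 t"
        using False \<delta> K2 by (intro mult_left_mono) auto
      also have "\<dots> \<le> (?K1 + ?K2 / \<delta>) * min 1 t"
        using t by (intro mult_right_mono) auto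
      finally show ?thesis .
    qed
  qed
qed

lemma continuous_on_A_power_integrand:
  "continuous_on {0<..} (\<lambda>t. t powr p *\<^sub>R (u - T t u))"
  by (intro continuous_intros continuous_on_T) auto

text \<open>This is w_s. The prefactor is the one that gives c^s for the scalar semigroup e^(-ct),
  by \<open>has_bochner_integral_one_minus_exp\<close>.\<close>

definition A_power :: "real \<Rightarrow> 'a \<Rightarrow> 'a" where
  "A_power s u = (s / Gamma (1 - s)) *\<^sub>R bint_Ioi (\<lambda>t. t powr (- 1 - s) *\<^sub>R (u - T t u))"

lemma has_bint_A_power:
  assumes ua: "(u, a) \<in> A" and s: "0 < s" "s < 1"
  shows "has_bint_Ioi (\<lambda>t. t powr (- 1 - s) *\<^sub>R (u - T t u)) ((Gamma (1 - s) / s) *\<^sub>R A_power s u)"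
proof -
  obtain K where K: "\<And>t. 0 < t \<Longrightarrow> norm (u - T t u) \<le> K * min 1 t"
    using norm_diff_T_le[OF ua] by blast
  have "bintegrable_Ioi (\<lambda>t. t powr (- 1 - s) *\<^sub>R (u - T t u))"
  proof (rule bintegrable_Ioi_dominated[OF continuous_on_A_power_integrand])
    show "integrable lborel_pos (\<lambda>t. K * (t powr (- 1 - s) * min 1 t))"
      by (intro integrable_mult_right integrable_powr_min s)
    fix t :: real assume "0 < t"
    then have "t powr (- 1 - s) * norm (u - T t u) \<le> t powr (- 1 - s) * (K * min 1 t)"
      by (intro mult_left_mono K) auto
    then show "norm (t powr (- 1 - s) *\<^sub>R (u - T t u)) \<le> K * (t powr (- 1 - s) * min 1 t)"
      by (simp add: mult.left_commute)
  qed
  moreover have "Gamma (1 - s) \<noteq> 0" using Gamma_real_pos[of "1 - s"] s by linarith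
  ultimately show ?thesis
    using s by (auto simp: bintegrable_Ioi_def A_power_def bint_Ioi_eq)
qed

lemma continuous_on_powr_R: "continuous_on {0<..} (\<lambda>\<mu>. \<mu> powr p *\<^sub>R R \<mu> x)"
  by (intro continuous_intros continuous_on_R) auto

lemma bintegrable_powr_R:
  assumes s: "0 < s" "s < 1"
    and C: "\<And>\<mu>. 0 < \<mu> \<Longrightarrow> norm (R \<mu> x) \<le> C / (1 + \<mu>)"
  shows "bintegrable_Ioi (\<lambda>\<mu>. \<mu> powr (s - 1) *\<^sub>R R \<mu> x)"
proof (rule bintegrable_Ioi_dominated[OF continuous_on_powr_R])
  show "integrable lborel_pos (\<lambda>\<mu>. C * (\<mu> powr (s - 1) / (1 + \<mu>)))"
    using has_bochner_integral_Beta[OF s]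
    by (intro integrable_mult_right) (simp add: has_bochner_integral_iff)
  fix \<mu> :: real assume "0 < \<mu>"
  then have "\<mu> powr (s - 1) * norm (R \<mu> x) \<le> \<mu> powr (s - 1) * (C / (1 + \<mu>))"
    by (intro mult_left_mono C) auto
  then show "norm (\<mu> powr (s - 1) *\<^sub>R R \<mu> x) \<le> C * (\<mu> powr (s - 1) / (1 + \<mu>))"
    by (simp add: mult.commute)
qed

text \<open>Shared by two cases: for bounded A the integral is the one in the definition of the
  power, and for invertible A it is \<open>Q (1 - s) a\<close>.\<close>

lemma has_bint_Balakrishnan:
  assumes ua: "(u, a) \<in> A" and s: "0 < s" "s < 1"
  shows "has_bint_Ioi (\<lambda>\<mu>. \<mu> powr (s - 1) *\<^sub>R R \<mu> a) ((pi / sin (pi * s)) *\<^sub>R A_power s u)"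
proof (rule has_bint_IoiI[OF _ continuous_on_powr_R])
  have Ra: "R \<mu> a = u - \<mu> *\<^sub>R R \<mu> u" if \<mu>: "0 < \<mu>" for \<mu>
  proof -
    interpret R: bounded_linear "R \<mu>" by (rule bounded_linear_R[OF \<mu>])
    show ?thesis using R_A[OF \<mu> ua] by (simp add: R.add R.scaleR algebra_simps)
  qed
  show "bintegrable_Ioi (\<lambda>\<mu>. \<mu> powr (s - 1) *\<^sub>R R \<mu> a)"
  proof (rule bintegrable_powr_R[OF s])
    fix \<mu> :: real assume \<mu>: "0 < \<mu>"
    \<comment> \<open>Two bounds are added: R a = u - \<mu> R u stays bounded near \<mu> = 0, and
      \<mu> norm (R a) \<le> M norm a gives the decay at infinity.\<close>
    have "norm (R \<mu> a) \<le> norm u + norm (\<mu> *\<^sub>R R \<mu> u)" unfolding Ra[OF \<mu>] by (rule norm_triangle_ineq4)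
    also have "norm (\<mu> *\<^sub>R R \<mu> u) \<le> \<mu> * (M / \<mu> * norm u)"
      using \<mu> mult_left_mono[OF norm_R[OF \<mu>, of u], of \<mu>] by simp
    finally have 1: "norm (R \<mu> a) \<le> norm u + M * norm u" using \<mu> by simp
    have "\<mu> * norm (R \<mu> a) \<le> \<mu> * (M / \<mu> * norm a)"
      using \<mu> norm_R[OF \<mu>, of a] by (intro mult_left_mono) auto
    with 1 \<mu> have "(1 + \<mu>) * norm (R \<mu> a) \<le> norm u + M * norm u + M * norm a"
      by (simp add: ring_distribs)
    then show "norm (R \<mu> a) \<le> (norm u + M * norm u + M * norm a) / (1 + \<mu>)"
      using \<mu> by (simp add: pos_le_divide_eq mult.commute)
  qed
  fix \<phi> :: "'a \<Rightarrow> real" assume lin: "linear \<phi>" and le: "\<And>x. \<bar>\<phi> x\<bar> \<le> norm x"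
  then have \<phi>: "bounded_linear \<phi>" by (rule bounded_linear_functional)
  interpret \<phi>: bounded_linear \<phi> by (rule \<phi>)
  obtain K where K: "\<And>t. 0 < t \<Longrightarrow> norm (u - T t u) \<le> K * min 1 t"
    using norm_diff_T_le[OF ua] by blast
  let ?D = "\<lambda>t. \<phi> (u - T t u)"
  have D_meas: "?D \<in> borel_measurable lborel_pos"
    by (intro borel_measurable_lborel_pos \<phi>.continuous_on continuous_intros continuous_on_T)
  have D_le: "\<bar>?D t\<bar> \<le> K * min 1 t" if "0 < t" for t
    using le[of "u - T t u"] K[OF that] by linarith
  \<comment> \<open>The Laplace transform of u - T_t u is u / \<mu> - R u = R a / \<mu>, which
    explains the shift of the exponent from s - 1 to s.\<close>
  have inner: "\<phi> (\<mu> powr (s - 1) *\<^sub>R R \<mu> a) = \<mu> powr s * (LINT t|lborel_pos. exp (- (\<mu> * t)) * ?D t)"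
    if \<mu>: "0 < \<mu>" for \<mu>
  proof -
    have "has_bochner_integral lborel_pos (\<lambda>t. exp (- (\<mu> * t)) * \<phi> u - exp (- (\<mu> * t)) * \<phi> (T t u))
        (1 / \<mu> * \<phi> u - \<phi> (R \<mu> u))"
      by (intro has_bochner_integral_diff has_bochner_integral_mult_left has_bochner_integral_exp
          has_bochner_integral_R \<mu> \<phi>)
    then have "(LINT t|lborel_pos. exp (- (\<mu> * t)) * ?D t) = 1 / \<mu> * \<phi> u - \<phi> (R \<mu> u)"
      by (simp add: has_bochner_integral_iff \<phi>.diff right_diff_distrib)
    moreover have "\<mu> powr s = \<mu> powr (s - 1) * \<mu>" using \<mu> by (simp add: powr_diff)
    ultimately show ?thesis
      using \<mu> by (simp add: Ra \<phi>.diff \<phi>.scaleR right_diff_distrib)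
  qed
  have "has_bochner_integral lborel_pos (\<lambda>\<mu>. \<phi> (\<mu> powr (s - 1) *\<^sub>R R \<mu> a))
      (Gamma (1 + s) * (LINT t|lborel_pos. t powr (- 1 - s) * ?D t))"
    using iffD2[OF has_bochner_integral_lborel_pos_cong[OF inner refl]
        has_bochner_integral_Balakrishnan(2)[OF s D_meas D_le]] .
  moreover have "(LINT t|lborel_pos. t powr (- 1 - s) * ?D t) = Gamma (1 - s) / s * \<phi> (A_power s u)"
    using has_bint_Ioi_bounded_linear[OF has_bint_A_power[OF ua s] continuous_on_A_power_integrand \<phi>]
    by (simp add: has_bochner_integral_iff \<phi>.scaleR)
  moreover have "Gamma (1 + s) * (Gamma (1 - s) / s) = pi / sin (pi * s)"
  proof -
    have "s \<notin> \<int>\<^sub>\<le>\<^sub>0" using s by (auto elim!: nonpos_Ints_cases)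
    then have "Gamma (1 + s) = s * Gamma s" using Gamma_plus1[of s] by (simp add: add.commute)
    then show ?thesis using s by (simp flip: Gamma_reflection_real)
  qed
  ultimately have "(LINT \<mu>|lborel_pos. \<phi> (\<mu> powr (s - 1) *\<^sub>R R \<mu> a)) = pi / sin (pi * s) * \<phi> (A_power s u)"
    by (simp only: has_bochner_integral_iff mult.assoc[symmetric])
  then show "(LINT \<mu>|lborel_pos. \<phi> (\<mu> powr (s - 1) *\<^sub>R R \<mu> a)) = \<phi> ((pi / sin (pi * s)) *\<^sub>R A_power s u)"
    by (simp add: \<phi>.scaleR)
qed

end

section \<open>The case of a bounded inverse\<close>

locale invertible_bounded_C0_semigroup = bounded_C0_semigroup +
  fixes B :: "'a \<Rightarrow> 'a"
  assumes bounded_linear_B: "bounded_linear B"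
    and A_inverse: "A\<inverse> = {(w, B w) | w. True}"
begin

lemma B_in_A: "(B w, w) \<in> A"
  and A_imp_B: "(p, q) \<in> A \<Longrightarrow> p = B q"
  using A_inverse by blast+

lemma R_B:
  assumes "0 < \<nu>"
  shows "R \<nu> x + \<nu> *\<^sub>R B (R \<nu> x) = B x"
proof -
  interpret B: bounded_linear B by (rule bounded_linear_B)
  have "R \<nu> x = B x - \<nu> *\<^sub>R B (R \<nu> x)"
    using A_imp_B[OF R_in_A[OF assms, of x]] unfolding B.diff B.scaleR .
  then show ?thesis by (rule eq_diff_eq[THEN iffD1])
qed

text \<open>The general bound M / \<nu> is too large at 0 for the integrals \<open>Q\<close>. With
  an inverse, R x = B (x - \<nu> R x), and the argument of \<open>B\<close> is bounded by (1 + M)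
  norm x uniformly in \<nu>.\<close>

lemma norm_R_le_inverse:
  obtains C where "0 \<le> C" "\<And>\<nu> x. 0 < \<nu> \<Longrightarrow> norm (R \<nu> x) \<le> C / (1 + \<nu>) * norm x"
proof -
  obtain K where K: "0 < K" "\<And>x. norm (B x) \<le> norm x * K"
    using bounded_linear.pos_bounded[OF bounded_linear_B] by blast
  let ?C = "(1 + M) * K + M"
  show thesis
  proof
    show "0 \<le> ?C" using M_pos K by simp
    fix \<nu> :: real and x assume \<nu>: "0 < \<nu>"
    have \<nu>R: "\<nu> * norm (R \<nu> x) \<le> M * norm x"
      using mult_left_mono[OF norm_R[OF \<nu>, of x], of \<nu>] \<nu> by simp
    have "R \<nu> x = B (x - \<nu> *\<^sub>R R \<nu> x)" using A_imp_B[OF R_in_A[OF \<nu>, of x]] .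
    then have "norm (R \<nu> x) \<le> norm (x - \<nu> *\<^sub>R R \<nu> x) * K" using K(2) by metis
    also have "\<dots> \<le> (norm x + M * norm x) * K"
    proof (intro mult_right_mono)
      have "norm (x - \<nu> *\<^sub>R R \<nu> x) \<le> norm x + norm (\<nu> *\<^sub>R R \<nu> x)" by (rule norm_triangle_ineq4)
      then show "norm (x - \<nu> *\<^sub>R R \<nu> x) \<le> norm x + M * norm x" using \<nu>R \<nu> by simp
    qed (use K in simp)
    finally have "(1 + \<nu>) * norm (R \<nu> x) \<le> ?C * norm x"
      using \<nu>R by (simp add: algebra_simps)
    then show "norm (R \<nu> x) \<le> ?C / (1 + \<nu>) * norm x"
      using \<nu> by (simp add: pos_le_divide_eq mult.commute)
  qed
qed

text \<open>By \<open>R_B\<close> the difference is - \<nu> B (R x), where R x stays bounded. The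
  limit supplies the boundary value at 0 for the double integral in \<open>Q_Q\<close>.\<close>

lemma R_tendsto_B: "((\<lambda>\<nu>. R \<nu> x) \<longlongrightarrow> B x) (at_right 0)"
proof -
  obtain K where K: "0 < K" "\<And>x. norm (B x) \<le> norm x * K"
    using bounded_linear.pos_bounded[OF bounded_linear_B] by blast
  obtain C where C: "0 \<le> C" "\<And>\<nu> x. 0 < \<nu> \<Longrightarrow> norm (R \<nu> x) \<le> C / (1 + \<nu>) * norm x"
    using norm_R_le_inverse by blast
  have "((\<lambda>\<nu>. R \<nu> x - B x) \<longlongrightarrow> 0) (at_right 0)"
  proof (rule Lim_null_comparison)
    show "\<forall>\<^sub>F \<nu> in at_right 0. norm (R \<nu> x - B x) \<le> \<nu> * (C * norm x * K)"
    proof (rule eventually_at_right_less[THEN eventually_mono])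
      fix \<nu> :: real assume \<nu>: "0 < \<nu>"
      have "C / (1 + \<nu>) \<le> C / 1" using \<nu> C(1) by (intro divide_left_mono) auto
      then have "C / (1 + \<nu>) * norm x \<le> C * norm x" by (intro mult_right_mono) auto
      with C(2)[OF \<nu>, of x] have "norm (R \<nu> x) \<le> C * norm x" by linarith
      then have "norm (R \<nu> x) * K \<le> C * norm x * K" using K by (intro mult_right_mono) auto
      then have "norm (B (R \<nu> x)) \<le> C * norm x * K" using K(2)[of "R \<nu> x"] by linarith
      then have "\<nu> * norm (B (R \<nu> x)) \<le> \<nu> * (C * norm x * K)" using \<nu> by (intro mult_left_mono) auto
      moreover have "R \<nu> x - B x = - (\<nu> *\<^sub>R B (R \<nu> x))" by (simp add: R_B[OF \<nu>, of x, symmetric])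
      ultimately show "norm (R \<nu> x - B x) \<le> \<nu> * (C * norm x * K)" using \<nu> by simp
    qed
    have "((\<lambda>\<nu>. \<nu> * (C * norm x * K)) \<longlongrightarrow> 0 * (C * norm x * K)) (at_right 0)"
      by (intro tendsto_intros)
    then show "((\<lambda>\<nu>. \<nu> * (C * norm x * K)) \<longlongrightarrow> 0) (at_right 0)" by simp
  qed
  then show ?thesis by (rule LIM_zero_cancel)
qed

text \<open>Up to the factor \<open>sin (\<pi> s) / \<pi>\<close>, this is the power \<open>A\<^sup>-\<^sup>s\<close>.\<close>

definition Q :: "real \<Rightarrow> 'a \<Rightarrow> 'a" where
  "Q s w = bint_Ioi (\<lambda>\<nu>. \<nu> powr (- s) *\<^sub>R R \<nu> w)"

lemma has_bint_Q:
  assumes s: "0 < s" "s < 1"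
  shows "has_bint_Ioi (\<lambda>\<nu>. \<nu> powr (- s) *\<^sub>R R \<nu> w) (Q s w)"
proof -
  obtain C where "0 \<le> C" and C: "\<And>\<nu> x. 0 < \<nu> \<Longrightarrow> norm (R \<nu> x) \<le> C / (1 + \<nu>) * norm x"
    using norm_R_le_inverse by blast
  have "bintegrable_Ioi (\<lambda>\<nu>. \<nu> powr (1 - s - 1) *\<^sub>R R \<nu> w)"
  proof (rule bintegrable_powr_R)
    show "norm (R \<nu> w) \<le> C * norm w / (1 + \<nu>)" if "0 < \<nu>" for \<nu>
      using C[OF that, of w] by simp
  qed (use s in auto)
  then show ?thesis by (auto simp: bintegrable_Ioi_def Q_def bint_Ioi_eq)
qed

lemma has_bochner_integral_Q:
  assumes s: "0 < s" "s < 1" and \<phi>: "bounded_linear \<phi>"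
  shows "has_bochner_integral lborel_pos (\<lambda>\<nu>. \<nu> powr (- s) * \<phi> (R \<nu> w)) (\<phi> (Q s w))"
  using has_bint_Ioi_bounded_linear[OF has_bint_Q[OF s] continuous_on_powr_R \<phi>]
  by (simp add: linear_scale[OF bounded_linear.linear[OF \<phi>]])

lemma Q_scale:
  assumes s: "0 < s" "s < 1"
  shows "Q s (c *\<^sub>R w) = c *\<^sub>R Q s w"
proof (rule eq_by_functionals)
  fix \<phi> :: "'a \<Rightarrow> real" assume lin: "linear \<phi>" and "\<And>x. \<bar>\<phi> x\<bar> \<le> norm x"
  then have \<phi>: "bounded_linear \<phi>" by (rule bounded_linear_functional)
  have eq: "c * (\<nu> powr (- s) * \<phi> (R \<nu> w)) = \<nu> powr (- s) * \<phi> (R \<nu> (c *\<^sub>R w))" if "0 < \<nu>" for \<nu>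
    by (simp add: linear_scale[OF bounded_linear.linear[OF bounded_linear_R[OF that]]] linear_scale[OF lin])
  have "c * \<phi> (Q s w) = \<phi> (c *\<^sub>R Q s w)" by (simp add: linear_scale[OF lin])
  from iffD1[OF has_bochner_integral_lborel_pos_cong[OF eq this]
      has_bochner_integral_mult_right[OF has_bochner_integral_Q[OF s \<phi>]]]
  have "has_bochner_integral lborel_pos (\<lambda>\<nu>. \<nu> powr (- s) * \<phi> (R \<nu> (c *\<^sub>R w))) (\<phi> (c *\<^sub>R Q s w))" .
  from has_bochner_integral_eq[OF has_bochner_integral_Q[OF s \<phi>] this]
  show "\<phi> (Q s (c *\<^sub>R w)) = \<phi> (c *\<^sub>R Q s w)" .
qed

text \<open>With f(\<nu>) = \<phi>(R \<nu> v), the resolvent identity makes \<phi>(R x (R y v)) the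
  quotient (f(y) - f(x)) / (x - y). The limit of f at 0 is \<phi>(B v), and that at infinity is
  0.\<close>

lemma Q_Q:
  assumes s: "0 < s" "s < 1"
  shows "Q s (Q (1 - s) v) = (pi / sin (pi * s))\<^sup>2 *\<^sub>R B v"
proof (rule eq_by_functionals)
  fix \<phi> :: "'a \<Rightarrow> real" assume lin: "linear \<phi>" and le: "\<And>x. \<bar>\<phi> x\<bar> \<le> norm x"
  then have \<phi>: "bounded_linear \<phi>" by (rule bounded_linear_functional)
  interpret \<phi>: bounded_linear \<phi> by (rule \<phi>)
  obtain C where C: "0 \<le> C" "\<And>\<nu> x. 0 < \<nu> \<Longrightarrow> norm (R \<nu> x) \<le> C / (1 + \<nu>) * norm x"
    using norm_R_le_inverse by blast
  define f where "f \<nu> = \<phi> (R \<nu> v)" for \<nu>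
  have f_diff: "f y - f x = (x - y) * \<phi> (R x (R y v))" if "0 < x" "0 < y" for x y
  proof -
    have "f x - f y = (y - x) * \<phi> (R x (R y v))"
      unfolding f_def \<phi>.diff[symmetric] resolvent_identity[OF that] by (simp add: \<phi>.scaleR)
    then show ?thesis by (simp add: algebra_simps)
  qed
  have [measurable]: "f \<in> borel_measurable lborel_pos"
    unfolding f_def by (intro borel_measurable_lborel_pos \<phi>.continuous_on continuous_on_R)
  have inner: "\<phi> (R x (Q (1 - s) v)) = (LINT y|lborel_pos. y powr (s - 1) * ((f y - f x) / (x - y)))"
    if x: "0 < x" for x
  proof -
    have "has_bochner_integral lborel_pos (\<lambda>y. y powr (s - 1) * \<phi> (R x (R y v))) (\<phi> (R x (Q (1 - s) v)))"
      using has_bochner_integral_Q[of "1 - s", OF _ _ bounded_linear_compose[OF \<phi> bounded_linear_R[OF x]]] s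
      by simp
    then have eq: "\<phi> (R x (Q (1 - s) v)) = (LINT y|lborel_pos. y powr (s - 1) * \<phi> (R x (R y v)))"
      and meas: "(\<lambda>y. y powr (s - 1) * \<phi> (R x (R y v))) \<in> borel_measurable lborel_pos"
      by (auto simp: has_bochner_integral_iff)
    have "(LINT y|lborel_pos. y powr (s - 1) * \<phi> (R x (R y v)))
        = (LINT y|lborel_pos. y powr (s - 1) * ((f y - f x) / (x - y)))"
    proof (rule integral_cong_AE[OF meas])
      \<comment> \<open>On the null set y = x the quotient is a division by zero, so the resolvent
        identity is only used off the diagonal.\<close>
      show "AE y in lborel_pos. y powr (s - 1) * \<phi> (R x (R y v)) = y powr (s - 1) * ((f y - f x) / (x - y))"
        using AE_lborel_pos AE_lborel_pos_neq[of x]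
      proof eventually_elim
        case (elim y)
        then show ?case using f_diff[OF x, of y] by simp
      qed
    qed measurable
    with eq show ?thesis by simp
  qed
  have "\<phi> (Q s (Q (1 - s) v)) = (LINT x|lborel_pos. x powr (- s) * \<phi> (R x (Q (1 - s) v)))"
    using has_bochner_integral_Q[OF s \<phi>] by (simp add: has_bochner_integral_iff)
  also have "\<dots> = (LINT x|lborel_pos. x powr (- s) *
      (LINT y|lborel_pos. y powr (s - 1) * ((f y - f x) / (x - y))))"
    using inner by (intro Bochner_Integration.integral_cong) auto
  also have "\<dots> = \<phi> (B v) * (pi / sin (pi * s))\<^sup>2"
  proof (rule difference_quotient_integral[OF s, where C = "C * (C * norm v)"])
    show "(f \<longlongrightarrow> \<phi> (B v)) (at_right 0)" unfolding f_def by (rule \<phi>.tendsto[OF R_tendsto_B])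
    show "(f \<longlongrightarrow> 0) at_top"
    proof (rule Lim_null_comparison)
      show "\<forall>\<^sub>F \<nu> in at_top. norm (f \<nu>) \<le> M * norm v / \<nu>"
        using eventually_gt_at_top[of 0]
      proof eventually_elim
        case (elim \<nu>)
        then show ?case using norm_R[OF elim, of v] le[of "R \<nu> v"] by (simp add: f_def)
      qed
      show "((\<lambda>\<nu>. M * norm v / \<nu>) \<longlongrightarrow> 0) at_top" by real_asymp
    qed
    fix x y :: real assume xy: "0 < x" "0 < y"
    have "norm (R x (R y v)) \<le> C / (1 + x) * norm (R y v)" by (rule C(2)[OF xy(1)])
    also have "\<dots> \<le> C / (1 + x) * (C / (1 + y) * norm v)"
      using C xy by (intro mult_left_mono) auto
    also have "\<dots> = C * (C * norm v) / ((1 + x) * (1 + y))" by simp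
    finally have "\<bar>\<phi> (R x (R y v))\<bar> \<le> C * (C * norm v) / ((1 + x) * (1 + y))"
      using le[of "R x (R y v)"] by linarith
    then have "\<bar>x - y\<bar> * \<bar>\<phi> (R x (R y v))\<bar> \<le> \<bar>x - y\<bar> * (C * (C * norm v) / ((1 + x) * (1 + y)))"
      by (intro mult_left_mono) auto
    then show "\<bar>f y - f x\<bar> \<le> C * (C * norm v) * \<bar>x - y\<bar> / ((1 + x) * (1 + y))"
      unfolding f_diff[OF xy] abs_mult by (simp add: mult_ac)
  qed
  finally show "\<phi> (Q s (Q (1 - s) v)) = \<phi> ((pi / sin (pi * s))\<^sup>2 *\<^sub>R B v)"
    by (simp add: \<phi>.scaleR mult.commute)
qed

text \<open>Formally, (\<mu> + 1/A)^(-1) (1/A) = (\<mu> A + 1)^(-1) = (1/\<mu>) (1/\<mu> +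
  A)^(-1).\<close>

lemma op_app_shift_A_inverse:
  assumes \<mu>: "0 < \<mu>"
  shows "op_app ((shift_op \<mu> (A\<inverse>))\<inverse>) (B w) = (1 / \<mu>) *\<^sub>R R (1 / \<mu>) w"
proof -
  interpret B: bounded_linear B by (rule bounded_linear_B)
  have shift: "(B w, x) \<in> (shift_op \<mu> (A\<inverse>))\<inverse> \<longleftrightarrow> \<mu> *\<^sub>R x + B x = B w" for x
    unfolding shift_op_def A_inverse by auto
  show ?thesis
    unfolding op_app_def
  proof (rule the_equality)
    show "(B w, (1 / \<mu>) *\<^sub>R R (1 / \<mu>) w) \<in> (shift_op \<mu> (A\<inverse>))\<inverse>"
      unfolding shift using R_B[of "1 / \<mu>" w] \<mu> by (simp add: B.scaleR)
    fix x assume "(B w, x) \<in> (shift_op \<mu> (A\<inverse>))\<inverse>"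
    then have "\<mu> *\<^sub>R x = B (w - x)" unfolding shift by (simp add: B.diff algebra_simps)
    then have "(\<mu> *\<^sub>R x, w - x) \<in> A" using B_in_A[of "w - x"] by simp
    from R_A[OF _ this, of "1 / \<mu>"] \<mu> have "R (1 / \<mu>) w = \<mu> *\<^sub>R x" by simp
    then show "x = (1 / \<mu>) *\<^sub>R R (1 / \<mu>) w" using \<mu> by simp
  qed
qed

text \<open>The integrand is \<mu>^(s-2) R (1/\<mu>) w, and the substitution \<nu> = 1/\<mu> turns
  it into \<nu>^(-s) R \<nu> w. The power of the inverse is thus defined on all of X.\<close>

lemma balakrishnan_power_A_inverse:
  assumes s: "0 < s" "s < 1"
  shows "balakrishnan_power (A\<inverse>) s = {(w, (sin (s * pi) / pi) *\<^sub>R Q s w) | w. True}"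
proof -
  have app: "op_app (A\<inverse>) w = B w" and dom: "w \<in> Domain (A\<inverse>)" for w
    unfolding op_app_def A_inverse by auto
  have Q: "has_bint_Ioi (\<lambda>\<mu>. \<mu> powr (s - 1) *\<^sub>R op_app ((shift_op \<mu> (A\<inverse>))\<inverse>) (B w)) (Q s w)" for w
  proof (rule iffD2[OF has_bint_Ioi_cong])
    let ?f = "\<lambda>\<mu>. (\<mu> powr (s - 1) / \<mu>) *\<^sub>R R (1 / \<mu>) w"
    show "\<mu> powr (s - 1) *\<^sub>R op_app ((shift_op \<mu> (A\<inverse>))\<inverse>) (B w) = ?f \<mu>" if "0 < \<mu>" for \<mu>
      using that by (simp add: op_app_shift_A_inverse)
    have cont: "continuous_on {0<..} ?f"
      by (intro continuous_intros continuous_on_compose2[OF continuous_on_R]) auto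
    obtain C where "0 \<le> C" and C: "\<And>\<nu> x. 0 < \<nu> \<Longrightarrow> norm (R \<nu> x) \<le> C / (1 + \<nu>) * norm x"
      using norm_R_le_inverse by blast
    show "has_bint_Ioi ?f (Q s w)"
    proof (rule has_bint_IoiI[OF _ cont])
      show "bintegrable_Ioi ?f"
      proof (rule bintegrable_Ioi_dominated[OF cont])
        show "integrable lborel_pos (\<lambda>\<mu>. C * norm w * (\<mu> powr (s - 1) / (1 + \<mu>)))"
          using has_bochner_integral_Beta[OF s]
          by (intro integrable_mult_right) (simp add: has_bochner_integral_iff)
        fix \<mu> :: real assume \<mu>: "0 < \<mu>"
        have "norm (?f \<mu>) \<le> \<mu> powr (s - 1) / \<mu> * (C / (1 + 1 / \<mu>) * norm w)"
          using \<mu> C[of "1 / \<mu>" w] by (simp add: mult_left_mono divide_right_mono del: times_divide_eq_left)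
        also have "1 + 1 / \<mu> = (1 + \<mu>) / \<mu>" using \<mu> by (simp add: add_divide_distrib)
        also have "\<mu> powr (s - 1) / \<mu> * (C / ((1 + \<mu>) / \<mu>) * norm w)
            = C * norm w * (\<mu> powr (s - 1) / (1 + \<mu>))"
          using \<mu> by simp
        finally show "norm (?f \<mu>) \<le> C * norm w * (\<mu> powr (s - 1) / (1 + \<mu>))" .
      qed
      fix \<phi> :: "'a \<Rightarrow> real" assume lin: "linear \<phi>" and "\<And>x. \<bar>\<phi> x\<bar> \<le> norm x"
      then have \<phi>: "bounded_linear \<phi>" by (rule bounded_linear_functional)
      have "continuous_on {0<..} (\<lambda>\<nu>. \<nu> powr (- s) * \<phi> (R \<nu> w))"
        by (intro continuous_intros bounded_linear.continuous_on[OF \<phi>] continuous_on_R) auto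
      from has_bochner_integral_lborel_pos_inverse[OF this has_bochner_integral_Q[OF s \<phi>]]
      have "(LINT \<mu>|lborel_pos. (1 / \<mu>) powr (- s) * \<phi> (R (1 / \<mu>) w) / \<mu> ^ 2) = \<phi> (Q s w)"
        by (simp add: has_bochner_integral_iff)
      also have "(LINT \<mu>|lborel_pos. (1 / \<mu>) powr (- s) * \<phi> (R (1 / \<mu>) w) / \<mu> ^ 2)
          = (LINT \<mu>|lborel_pos. \<phi> (?f \<mu>))"
      proof (intro Bochner_Integration.integral_cong refl)
        fix \<mu> assume "\<mu> \<in> space lborel_pos"
        then have \<mu>: "0 < \<mu>" by simp
        have "(1 / \<mu>) powr (- s) = \<mu> powr s" using \<mu> by (simp add: powr_minus powr_divide)
        moreover have "\<mu> powr s = \<mu> powr (s - 1) * \<mu>" using \<mu> by (simp add: powr_diff)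
        ultimately show "(1 / \<mu>) powr (- s) * \<phi> (R (1 / \<mu>) w) / \<mu> ^ 2 = \<phi> (?f \<mu>)"
          using \<mu> by (simp add: linear_scale[OF lin] power2_eq_square)
      qed
      finally show "(LINT \<mu>|lborel_pos. \<phi> (?f \<mu>)) = \<phi> (Q s w)" .
    qed
  qed
  have "has_bint_Ioi (\<lambda>\<mu>. \<mu> powr (s - 1) *\<^sub>R op_app ((shift_op \<mu> (A\<inverse>))\<inverse>) (B w)) v \<longleftrightarrow> v = Q s w" for w v
    using Q[of w] unfolding has_bint_Ioi_def by (auto dest: has_bint_unique)
  then show ?thesis unfolding balakrishnan_power_def app using dom by auto
qed

text \<open>Membership means that u is the multiple sin(\<pi> s) / \<pi> of Q_s w. That w_s solves
  this equation follows from w_s = sin(\<pi> s) / \<pi> Q_(1-s) a and \<open>Q_Q\<close>; that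
  nothing else does is the injectivity of Q_s.\<close>

lemma inverse_balakrishnan_power_A_inverse:
  assumes ua: "(u, a) \<in> A" and s: "0 < s" "s < 1"
  shows "(u, w) \<in> (balakrishnan_power (A\<inverse>) s)\<inverse> \<longleftrightarrow> w = A_power s u"
proof -
  let ?c = "sin (pi * s) / pi"
  have c: "?c \<noteq> 0" using s sin_gt_zero[of "pi * s"] by simp
  have "has_bint_Ioi (\<lambda>\<mu>. \<mu> powr (s - 1) *\<^sub>R R \<mu> a) (Q (1 - s) a)"
    using has_bint_Q[of "1 - s" a] s by simp
  with has_bint_Balakrishnan[OF ua s] have "(1 / ?c) *\<^sub>R A_power s u = Q (1 - s) a"
    unfolding has_bint_Ioi_def by (auto dest: has_bint_unique)
  then have "?c *\<^sub>R Q (1 - s) a = ?c *\<^sub>R (1 / ?c) *\<^sub>R A_power s u" by simp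
  then have A_power: "A_power s u = ?c *\<^sub>R Q (1 - s) a" using c by simp
  have "?c *\<^sub>R Q s (A_power s u) = (?c * (?c * (1 / ?c)\<^sup>2)) *\<^sub>R B a"
    unfolding A_power Q_scale[OF s] Q_Q[OF s] by simp
  also have "?c * (?c * (1 / ?c)\<^sup>2) = 1" using c by (simp add: power2_eq_square)
  finally have Q_A_power: "?c *\<^sub>R Q s (A_power s u) = u" using A_imp_B[OF ua] by simp
  \<comment> \<open>\<open>Q_Q\<close> for 1 - s in place of s makes Q_(1-s) Q_s a nonzero multiple
    of \<open>B\<close>, and \<open>B\<close> is injective because \<open>A\<close> is
    single-valued.\<close>
  have inj: "v = w" if "Q s v = Q s w" for v w
  proof -
    have s': "0 < 1 - s" "1 - s < 1" using s by auto
    have "Q (1 - s) (Q (1 - (1 - s)) v) = Q (1 - s) (Q (1 - (1 - s)) w)" using that by simp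
    then have "(pi / sin (pi * (1 - s)))\<^sup>2 *\<^sub>R B v = (pi / sin (pi * (1 - s)))\<^sup>2 *\<^sub>R B w"
      unfolding Q_Q[OF s'] .
    moreover have "sin (pi * (1 - s)) \<noteq> 0" using s' sin_gt_zero[of "pi * (1 - s)"] by simp
    ultimately have "B v = B w" by simp
    then show ?thesis using A_unique[of "B v" v w] B_in_A[of v] B_in_A[of w] by simp
  qed
  have "(u, w) \<in> (balakrishnan_power (A\<inverse>) s)\<inverse> \<longleftrightarrow> u = ?c *\<^sub>R Q s w"
    unfolding balakrishnan_power_A_inverse[OF s] by (auto simp: mult.commute)
  also have "\<dots> \<longleftrightarrow> ?c *\<^sub>R Q s (A_power s u) = ?c *\<^sub>R Q s w" unfolding Q_A_power ..
  also have "\<dots> \<longleftrightarrow> Q s (A_power s u) = Q s w" using c by (metis scaleR_cancel_left)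
  also have "\<dots> \<longleftrightarrow> w = A_power s u" using inj by auto
  finally show ?thesis .
qed

end

section \<open>Approximation by A + \<epsilon>I and the three cases together\<close>

context bounded_C0_semigroup
begin

lemma bounded_C0_semigroup_shift:
  assumes \<epsilon>: "0 \<le> \<epsilon>"
  shows "bounded_C0_semigroup (\<lambda>t u. exp (- (\<epsilon> * t)) *\<^sub>R T t u) M"
proof
  show "norm (exp (- (\<epsilon> * t)) *\<^sub>R T t u) \<le> M * norm u" if "0 \<le> t" for t u
  proof -
    have "exp (- (\<epsilon> * t)) * norm (T t u) \<le> 1 * (M * norm u)"
      using \<epsilon> that norm_T[of t u] by (intro mult_mono) auto
    then show ?thesis by simp
  qed
  show "C0_semigroup (\<lambda>t u. exp (- (\<epsilon> * t)) *\<^sub>R T t u)"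
    unfolding C0_semigroup_def
  proof (intro conjI allI impI)
    show "bounded_linear (\<lambda>u. exp (- (\<epsilon> * t)) *\<^sub>R T t u)" if "0 \<le> t" for t
      using bounded_linear_T[OF that] by (rule bounded_linear_const_scaleR)
    show "exp (- (\<epsilon> * 0)) *\<^sub>R T 0 u = u" for u by (simp add: T_zero)
    show "exp (- (\<epsilon> * a)) *\<^sub>R T a (exp (- (\<epsilon> * b)) *\<^sub>R T b u) = exp (- (\<epsilon> * (a + b))) *\<^sub>R T (a + b) u"
      if "0 \<le> a" "0 \<le> b" for a b u
    proof -
      have "exp (- (\<epsilon> * (a + b))) = exp (- (\<epsilon> * a)) * exp (- (\<epsilon> * b))"
        by (simp add: distrib_left exp_add[symmetric])
      then show ?thesis
        using that by (simp add: linear_scale[OF bounded_linear.linear[OF bounded_linear_T]] T_T)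
    qed
    show "((\<lambda>t. exp (- (\<epsilon> * t)) *\<^sub>R T t u) \<longlongrightarrow> u) (at_right 0)" for u
    proof -
      have "((\<lambda>t. exp (- (\<epsilon> * t)) *\<^sub>R T t u) \<longlongrightarrow> exp (- (\<epsilon> * 0)) *\<^sub>R u) (at_right 0)"
        by (intro tendsto_intros T_tendsto)
      then show ?thesis by simp
    qed
  qed
qed (rule M_pos)

text \<open>The two difference quotients differ by ((e^(-\<epsilon>t) - 1) / t) T_t u, which tends
  to - \<epsilon> u.\<close>

lemma inf_generator_shift:
  "(u, v - \<epsilon> *\<^sub>R u) \<in> inf_generator (\<lambda>t u. exp (- (\<epsilon> * t)) *\<^sub>R T t u) \<longleftrightarrow> (u, v) \<in> inf_generator T"
proof -
  let ?q = "\<lambda>t. (1 / t) *\<^sub>R (T t u - u)"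
  let ?q' = "\<lambda>t. (1 / t) *\<^sub>R (exp (- (\<epsilon> * t)) *\<^sub>R T t u - u)"
  let ?d = "\<lambda>t. ((exp (- (\<epsilon> * t)) - 1) / t) *\<^sub>R T t u"
  have "((\<lambda>t. (exp (- (\<epsilon> * t)) - 1) / t) \<longlongrightarrow> - \<epsilon>) (at_right 0)" by real_asymp
  then have d: "(?d \<longlongrightarrow> (- \<epsilon>) *\<^sub>R u) (at_right 0)" by (intro tendsto_intros T_tendsto)
  have eq: "?q' = (\<lambda>t. ?q t + ?d t)"
    by (simp add: fun_eq_iff scaleR_diff_right scaleR_diff_left diff_divide_distrib)
  then have eq': "?q = (\<lambda>t. ?q' t - ?d t)" by (simp add: fun_eq_iff)
  have "(?q' \<longlongrightarrow> v - \<epsilon> *\<^sub>R u) (at_right 0) \<longleftrightarrow> (?q \<longlongrightarrow> v) (at_right 0)"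
  proof
    assume "(?q' \<longlongrightarrow> v - \<epsilon> *\<^sub>R u) (at_right 0)"
    from tendsto_diff[OF this d] show "(?q \<longlongrightarrow> v) (at_right 0)" unfolding eq' by simp
  next
    assume "(?q \<longlongrightarrow> v) (at_right 0)"
    from tendsto_add[OF this d] show "(?q' \<longlongrightarrow> v - \<epsilon> *\<^sub>R u) (at_right 0)" unfolding eq by simp
  qed
  then show ?thesis by (simp add: inf_generator_def)
qed

lemma shift_A:
  "neg_op (inf_generator (\<lambda>t u. exp (- (\<epsilon> * t)) *\<^sub>R T t u)) = shift_op \<epsilon> A"
proof -
  have "(u, a) \<in> neg_op (inf_generator (\<lambda>t u. exp (- (\<epsilon> * t)) *\<^sub>R T t u)) \<longleftrightarrow> (u, a) \<in> shift_op \<epsilon> A" for u a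
  proof -
    have neg: "(u, c) \<in> neg_op G \<longleftrightarrow> (u, - c) \<in> G" for c and G :: "'a operator"
      unfolding neg_op_def by force
    have "(u, a) \<in> shift_op \<epsilon> A \<longleftrightarrow> (u, a - \<epsilon> *\<^sub>R u) \<in> A"
      unfolding shift_op_def by force
    also have "\<dots> \<longleftrightarrow> (u, \<epsilon> *\<^sub>R u - a) \<in> inf_generator T" by (simp add: neg)
    also have "\<dots> \<longleftrightarrow> (u, - a) \<in> inf_generator (\<lambda>t u. exp (- (\<epsilon> * t)) *\<^sub>R T t u)"
      using inf_generator_shift[of u "\<epsilon> *\<^sub>R u - a" \<epsilon>] by simp
    finally show ?thesis by (simp add: neg)
  qed
  then show ?thesis by auto
qed

lemma invertible_shift:
  assumes \<epsilon>: "0 < \<epsilon>"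
  shows "invertible_bounded_C0_semigroup (\<lambda>t u. exp (- (\<epsilon> * t)) *\<^sub>R T t u) M (R \<epsilon>)"
proof (intro invertible_bounded_C0_semigroup.intro invertible_bounded_C0_semigroup_axioms.intro)
  show "bounded_C0_semigroup (\<lambda>t u. exp (- (\<epsilon> * t)) *\<^sub>R T t u) M"
    using \<epsilon> by (intro bounded_C0_semigroup_shift) simp
  show "bounded_linear (R \<epsilon>)" by (rule bounded_linear_R[OF \<epsilon>])
  have "(p, w) \<in> shift_op \<epsilon> A \<longleftrightarrow> p = R \<epsilon> w" for p w
    using R_A[OF \<epsilon>] R_in_A[OF \<epsilon>, of w] unfolding shift_op_def by force
  then show "(neg_op (inf_generator (\<lambda>t u. exp (- (\<epsilon> * t)) *\<^sub>R T t u)))\<inverse> = {(w, R \<epsilon> w) | w. True}"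
    unfolding shift_A by auto
qed

text \<open>The integrands differ by t^(-1-s) (1 - e^(-\<epsilon>t)) T_t u. The scalar weight
  integrates to \<epsilon>^s Gamma(1-s) / s, so the two powers differ by at most \<epsilon>^s M norm
  u.\<close>

lemma A_power_shift_tendsto:
  assumes ua: "(u, a) \<in> A" and s: "0 < s" "s < 1"
  shows "((\<lambda>\<epsilon>. bounded_C0_semigroup.A_power (\<lambda>t u. exp (- (\<epsilon> * t)) *\<^sub>R T t u) s u) \<longlongrightarrow> A_power s u)
    (at_right 0)"
proof -
  let ?c = "Gamma (1 - s) / s"
  have c: "0 < ?c" using s Gamma_real_pos[of "1 - s"] by simp
  let ?P = "\<lambda>\<epsilon>. bounded_C0_semigroup.A_power (\<lambda>t u. exp (- (\<epsilon> * t)) *\<^sub>R T t u) s u"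
  have "norm (?P \<epsilon> - A_power s u) \<le> \<epsilon> powr s * (M * norm u)" if \<epsilon>: "0 < \<epsilon>" for \<epsilon>
  proof -
    interpret S: bounded_C0_semigroup "\<lambda>t u. exp (- (\<epsilon> * t)) *\<^sub>R T t u" M
      using \<epsilon> by (intro bounded_C0_semigroup_shift) simp
    have ua': "(u, \<epsilon> *\<^sub>R u + a) \<in> S.A" using ua unfolding shift_A shift_op_def by blast
    have d: "has_bochner_integral lborel_pos (\<lambda>t. M * norm u * (t powr (- 1 - s) * (1 - exp (- (\<epsilon> * t)))))
        (M * norm u * (\<epsilon> powr s * ?c))"
      by (intro has_bochner_integral_mult_right has_bochner_integral_one_minus_exp s \<epsilon>)
    have "norm (?c *\<^sub>R S.A_power s u - ?c *\<^sub>R A_power s u)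
        \<le> (LINT t|lborel_pos. M * norm u * (t powr (- 1 - s) * (1 - exp (- (\<epsilon> * t)))))"
    proof (rule has_bint_Ioi_norm_diff_le[OF S.has_bint_A_power[OF ua' s] S.continuous_on_A_power_integrand
          has_bint_A_power[OF ua s] continuous_on_A_power_integrand])
      fix t :: real assume t: "0 < t"
      have "t powr (- 1 - s) *\<^sub>R (u - exp (- (\<epsilon> * t)) *\<^sub>R T t u) - t powr (- 1 - s) *\<^sub>R (u - T t u)
          = (t powr (- 1 - s) * (1 - exp (- (\<epsilon> * t)))) *\<^sub>R T t u"
        by (simp add: algebra_simps)
      moreover have "0 \<le> t powr (- 1 - s) * (1 - exp (- (\<epsilon> * t)))" using t \<epsilon> by simp
      ultimately have "norm (t powr (- 1 - s) *\<^sub>R (u - exp (- (\<epsilon> * t)) *\<^sub>R T t u) - t powr (- 1 - s) *\<^sub>R (u - T t u))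
          = t powr (- 1 - s) * (1 - exp (- (\<epsilon> * t))) * norm (T t u)"
        by simp
      also have "\<dots> \<le> t powr (- 1 - s) * (1 - exp (- (\<epsilon> * t))) * (M * norm u)"
        using t \<epsilon> by (intro mult_left_mono norm_T) auto
      finally show "norm (t powr (- 1 - s) *\<^sub>R (u - exp (- (\<epsilon> * t)) *\<^sub>R T t u) - t powr (- 1 - s) *\<^sub>R (u - T t u))
          \<le> M * norm u * (t powr (- 1 - s) * (1 - exp (- (\<epsilon> * t))))"
        by (simp only: mult.commute)
    qed (use d in \<open>simp add: has_bochner_integral_iff\<close>)
    also have "norm (?c *\<^sub>R S.A_power s u - ?c *\<^sub>R A_power s u) = ?c * norm (S.A_power s u - A_power s u)"
      by (simp only: scaleR_diff_right[symmetric] norm_scaleR abs_of_pos[OF c])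
    also have "(LINT t|lborel_pos. M * norm u * (t powr (- 1 - s) * (1 - exp (- (\<epsilon> * t)))))
        = M * norm u * (\<epsilon> powr s * ?c)"
      by (rule has_bochner_integral_integral_eq[OF d])
    also have "\<dots> = ?c * (\<epsilon> powr s * (M * norm u))" by (simp only: mult_ac)
    finally show ?thesis using c by (simp only: mult_le_cancel_left_pos)
  qed
  then have "\<forall>\<^sub>F \<epsilon> in at_right 0. norm (?P \<epsilon> - A_power s u) \<le> \<epsilon> powr s * (M * norm u)"
    by (rule eventually_at_right_less[THEN eventually_mono])
  moreover have "((\<lambda>\<epsilon>. \<epsilon> powr s * (M * norm u)) \<longlongrightarrow> 0) (at_right 0)"
    using s by real_asymp
  ultimately have "((\<lambda>\<epsilon>. ?P \<epsilon> - A_power s u) \<longlongrightarrow> 0) (at_right 0)"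
    by (rule Lim_null_comparison)
  then show ?thesis by (rule LIM_zero_cancel)
qed

text \<open>The equivalence contains both facts that \<open>log_op\<close> asks for: u lies in the
  domain of the power, and \<open>op_app\<close> picks a unique value.\<close>

lemma frac_power_A:
  assumes ua: "(u, a) \<in> A" and s: "0 < s" "s < 1"
  shows "(u, w) \<in> frac_power A s \<longleftrightarrow> w = A_power s u"
proof -
  consider "bounded_op A" | "\<not> bounded_op A" "has_bounded_inverse A"
    | "\<not> bounded_op A" "\<not> has_bounded_inverse A" by blast
  then show ?thesis
  proof cases
    case 1
    let ?c = "sin (s * pi) / pi"
    have c: "?c \<noteq> 0" using s sin_gt_zero[of "s * pi"] by simp
    have dom: "u \<in> Domain A" using ua by blast
    have "has_bint_Ioi (\<lambda>\<mu>. \<mu> powr (s - 1) *\<^sub>R op_app ((shift_op \<mu> A)\<inverse>) (op_app A u)) v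
        \<longleftrightarrow> v = (1 / ?c) *\<^sub>R A_power s u" for v
    proof -
      have "has_bint_Ioi (\<lambda>\<mu>. \<mu> powr (s - 1) *\<^sub>R op_app ((shift_op \<mu> A)\<inverse>) (op_app A u)) v
          \<longleftrightarrow> has_bint_Ioi (\<lambda>\<mu>. \<mu> powr (s - 1) *\<^sub>R R \<mu> a) v"
        by (intro has_bint_Ioi_cong) (simp add: op_app_A[OF ua] op_app_shift_inverse)
      also have "\<dots> \<longleftrightarrow> v = (1 / ?c) *\<^sub>R A_power s u"
        using has_bint_Balakrishnan[OF ua s] unfolding has_bint_Ioi_def
        by (auto simp: mult.commute dest: has_bint_unique)
      finally show ?thesis .
    qed
    then have "(u, w) \<in> balakrishnan_power A s \<longleftrightarrow> w = ?c *\<^sub>R (1 / ?c) *\<^sub>R A_power s u"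
      using dom unfolding balakrishnan_power_def by auto
    also have "?c *\<^sub>R (1 / ?c) *\<^sub>R A_power s u = A_power s u" using c by simp
    finally show ?thesis using 1 by (simp add: frac_power_def)
  next
    case 2
    then obtain B where "bounded_linear B" "A\<inverse> = {(w, B w) | w. True}"
      unfolding has_bounded_inverse_def by blast
    then interpret invertible_bounded_C0_semigroup T M B
      by (intro invertible_bounded_C0_semigroup.intro[OF bounded_C0_semigroup_axioms]
          invertible_bounded_C0_semigroup_axioms.intro)
    show ?thesis
      using 2 inverse_balakrishnan_power_A_inverse[OF ua s] by (simp add: frac_power_def)
  next
    case 3
    define P where "P \<epsilon> = (balakrishnan_power ((shift_op \<epsilon> A)\<inverse>) s)\<inverse>" for \<epsilon>
    let ?p = "\<lambda>\<epsilon>. bounded_C0_semigroup.A_power (\<lambda>t u. exp (- (\<epsilon> * t)) *\<^sub>R T t u) s u"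
    have P: "(u, v) \<in> P \<epsilon> \<longleftrightarrow> v = ?p \<epsilon>" if \<epsilon>: "0 < \<epsilon>" for \<epsilon> v
    proof -
      interpret S: invertible_bounded_C0_semigroup "\<lambda>t u. exp (- (\<epsilon> * t)) *\<^sub>R T t u" M "R \<epsilon>"
        by (rule invertible_shift[OF \<epsilon>])
      have "(u, \<epsilon> *\<^sub>R u + a) \<in> S.A" using ua unfolding shift_A shift_op_def by blast
      from S.inverse_balakrishnan_power_A_inverse[OF this s] show ?thesis
        unfolding P_def shift_A .
    qed
    have dom: "\<forall>\<^sub>F \<epsilon> in at_right 0. u \<in> Domain (P \<epsilon>)"
      by (rule eventually_at_right_less[THEN eventually_mono]) (use P in blast)
    have "\<forall>\<^sub>F \<epsilon> in at_right 0. ?p \<epsilon> = op_app (P \<epsilon>) u"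
      by (rule eventually_at_right_less[THEN eventually_mono]) (simp add: op_app_def P)
    from Lim_transform_eventually[OF A_power_shift_tendsto[OF ua s] this]
    have lim: "((\<lambda>\<epsilon>. op_app (P \<epsilon>) u) \<longlongrightarrow> A_power s u) (at_right 0)" .
    have "(u, w) \<in> frac_power A s \<longleftrightarrow> ((\<lambda>\<epsilon>. op_app (P \<epsilon>) u) \<longlongrightarrow> w) (at_right 0)"
      using 3 dom by (simp add: frac_power_def Let_def P_def)
    also have "\<dots> \<longleftrightarrow> w = A_power s u"
      using lim by (auto intro: tendsto_unique[rotated])
    finally show ?thesis .
  qed
qed

section \<open>The logarithm\<close>

lemma has_bint_exp_diff:
  assumes ua: "(u, a) \<in> A" and s: "0 < s" "s < 1"
  shows "has_bint_Ioi (\<lambda>t. (1 / t powr (1 + s)) *\<^sub>R (exp (- t) *\<^sub>R u - T t u))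
    ((Gamma (1 - s) / s) *\<^sub>R (A_power s u - u))"
proof (rule iffD2[OF has_bint_Ioi_cong])
  let ?f = "\<lambda>t. t powr (- 1 - s) *\<^sub>R (exp (- t) *\<^sub>R u - T t u)"
  show "(1 / t powr (1 + s)) *\<^sub>R (exp (- t) *\<^sub>R u - T t u) = ?f t" if "0 < t" for t
    using powr_minus_divide[of t "1 + s"] by simp
  have cont: "continuous_on {0<..} ?f"
    by (intro continuous_intros continuous_on_T) auto
  obtain K where K: "\<And>t. 0 < t \<Longrightarrow> norm (u - T t u) \<le> K * min 1 t"
    using norm_diff_T_le[OF ua] by blast
  \<comment> \<open>The integrand is split around u. The product \<open>1 * t\<close> makes the
    second term the case c = 1 of \<open>has_bochner_integral_one_minus_exp\<close>.\<close>
  have f_eq: "?f t = t powr (- 1 - s) *\<^sub>R (u - T t u) - (t powr (- 1 - s) * (1 - exp (- (1 * t)))) *\<^sub>R u" for t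
    by (simp add: algebra_simps)
  show "has_bint_Ioi ?f ((Gamma (1 - s) / s) *\<^sub>R (A_power s u - u))"
  proof (rule has_bint_IoiI[OF _ cont])
    show "bintegrable_Ioi ?f"
    proof (rule bintegrable_Ioi_dominated[OF cont])
      show "integrable lborel_pos (\<lambda>t. (K + norm u) * (t powr (- 1 - s) * min 1 t))"
        by (intro integrable_mult_right integrable_powr_min s)
      fix t :: real assume t: "0 < t"
      have "exp (- t) *\<^sub>R u - T t u = (u - T t u) - (1 - exp (- t)) *\<^sub>R u"
        by (simp add: algebra_simps)
      then have "norm (exp (- t) *\<^sub>R u - T t u) \<le> norm (u - T t u) + norm ((1 - exp (- t)) *\<^sub>R u)"
        by (metis norm_triangle_ineq4)
      also have "norm ((1 - exp (- t)) *\<^sub>R u) \<le> min 1 t * norm u"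
      proof -
        have "\<bar>1 - exp (- t)\<bar> \<le> min 1 t" using t exp_ge_add_one_self[of "- t"] by simp
        then show ?thesis unfolding norm_scaleR by (rule mult_right_mono) simp
      qed
      also have "norm (u - T t u) + min 1 t * norm u \<le> (K + norm u) * min 1 t"
        using K[OF t] by (simp add: algebra_simps)
      finally have "t powr (- 1 - s) * norm (exp (- t) *\<^sub>R u - T t u)
          \<le> t powr (- 1 - s) * ((K + norm u) * min 1 t)"
        by (intro mult_left_mono) auto
      then show "norm (?f t) \<le> (K + norm u) * (t powr (- 1 - s) * min 1 t)"
        by (simp add: mult.left_commute)
    qed
    fix \<phi> :: "'a \<Rightarrow> real" assume lin: "linear \<phi>" and "\<And>x. \<bar>\<phi> x\<bar> \<le> norm x"
    then have \<phi>: "bounded_linear \<phi>" by (rule bounded_linear_functional)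
    interpret \<phi>: bounded_linear \<phi> by (rule \<phi>)
    have "has_bochner_integral lborel_pos
        (\<lambda>t. \<phi> (t powr (- 1 - s) *\<^sub>R (u - T t u)) - t powr (- 1 - s) * (1 - exp (- (1 * t))) * \<phi> u)
        (\<phi> ((Gamma (1 - s) / s) *\<^sub>R A_power s u) - 1 powr s * (Gamma (1 - s) / s) * \<phi> u)"
      by (intro has_bochner_integral_diff has_bochner_integral_mult_left
          has_bochner_integral_one_minus_exp s zero_less_one
          has_bint_Ioi_bounded_linear[OF has_bint_A_power[OF ua s] continuous_on_A_power_integrand \<phi>])
    then have "(LINT t|lborel_pos. \<phi> (?f t))
        = \<phi> ((Gamma (1 - s) / s) *\<^sub>R A_power s u) - 1 powr s * (Gamma (1 - s) / s) * \<phi> u"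
      unfolding f_eq \<phi>.diff \<phi>.scaleR by (simp add: has_bochner_integral_iff)
    then show "(LINT t|lborel_pos. \<phi> (?f t)) = \<phi> ((Gamma (1 - s) / s) *\<^sub>R (A_power s u - u))"
      by (simp add: \<phi>.diff \<phi>.scaleR right_diff_distrib diff_divide_distrib)
  qed
qed

lemma log_op_A:
  assumes ua: "(u, a) \<in> A"
  shows "(u, v) \<in> log_op A \<longleftrightarrow>
    ((\<lambda>s. (1 / Gamma (1 - s)) *\<^sub>R bint_Ioi (\<lambda>t. (1 / t powr (1 + s)) *\<^sub>R (exp (- t) *\<^sub>R u - T t u))) \<longlongrightarrow> v)
      (at_right 0)"
proof -
  let ?F = "\<lambda>s. (1 / Gamma (1 - s)) *\<^sub>R bint_Ioi (\<lambda>t. (1 / t powr (1 + s)) *\<^sub>R (exp (- t) *\<^sub>R u - T t u))"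
  have small: "\<forall>\<^sub>F s in at_right 0. 0 < s \<and> s < (1 :: real)"
    unfolding eventually_at_right_field by (intro exI[of _ 1]) auto
  have dom: "\<forall>\<^sub>F s in at_right 0. u \<in> Domain (frac_power A s)"
    using small by eventually_elim (use frac_power_A[OF ua] in blast)
  have "(1 / s) *\<^sub>R (op_app (frac_power A s) u - u) = ?F s" if s: "0 < s" "s < 1" for s
  proof -
    have "op_app (frac_power A s) u = A_power s u"
      unfolding op_app_def frac_power_A[OF ua s] by simp
    moreover have "Gamma (1 - s) \<noteq> 0" using Gamma_real_pos[of "1 - s"] s by linarith
    ultimately show ?thesis
      using s by (simp add: bint_Ioi_eq[OF has_bint_exp_diff[OF ua s]])
  qed
  with small have "\<forall>\<^sub>F s in at_right 0. (1 / s) *\<^sub>R (op_app (frac_power A s) u - u) = ?F s"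
    by (auto elim: eventually_mono)
  from tendsto_cong[OF this] dom show ?thesis by (simp add: log_op_def)
qed

text \<open>For t > 1 the factor t^(-s) is at most 1, and the assumed integrability of
  \<open>?h\<close> controls the tail. For t \<le> 1 that factor is singular, but \<open>?h\<close>
  is bounded there because u lies in D(A). Dominated convergence is applied to the norm of the
  difference of the integrands.\<close>

lemma tendsto_bint_exp_diff:
  assumes ua: "(u, a) \<in> A"
    and h: "bintegrable_Ioi (\<lambda>t. (1 / t) *\<^sub>R (exp (- t) *\<^sub>R u - T t u))" (is "bintegrable_Ioi ?h")
  shows "((\<lambda>s. (1 / Gamma (1 - s)) *\<^sub>R bint_Ioi (\<lambda>t. (1 / t powr (1 + s)) *\<^sub>R (exp (- t) *\<^sub>R u - T t u)))
    \<longlongrightarrow> bint_Ioi ?h) (at_right 0)"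
proof -
  let ?g = "\<lambda>s t. (1 / t powr (1 + s)) *\<^sub>R (exp (- t) *\<^sub>R u - T t u)"
  have g_cont: "continuous_on {0<..} (?g s)" for s
    by (intro continuous_intros continuous_on_T) auto
  have h_cont: "continuous_on {0<..} ?h"
    by (intro continuous_intros continuous_on_T) auto
  have h_int: "integrable lborel_pos (\<lambda>t. norm (?h t))"
    by (rule integrable_norm_bintegrable_Ioi[OF h h_cont])
  have h_bint: "has_bint_Ioi ?h (bint_Ioi ?h)" using h by (auto simp: bintegrable_Ioi_def bint_Ioi_eq)
  obtain K where K: "\<And>t. 0 < t \<Longrightarrow> norm (u - T t u) \<le> K * min 1 t"
    using norm_diff_T_le[OF ua] by blast
  have gh: "?g s t = t powr (- s) *\<^sub>R ?h t" if "0 < t" for s t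
    using that powr_minus_divide[of t s] by (simp add: powr_add)
  have g_bint: "has_bint_Ioi (?g s) (bint_Ioi (?g s))" if "0 < s" "s < 1" for s
    using has_bint_exp_diff[OF ua that] bint_Ioi_eq[OF has_bint_exp_diff[OF ua that]] by simp
  let ?D = "\<lambda>s t. \<bar>t powr (- s) - 1\<bar> * norm (?h t)"
  \<comment> \<open>The exponent is that of \<open>integrable_powr_min\<close> for s = 1/2: if s <
    1/2 and t \<le> 1, then t^(-s) - 1 is at most t^(-1/2) = t^(-1-1/2) min 1 t.\<close>
  let ?w = "\<lambda>t. norm (?h t) + (K + norm u) * (t powr (- 1 - 1 / 2) * min 1 t)"
  have w_int: "integrable lborel_pos ?w"
    by (intro Bochner_Integration.integrable_add h_int integrable_mult_right integrable_powr_min) auto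
  have norm_h: "norm (?h t) \<le> K + norm u" if t: "0 < t" "t \<le> 1" for t
  proof -
    have "exp (- t) *\<^sub>R u - T t u = (u - T t u) - (1 - exp (- t)) *\<^sub>R u"
      by (simp add: algebra_simps)
    then have "norm (exp (- t) *\<^sub>R u - T t u) \<le> norm (u - T t u) + norm ((1 - exp (- t)) *\<^sub>R u)"
      by (metis norm_triangle_ineq4)
    also have "norm ((1 - exp (- t)) *\<^sub>R u) \<le> t * norm u"
      using t exp_ge_add_one_self[of "- t"] by (auto intro!: mult_right_mono)
    also have "norm (u - T t u) + t * norm u \<le> t * (K + norm u)"
      using K[OF t(1)] t by (simp add: distrib_left mult.commute min_def split: if_splits)
    finally show ?thesis using t by (simp add: divide_le_eq mult.commute)
  qed
  have D_le: "?D s t \<le> ?w t" if s: "0 < s" "s < 1 / 2" and t: "0 < t" for s t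
  proof (cases "t \<le> 1")
    case False
    then have "t powr (- s) \<le> t powr 0" using s by (intro powr_mono) auto
    then have "\<bar>t powr (- s) - 1\<bar> \<le> 1" using t by (simp add: abs_le_iff)
    then have "?D s t \<le> norm (?h t)" by (intro mult_left_le_one_le) auto
    moreover have "0 \<le> K + norm u" using order_trans[OF norm_ge_zero norm_h[of 1]] by simp
    then have "0 \<le> (K + norm u) * (t powr (- 1 - 1 / 2) * min 1 t)"
      using t by (intro mult_nonneg_nonneg) auto
    ultimately show ?thesis by linarith
  next
    case True
    have "t powr (- s) \<le> t powr (- 1 / 2)" using True t s by (intro powr_mono') auto
    moreover have "t powr (- s) \<ge> t powr 0" using True t s by (intro powr_mono') auto
    ultimately have "\<bar>t powr (- s) - 1\<bar> \<le> t powr (- 1 / 2)" using t by simp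
    then have "?D s t \<le> t powr (- 1 / 2) * (K + norm u)"
      using norm_h[OF t True] by (intro mult_mono) auto
    also have "t powr (- 1 / 2) = t powr (- 1 - 1 / 2) * min 1 t"
      using t True powr_add[of t "- 1 - 1 / 2" 1] by (simp add: min_def)
    finally have "?D s t \<le> (K + norm u) * (t powr (- 1 - 1 / 2) * min 1 t)"
      by (simp only: mult.commute)
    then show ?thesis by (rule order_trans) simp
  qed
  \<comment> \<open>The limit is tested along sequences in (0, 1/2), the range where
    \<open>?w\<close> is a majorant.\<close>
  have lim: "((\<lambda>s. bint_Ioi (?g s)) \<longlongrightarrow> bint_Ioi ?h) (at_right 0)"
  proof (rule tendsto_at_right_sequentially[where b = "1 / 2"])
    fix S :: "nat \<Rightarrow> real" assume S: "\<And>n. 0 < S n" "\<And>n. S n < 1 / 2" "S \<longlonglongrightarrow> 0"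
    have D_meas: "?D s \<in> borel_measurable lborel_pos" for s
      by (intro borel_measurable_lborel_pos continuous_intros continuous_on_T) auto
    have "(\<lambda>n. integral\<^sup>L lborel_pos (?D (S n))) \<longlonglongrightarrow> (LINT t|lborel_pos. 0 * t)"
    proof (rule integral_dominated_convergence[where w = ?w])
      show "AE t in lborel_pos. (\<lambda>n. ?D (S n) t) \<longlonglongrightarrow> 0 * t"
        using AE_lborel_pos
      proof eventually_elim
        case (elim t)
        have "(\<lambda>n. ?D (S n) t) \<longlonglongrightarrow> \<bar>t powr (- 0) - 1\<bar> * norm (?h t)"
          using elim by (intro tendsto_intros S) auto
        then show ?case using elim by simp
      qed
      show "AE t in lborel_pos. norm (?D (S n) t) \<le> ?w t" for n
        using AE_lborel_pos
      proof eventually_elim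
        case (elim t)
        then show ?case using D_le[OF S(1,2) elim, of n] by (simp add: abs_mult)
      qed
    qed (use w_int D_meas in auto)
    then have D_lim: "(\<lambda>n. integral\<^sup>L lborel_pos (?D (S n))) \<longlonglongrightarrow> 0" by simp
    have D_int: "integrable lborel_pos (?D (S n))" for n
    proof (rule Bochner_Integration.integrable_bound[OF w_int D_meas])
      show "AE t in lborel_pos. norm (?D (S n) t) \<le> norm (?w t)"
        using AE_lborel_pos
      proof eventually_elim
        case (elim t)
        have "norm (?D (S n) t) = ?D (S n) t" by (simp add: abs_mult)
        also have "\<dots> \<le> ?w t" by (rule D_le[OF S(1,2) elim])
        also have "\<dots> \<le> norm (?w t)" by simp
        finally show ?case .
      qed
    qed
    have "norm (bint_Ioi (?g (S n)) - bint_Ioi ?h) \<le> integral\<^sup>L lborel_pos (?D (S n))" for n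
    proof (rule has_bint_Ioi_norm_diff_le[OF g_bint g_cont h_bint h_cont D_int])
      show "S n < 1" using S(2)[of n] by simp
      fix t :: real assume "0 < t"
      from gh[OF this] have "?g (S n) t - ?h t = (t powr (- S n) - 1) *\<^sub>R ?h t"
        by (simp only: scaleR_diff_left scaleR_one)
      then show "norm (?g (S n) t - ?h t) \<le> ?D (S n) t" by (simp only: norm_scaleR real_norm_def order_refl)
    qed (rule S(1))
    then have "(\<lambda>n. bint_Ioi (?g (S n)) - bint_Ioi ?h) \<longlonglongrightarrow> 0"
      by (intro Lim_null_comparison[OF _ D_lim] always_eventually allI)
    then show "(\<lambda>n. bint_Ioi (?g (S n))) \<longlonglongrightarrow> bint_Ioi ?h" by (rule LIM_zero_cancel)
  qed simp
  have "((\<lambda>s. 1 / Gamma (1 - s)) \<longlongrightarrow> 1 / Gamma (1 - 0 :: real)) (at_right 0)"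
    by (intro tendsto_intros) (auto simp: nonpos_Ints_def)
  then have "((\<lambda>s. 1 / Gamma (1 - s) :: real) \<longlongrightarrow> 1) (at_right 0)" by simp
  from tendsto_scaleR[OF this lim] show ?thesis by simp
qed

end

text \<open>The first formula equates partially defined objects: for L = 0 and u \<noteq> 0 one has
  F s = - u / s, which has no limit. It is therefore stated as an equivalence for the domain
  together with the value on it. The second, formal one becomes exact once its integrand is Bochner
  integrable, and then membership in the domain is part of the conclusion.\<close>

theorem proposition3p2:
  fixes T :: "real \<Rightarrow> 'a::banach \<Rightarrow> 'a" and L :: "'a operator" and u :: 'a
  assumes "C0_semigroup T"
    and "uniformly_bounded_semigroup T"
    and "L = inf_generator T"
    and "u \<in> Domain L"
  shows "let g = (\<lambda>s t. (1 / t powr (1 + s)) *\<^sub>R (exp (- t) *\<^sub>R u - T t u));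
             F = (\<lambda>s. (1 / Gamma (1 - s)) *\<^sub>R bint_Ioi (g s));
             h = (\<lambda>t. (1 / t) *\<^sub>R (exp (- t) *\<^sub>R u - T t u))
         in (\<forall>s. 0 < s \<and> s < 1 \<longrightarrow> bintegrable_Ioi (g s))
          \<and> (u \<in> Domain (log_op (neg_op L)) \<longleftrightarrow> (\<exists>v. (F \<longlongrightarrow> v) (at_right 0)))
          \<and> (u \<in> Domain (log_op (neg_op L)) \<longrightarrow>
               (F \<longlongrightarrow> op_app (log_op (neg_op L)) u) (at_right 0))
          \<and> (bintegrable_Ioi h \<longrightarrow>
               u \<in> Domain (log_op (neg_op L)) \<and>
               op_app (log_op (neg_op L)) u = bint_Ioi h)"
proof -
  obtain M where "0 < M" "\<And>u t. 0 \<le> t \<Longrightarrow> norm (T t u) \<le> M * norm u"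
    using assms(2) unfolding uniformly_bounded_semigroup_def by blast
  with assms(1) interpret bounded_C0_semigroup T M by unfold_locales
  obtain a where ua: "(u, a) \<in> A"
    using assms(3,4) unfolding neg_op_def by blast
  define F where "F s = (1 / Gamma (1 - s)) *\<^sub>R
    bint_Ioi (\<lambda>t. (1 / t powr (1 + s)) *\<^sub>R (exp (- t) *\<^sub>R u - T t u))" for s
  have log: "(u, v) \<in> log_op A \<longleftrightarrow> (F \<longlongrightarrow> v) (at_right 0)" for v
    unfolding F_def by (rule log_op_A[OF ua])
  have app: "op_app (log_op A) u = v" if "(F \<longlongrightarrow> v) (at_right 0)" for v
    unfolding op_app_def log
    by (rule the_equality) (use that in \<open>auto intro: tendsto_unique[rotated]\<close>)
  have "bintegrable_Ioi (\<lambda>t. (1 / t powr (1 + s)) *\<^sub>R (exp (- t) *\<^sub>R u - T t u))" if "0 < s" "s < 1" for s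
    using has_bint_exp_diff[OF ua that] unfolding bintegrable_Ioi_def by blast
  moreover have dom: "u \<in> Domain (log_op A) \<longleftrightarrow> (\<exists>v. (F \<longlongrightarrow> v) (at_right 0))"
    unfolding log[symmetric] by blast
  moreover have "(F \<longlongrightarrow> op_app (log_op A) u) (at_right 0)" if "u \<in> Domain (log_op A)"
    using that app unfolding dom by metis
  moreover have "u \<in> Domain (log_op A) \<and>
      op_app (log_op A) u = bint_Ioi (\<lambda>t. (1 / t) *\<^sub>R (exp (- t) *\<^sub>R u - T t u))"
    if "bintegrable_Ioi (\<lambda>t. (1 / t) *\<^sub>R (exp (- t) *\<^sub>R u - T t u))"
    using tendsto_bint_exp_diff[OF ua that] app unfolding dom F_def[abs_def] by blast
  ultimately show ?thesis
    unfolding Let_def assms(3) F_def[abs_def] by blast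
qed

end
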